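(* Let $a<b$ be real numbers, $n\ge 1$ an integer, $0<d<\pi/2$, $0<\alpha\le 1$, and $\mathbf{r}\in\mathbb{C}^n$. Let $K=[k_{ij}]$ be an $n\times n$ matrix of functions and $\mathbf{g}=[g_1,\ldots,g_n]^{\mathrm T}$ a vector of functions, and put $Q(z)=(z-a)(b-z)$. Assume that $k_{ij}Q\in \mathbf{L}_{\alpha}(\psi^{\mathrm{DE}}(\mathscr{D}_d))$ for all $i,j=1,\ldots,n$ and $g_iQ\in \mathbf{L}_{\alpha}(\psi^{\mathrm{DE}}(\mathscr{D}_d))$ for all $i=1,\ldots,n$. Let $\mathbf{y}=[y_1,\ldots,y_n]^{\mathrm T}$ be the solution of $\mathbf{y}'(t)=K(t)\mathbf{y}(t)+\mathbf{g}(t)$ $(a\le t\le b)$, $\mathbf{y}(a)=\mathbf{r}$, and for each positive integer $N$ let $h=\log(2dN/\alpha)/N$. Then there exist $N_0$ and a constant $C$ independent of $N$ such that for all $N\ge N_0$ the DE-Sinc linear system (defined in the context) is uniquely solvable, and the DE-Sinc-collocation solution $\tilde{\mathbf{y}}^{(N)}=[\tilde y_1^{(N)},\ldots,\tilde y_n^{(N)}]^{\mathrm T}$ (defined in the context) satisfies $$\max_{i=1,\ldots,n}\Bigl\{\max_{a\le t\le b}|y_i(t)-\tilde y_i^{(N)}(t)|\Bigr\}\le C\exp\left\{\frac{-\pi dN}{\log(2dN/\alpha)}\right\}.$$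
   Context: $\mathscr{D}_d=\{\zeta\in\mathbb{C}:|\operatorname{Im}\zeta|<d\}$, $\psi^{\mathrm{DE}}(\zeta)=\frac{b-a}{2}\tanh\left(\frac{\pi}{2}\sinh\zeta\right)+\frac{b+a}{2}$, with inverse $\phi^{\mathrm{DE}}(t)=\operatorname{arcsinh}\left[\frac{2}{\pi}\operatorname{arctanh}\left(\frac{2t-b-a}{b-a}\right)\right]$ on $(a,b)$. The image $\mathscr{D}=\psi^{\mathrm{DE}}(\mathscr{D}_d)$ is regarded as a Riemann surface (since $\psi^{\mathrm{DE}}$ is not injective on $\mathscr{D}_d$). Concretely, a function $f$ on $\mathscr{D}$ is identified with the function $F$ on $\mathscr{D}_d$, written $F(\zeta)=f(\psi^{\mathrm{DE}}(\zeta))$, and is called analytic if $F$ is analytic; in inequalities "for all $z\in\mathscr{D}$", $f(z)$ means $F(\zeta)$ and $z$ means $\psi^{\mathrm{DE}}(\zeta)$, for all $\zeta\in\mathscr{D}_d$. The interval $(a,b)$ corresponds to $\zeta\in\mathbb{R}$. For $\alpha>0$, $\mathbf{L}_{\alpha}(\mathscr{D})$ is the set of bounded analytic functions $f$ on $\mathscr{D}$ for which there is a constant $L$ with $|f(z)|\le L|Q(z)|^{\alpha}$ for all $z\in\mathscr{D}$, where $Q(z)=(z-a)(b-z)$. The initial value problem is understood in the equivalent integrated form $\mathbf{y}(t)=\mathbf{r}+\int_a^t\{\mathbf{g}(s)+K(s)\mathbf{y}(s)\}\,ds$, $a\le t\le b$, with $\mathbf{y}$ continuous on $[a,b]$ ($k_{ij},g_i$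 may have integrable singularities at $a,b$); under the stated assumptions it has a unique solution. Sampling points: $t_j^{\mathrm{DE}}=\psi^{\mathrm{DE}}(jh)$, $j=-N,\ldots,N$. Sine integral: $\operatorname{Si}(x)=\int_0^x\frac{\sin u}{u}\,du$. DE-Sinc linear system: let $\sigma_k=\frac12+\frac1\pi\operatorname{Si}(\pi k)$, $I_N^{(-1)}=[\sigma_{i-j}]_{i,j=-N}^{N}$ (a $(2N+1)\times(2N+1)$ matrix), $D_N^{\mathrm{DE}}=\operatorname{diag}[(\psi^{\mathrm{DE}})'(-Nh),\ldots,(\psi^{\mathrm{DE}})'(Nh)]$, $K_{ij}^{\mathrm{DE}}=\operatorname{diag}[k_{ij}(t_{-N}^{\mathrm{DE}}),\ldots,k_{ij}(t_N^{\mathrm{DE}})]$, and $[K_{ij}^{\mathrm{DE}}]$ the $n\times n$ block matrix with blocks $K_{ij}^{\mathrm{DE}}$. Let $I_N$, $I_n$ be the identity matrices of order $2N+1$ and $n$, respectively. Let $\mathbf{R}=[r_1,\ldots,r_1,r_2,\ldots,r_2,\ldots,r_n]^{\mathrm T}$ (each $r_i$ repeated $2N+1$ times) and $\mathbf{G}^{\mathrm{DE}}=[g_1(t_{-N}^{\mathrm{DE}}),\ldots,g_1(t_N^{\mathrm{DE}}),\ldots,g_n(t_{-N}^{\mathrm{DE}}),\ldots,g_n(t_N^{\mathrm{DE}})]^{\mathrm T}$. The system for the unknown vector $\mathbf{Y}$ of order $(2N+1)n$ is $$\bigl(I_n\otimes I_N-\bigl(I_n\otimes\{hI_N^{(-1)}D_N^{\mathrm{DE}}\}\bigr)[K_{ij}^{\mathrm{DE}}]\bigr)\mathbf{Y}=\bigl(I_n\otimes\{hI_N^{(-1)}D_N^{\mathrm{DE}}\}\bigr)\mathbf{G}^{\mathrm{DE}}+\mathbf{R},$$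 where $\otimes$ is the Kronecker product. DE-Sinc-collocation solution: write the solution of the system as $\mathbf{Y}=[y_{1,-N},\ldots,y_{1,N},y_{2,-N},\ldots,y_{2,N},\ldots,y_{n,N}]^{\mathrm T}$. With $w_a(t)=\frac{b-t}{b-a}$, $w_b(t)=\frac{t-a}{b-a}$ and $S(j,h)(x)=\frac{\sin\pi(x/h-j)}{\pi(x/h-j)}$ (equal to $1$ at $x=jh$; and $S(j,h)(\phi^{\mathrm{DE}}(t))$ is taken as its limit $0$ at $t=a,b$), $$\tilde y_i^{(N)}(t)=y_{i,-N}w_a(t)+y_{i,N}w_b(t)+\sum_{j=-N}^N\{y_{i,j}-y_{i,-N}w_a(t_j^{\mathrm{DE}})-y_{i,N}w_b(t_j^{\mathrm{DE}})\}S(j,h)(\phi^{\mathrm{DE}}(t)),\quad i=1,\ldots,n.$$ *)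

theory Defs
  imports
    "HOL-Complex_Analysis.Complex_Analysis"
    "HOL-Probability.Sinc_Integral"
    "Jordan_Normal_Form.Matrix"
begin

unbundle no vec_syntax

section \<open>The double-exponential transformation\<close>

definition strip :: "real \<Rightarrow> complex set" where
  "strip d = {\<zeta>. \<bar>Im \<zeta>\<bar> < d}"

text \<open>Polymorphic, so that the same definition serves on the complex strip and on the real line.\<close>

definition psi_DE :: "real \<Rightarrow> real \<Rightarrow> 'a::{banach, real_normed_field} \<Rightarrow> 'a" where
  "psi_DE a b \<zeta> = of_real ((b - a) / 2) * tanh (of_real (pi / 2) * sinh \<zeta>) + of_real ((b + a) / 2)"

text \<open>Meaningful for \<open>a < t < b\<close> only; at the end points \<^const>\<open>artanh\<close> has an arbitrary value.\<close>

definition phi_DE :: "real \<Rightarrow> real \<Rightarrow> real \<Rightarrow> real" where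
  "phi_DE a b t = arsinh (2 / pi * artanh ((2 * t - b - a) / (b - a)))"

definition Q_fun :: "real \<Rightarrow> real \<Rightarrow> complex \<Rightarrow> complex" where
  "Q_fun a b z = (z - of_real a) * (of_real b - z)"

section \<open>Functions on the Riemann surface\<close>

text \<open>
  Since \<^const>\<open>psi_DE\<close> need not be injective on the strip, its image is regarded as a
  Riemann surface: a function \<open>f\<close> on the image is represented throughout by the function
  \<open>F \<zeta> = f (psi_DE a b \<zeta>)\<close> on the strip, where \<open>f\<close> may be multivalued as a function of
  \<open>z = psi_DE a b \<zeta>\<close>. Values of \<open>F\<close> outside the strip are irrelevant.
\<close>

definition L_space :: "real \<Rightarrow> real \<Rightarrow> real \<Rightarrow> real \<Rightarrow> (complex \<Rightarrow> complex) set" where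
  "L_space a b d \<alpha> = {F. F analytic_on strip d \<and> bounded (F ` strip d) \<and>
     (\<exists>L. \<forall>\<zeta>\<in>strip d. norm (F \<zeta>) \<le> L * norm (Q_fun a b (psi_DE a b \<zeta>)) powr \<alpha>)}"

text \<open>The value \<open>f t\<close> at a point \<open>t\<close> of the interval \<open>(a, b)\<close>, which corresponds to the real line.\<close>

definition on_interval :: "real \<Rightarrow> real \<Rightarrow> (complex \<Rightarrow> complex) \<Rightarrow> real \<Rightarrow> complex" where
  "on_interval a b F t = F (of_real (phi_DE a b t))"

section \<open>The initial value problem\<close>

text \<open>
  Components are indexed by \<open>0, ..., n - 1\<close>. The problem is taken in integrated form, since the
  coefficients may have integrable singularities at \<open>a\<close> and \<open>b\<close>. The integrand has arbitrary
  values at these two points, which does not affect the integral.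
\<close>

definition ivp_solution ::
  "real \<Rightarrow> real \<Rightarrow> nat \<Rightarrow> (nat \<Rightarrow> nat \<Rightarrow> complex \<Rightarrow> complex) \<Rightarrow> (nat \<Rightarrow> complex \<Rightarrow> complex)
    \<Rightarrow> complex vec \<Rightarrow> (nat \<Rightarrow> real \<Rightarrow> complex) \<Rightarrow> bool" where
  "ivp_solution a b n k g r y \<longleftrightarrow>
     (\<forall>i<n. continuous_on {a..b} (y i)) \<and>
     (\<forall>i<n. \<forall>t\<in>{a..b}.
        ((\<lambda>s. on_interval a b (g i) s + (\<Sum>j<n. on_interval a b (k i j) s * y j s))
           has_integral (y i t - r $ i)) {a..t})"

section \<open>The DE-Sinc linear system\<close>

definition step_size :: "real \<Rightarrow> real \<Rightarrow> nat \<Rightarrow> real" where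
  "step_size d \<alpha> N = ln (2 * d * real N / \<alpha>) / real N"

definition sample_pt :: "real \<Rightarrow> real \<Rightarrow> real \<Rightarrow> int \<Rightarrow> real" where
  "sample_pt a b h j = psi_DE a b (of_int j * h)"

text \<open>Sampling indices run over \<open>-N, ..., N\<close>; matrix positions over \<open>0, ..., 2 * N\<close>.\<close>

definition node :: "nat \<Rightarrow> nat \<Rightarrow> int" where
  "node N p = int p - int N"

definition sigma :: "int \<Rightarrow> real" where
  "sigma k = 1 / 2 + Si (pi * of_int k) / pi"

definition sinc_int_mat :: "nat \<Rightarrow> complex mat" where
  "sinc_int_mat N = mat (2 * N + 1) (2 * N + 1)
     (\<lambda>(p, q). of_real (sigma (node N p - node N q)))"

definition D_mat :: "real \<Rightarrow> real \<Rightarrow> real \<Rightarrow> nat \<Rightarrow> complex mat" where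
  "D_mat a b h N = mat_diag (2 * N + 1)
     (\<lambda>p. of_real (deriv (psi_DE a b :: real \<Rightarrow> real) (of_int (node N p) * h)))"

definition sample_mat :: "real \<Rightarrow> real \<Rightarrow> real \<Rightarrow> nat \<Rightarrow> (complex \<Rightarrow> complex) \<Rightarrow> complex mat" where
  "sample_mat a b h N F = mat_diag (2 * N + 1)
     (\<lambda>p. on_interval a b F (sample_pt a b h (node N p)))"

text \<open>The \<open>n \<times> n\<close> block matrix with square blocks \<open>B i j\<close> of order \<open>m\<close>.\<close>

definition block_mat :: "nat \<Rightarrow> nat \<Rightarrow> (nat \<Rightarrow> nat \<Rightarrow> 'a mat) \<Rightarrow> 'a mat" where
  "block_mat n m B = mat (n * m) (n * m)
     (\<lambda>(p, q). B (p div m) (q div m) $$ (p mod m, q mod m))"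

definition kronecker :: "'a::times mat \<Rightarrow> 'a mat \<Rightarrow> 'a mat" where
  "kronecker A B = mat (dim_row A * dim_row B) (dim_col A * dim_col B)
     (\<lambda>(p, q). A $$ (p div dim_row B, q div dim_col B) * B $$ (p mod dim_row B, q mod dim_col B))"

definition integration_mat :: "real \<Rightarrow> real \<Rightarrow> nat \<Rightarrow> real \<Rightarrow> nat \<Rightarrow> complex mat" where
  "integration_mat a b n h N =
     kronecker (1\<^sub>m n) (of_real h \<cdot>\<^sub>m (sinc_int_mat N * D_mat a b h N))"

definition system_mat ::
  "real \<Rightarrow> real \<Rightarrow> nat \<Rightarrow> (nat \<Rightarrow> nat \<Rightarrow> complex \<Rightarrow> complex) \<Rightarrow> real \<Rightarrow> nat \<Rightarrow> complex mat" where
  "system_mat a b n k h N =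
     kronecker (1\<^sub>m n) (1\<^sub>m (2 * N + 1)) -
     integration_mat a b n h N * block_mat n (2 * N + 1) (\<lambda>i j. sample_mat a b h N (k i j))"

definition R_vec :: "nat \<Rightarrow> complex vec \<Rightarrow> nat \<Rightarrow> complex vec" where
  "R_vec n r N = vec (n * (2 * N + 1)) (\<lambda>p. r $ (p div (2 * N + 1)))"

definition G_vec ::
  "real \<Rightarrow> real \<Rightarrow> nat \<Rightarrow> (nat \<Rightarrow> complex \<Rightarrow> complex) \<Rightarrow> real \<Rightarrow> nat \<Rightarrow> complex vec" where
  "G_vec a b n g h N = vec (n * (2 * N + 1))
     (\<lambda>p. on_interval a b (g (p div (2 * N + 1))) (sample_pt a b h (node N (p mod (2 * N + 1)))))"

definition system_rhs ::
  "real \<Rightarrow> real \<Rightarrow> nat \<Rightarrow> (nat \<Rightarrow> complex \<Rightarrow> complex) \<Rightarrow> complex vec \<Rightarrow> real \<Rightarrow> nat \<Rightarrow> complex vec" where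
  "system_rhs a b n g r h N = integration_mat a b n h N *\<^sub>v G_vec a b n g h N + R_vec n r N"

definition system_solution ::
  "real \<Rightarrow> real \<Rightarrow> nat \<Rightarrow> (nat \<Rightarrow> nat \<Rightarrow> complex \<Rightarrow> complex) \<Rightarrow> (nat \<Rightarrow> complex \<Rightarrow> complex)
    \<Rightarrow> complex vec \<Rightarrow> real \<Rightarrow> nat \<Rightarrow> complex vec \<Rightarrow> bool" where
  "system_solution a b n k g r h N Y \<longleftrightarrow>
     Y \<in> carrier_vec (n * (2 * N + 1)) \<and>
     system_mat a b n k h N *\<^sub>v Y = system_rhs a b n g r h N"

section \<open>The DE-Sinc-collocation solution\<close>

definition w_a :: "real \<Rightarrow> real \<Rightarrow> real \<Rightarrow> real" where
  "w_a a b t = (b - t) / (b - a)"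

definition w_b :: "real \<Rightarrow> real \<Rightarrow> real \<Rightarrow> real" where
  "w_b a b t = (t - a) / (b - a)"

definition sinc_basis :: "int \<Rightarrow> real \<Rightarrow> real \<Rightarrow> real" where
  "sinc_basis j h x = sinc (pi * (x / h - of_int j))"

text \<open>\<open>sinc_basis j h (phi_DE a b t)\<close>, with its limit 0 at the end points.\<close>

definition sinc_basis_DE :: "real \<Rightarrow> real \<Rightarrow> int \<Rightarrow> real \<Rightarrow> real \<Rightarrow> real" where
  "sinc_basis_DE a b j h t = (if t = a \<or> t = b then 0 else sinc_basis j h (phi_DE a b t))"

definition coeff_at :: "nat \<Rightarrow> complex vec \<Rightarrow> nat \<Rightarrow> int \<Rightarrow> complex" where
  "coeff_at N Y i j = Y $ (i * (2 * N + 1) + nat (j + int N))"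

definition collocation_solution ::
  "real \<Rightarrow> real \<Rightarrow> real \<Rightarrow> nat \<Rightarrow> complex vec \<Rightarrow> nat \<Rightarrow> real \<Rightarrow> complex" where
  "collocation_solution a b h N Y i t =
     coeff_at N Y i (- int N) * of_real (w_a a b t) + coeff_at N Y i (int N) * of_real (w_b a b t) +
     (\<Sum>j = - int N..int N.
        (coeff_at N Y i j
          - coeff_at N Y i (- int N) * of_real (w_a a b (sample_pt a b h j))
          - coeff_at N Y i (int N) * of_real (w_b a b (sample_pt a b h j)))
        * of_real (sinc_basis_DE a b j h t))"

end

theory Submission
  imports
    Defs
    "HOL-Real_Asymp.Real_Asymp"
    "Jordan_Normal_Form.Determinant"
begin

text \<open>
  Put \<open>u(\<zeta>) = y(\<psi>(\<zeta>))\<close>. Then \<open>u' = A u + G\<close> on the strip, where \<open>A\<close> and \<open>G\<close> are the coefficients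
  times \<open>\<psi>'\<close>; since \<open>\<psi>'\<close> equals \<open>Q \<circ> \<psi>\<close> up to the factor \<open>\<pi> cosh \<zeta> / (b - a)\<close>, they decay double exponentially,
  and Picard iteration from \<open>-\<infinity>\<close> along horizontal lines shows that \<open>u\<close> is bounded and analytic on
  the whole strip.

  For rapidly decaying \<open>F\<close> the residue theorem writes the Sinc interpolation error as
  \<open>sin (\<pi>x/h) \<Theta>(x)\<close> with \<open>\<Theta>\<close> of order \<open>exp (-\<pi>d/h)\<close>. Integrating by parts, the indefinite integration
  error at the sampling points is smaller by a further factor \<open>h\<close>.

  The collocation system is stable because \<open>\<sigma>\<^sub>k\<close> differs from the Heaviside function by
  \<open>O(1/(1 + |k|))\<close>: up to a perturbation of norm \<open>O(h \<surd>N)\<close> the matrix is lower triangular, and a discrete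
  Gronwall inequality bounds its inverse. The extra factor \<open>h\<close> in the residual absorbs the Lebesgue
  constant \<open>O(\<surd>N)\<close> of Sinc interpolation, and all truncation errors are of order \<open>exp (-cN)\<close>.
\<close>

section \<open>Contour integrals over rectangles and Sinc interpolation\<close>

text \<open>The solution \<open>u\<close> itself does not decay, so it is never interpolated. Two
  different functions enter the Sinc estimates: \<open>F = u'\<close> for indefinite integration,
  and \<open>u - r (1 - wb) - y(b) wb\<close> for interpolation, where \<open>wb\<close> is the
  weight \<open>w_b\<close> continued to the strip. The latter decays like \<open>omega\<close> at
  both ends, at the price of controlling how well the computed values at -N and N replace r and
  y(b).

  The given y is only a continuous function on [a,b] satisfying an integral equation. Its
  continuation is obtained by constructing a solution on the strip independently and identifying the
  two on the real line by uniqueness from minus infinity.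

  Contours stay at heights c < d, because nothing is known on the boundary of the strip. The
  estimates have constants that are uniform for d/2 \<le> c < d, so c may tend to d while h is
  fixed; likewise the rectangles are widened to infinity at fixed h. The choice of h makes exp(-pi
  d/h) equal to the claimed rate. Powers of N are harmless in the truncation terms but not in the
  contour terms, where the only smallness to spare is that h sqrt N tends to 0.\<close>

lemma strip_altdef: "strip d = {z. Im z < d} \<inter> {z. Im z > - d}"
  by (auto simp: strip_def)

lemma open_strip: "open (strip d)"
  unfolding strip_altdef by (intro open_Int open_halfspace_Im_lt open_halfspace_Im_gt)

lemma convex_strip: "convex (strip d)"
  unfolding strip_altdef by (intro convex_Int convex_halfspace_Im_lt convex_halfspace_Im_gt)

lemma Complex_in_strip_iff: "Complex x y \<in> strip d \<longleftrightarrow> \<bar>y\<bar> < d"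
  by (simp add: strip_def)

text \<open>The majorant \<open>w\<close> enters through a primitive \<open>W\<close>. Unlike length
  times maximum, the resulting bound does not deteriorate when the segment grows to a whole line,
  provided \<open>W\<close> is bounded.\<close>

lemma contour_integral_bound_same_Im:
  fixes f :: "complex \<Rightarrow> complex" and w W :: "real \<Rightarrow> real"
  assumes "p \<le> q"
    and cont: "continuous_on (closed_segment (Complex p c) (Complex q c)) f"
    and deriv: "\<And>s. (W has_real_derivative w s) (at s)"
    and bound: "\<And>s. p \<le> s \<Longrightarrow> s \<le> q \<Longrightarrow> norm (f (Complex s c)) \<le> w s"
  shows "norm (contour_integral (linepath (Complex p c) (Complex q c)) f) \<le> W q - W p"
proof -
  let ?\<gamma> = "linepath (Complex p c) (Complex q c)"
  have line: "?\<gamma> t = Complex (p + t * (q - p)) c" for t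
    by (simp add: linepath_def complex_eq_iff algebra_simps)
  have diff: "Complex q c - Complex p c = of_real (q - p)"
    by (simp add: complex_eq_iff)
  have "(f has_contour_integral contour_integral ?\<gamma> f) ?\<gamma>"
    using cont contour_integrable_continuous_linepath has_contour_integral_integral by blast
  hence 1: "((\<lambda>t. f (?\<gamma> t) * (Complex q c - Complex p c)) has_integral contour_integral ?\<gamma> f) {0..1}"
    by (simp add: has_contour_integral_linepath)
  have 2: "((\<lambda>t. w (p + t * (q - p)) * (q - p)) has_integral
      (W (p + 1 * (q - p)) - W (p + 0 * (q - p)))) {0..1}"
    by (rule fundamental_theorem_of_calculus)
      (auto simp flip: has_real_derivative_iff_has_vector_derivative
        intro!: derivative_eq_intros DERIV_chain2[OF deriv] simp del: of_real_diff)
  have "norm (integral {0..1} (\<lambda>t. f (?\<gamma> t) * (Complex q c - Complex p c)))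
      \<le> integral {0..1} (\<lambda>t. w (p + t * (q - p)) * (q - p))"
  proof (rule integral_norm_bound_integral)
    fix t :: real assume t: "t \<in> {0..1}"
    have "p \<le> p + t * (q - p)" "p + t * (q - p) \<le> q"
      using t \<open>p \<le> q\<close> mult_right_mono[of t 1 "q - p"] by auto
    from bound[OF this] show "norm (f (?\<gamma> t) * (Complex q c - Complex p c)) \<le> w (p + t * (q - p)) * (q - p)"
      unfolding line diff norm_mult using \<open>p \<le> q\<close>
      by (simp del: of_real_diff add: mult_right_mono)
  qed (use 1 2 in blast)+
  thus ?thesis
    unfolding integral_unique[OF 1] integral_unique[OF 2] by simp
qed

text \<open>The horizontal sides will be lengthened without limit and are therefore measured by the
  increment of \<open>W\<close>; the two vertical sides keep the length 2c, so a supremum is good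
  enough there and gives 4 c V.\<close>

lemma contour_integral_rectpath_bound:
  fixes f :: "complex \<Rightarrow> complex" and w W :: "real \<Rightarrow> real" and X c V :: real
  assumes X: "0 < X" and c: "0 < c"
    and cont: "continuous_on (path_image (rectpath (Complex (-X) (-c)) (Complex X c))) f"
    and deriv: "\<And>s. (W has_real_derivative w s) (at s)"
    and horizontal: "\<And>s e. \<bar>s\<bar> \<le> X \<Longrightarrow> \<bar>e\<bar> = c \<Longrightarrow> norm (f (Complex s e)) \<le> w s"
    and vertical: "\<And>s e. \<bar>s\<bar> = X \<Longrightarrow> \<bar>e\<bar> \<le> c \<Longrightarrow> norm (f (Complex s e)) \<le> V"
  shows "norm (contour_integral (rectpath (Complex (-X) (-c)) (Complex X c)) f)
           \<le> 2 * (W X - W (-X)) + 4 * c * V"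
proof -
  let ?a1 = "Complex (-X) (-c)" and ?a2 = "Complex X (-c)" and ?a3 = "Complex X c" and ?a4 = "Complex (-X) c"
  have image: "path_image (rectpath ?a1 ?a3) = closed_segment ?a1 ?a2 \<union> closed_segment ?a2 ?a3
      \<union> closed_segment ?a3 ?a4 \<union> closed_segment ?a4 ?a1"
    by (simp add: rectpath_def Let_def path_image_join Un_assoc)
  have conts: "continuous_on (closed_segment ?a1 ?a2) f" "continuous_on (closed_segment ?a2 ?a3) f"
    "continuous_on (closed_segment ?a3 ?a4) f" "continuous_on (closed_segment ?a4 ?a1) f"
    using cont unfolding image by (auto elim: continuous_on_subset)
  note ints = conts[THEN contour_integrable_continuous_linepath]
  have eq: "contour_integral (rectpath ?a1 ?a3) f = contour_integral (linepath ?a1 ?a2) f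
      + (contour_integral (linepath ?a2 ?a3) f
      + (contour_integral (linepath ?a3 ?a4) f + contour_integral (linepath ?a4 ?a1) f))"
    using ints by (simp add: rectpath_def Let_def contour_integrable_join contour_integral_join)
  have V: "0 \<le> V"
    using order_trans[OF norm_ge_zero vertical[of X 0]] X c by simp
  have 1: "norm (contour_integral (linepath ?a1 ?a2) f) \<le> W X - W (-X)"
    by (rule contour_integral_bound_same_Im[OF _ conts(1) deriv]) (use X c horizontal in auto)
  have "norm (contour_integral (linepath ?a4 ?a3) f) \<le> W X - W (-X)"
    by (rule contour_integral_bound_same_Im[OF _ _ deriv])
      (use X c horizontal conts(3) in \<open>auto simp: closed_segment_commute\<close>)
  hence 3: "norm (contour_integral (linepath ?a3 ?a4) f) \<le> W X - W (-X)"
    using conts(3) by (subst contour_integral_reverse_linepath) auto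
  have seg: "z \<in> closed_segment ?a2 ?a3 \<union> closed_segment ?a4 ?a1 \<Longrightarrow> \<bar>Re z\<bar> = X \<and> \<bar>Im z\<bar> \<le> c" for z
    using X c by (auto simp: closed_segment_same_Re closed_segment_eq_real_ivl split: if_splits)
  have vert: "norm (f z) \<le> V" if "z \<in> closed_segment ?a2 ?a3 \<union> closed_segment ?a4 ?a1" for z
    using vertical[of "Re z" "Im z"] seg[OF that] by simp
  have "norm (contour_integral (linepath ?a2 ?a3) f) \<le> V * norm (?a3 - ?a2)"
    by (rule contour_integral_bound_linepath) (use ints V vert in auto)
  also have "norm (?a3 - ?a2) = 2 * c"
    using c by (simp add: cmod_def real_sqrt_mult)
  finally have 2: "norm (contour_integral (linepath ?a2 ?a3) f) \<le> V * (2 * c)" .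
  have "norm (contour_integral (linepath ?a4 ?a1) f) \<le> V * norm (?a1 - ?a4)"
    by (rule contour_integral_bound_linepath) (use ints V vert in auto)
  also have "norm (?a1 - ?a4) = 2 * c"
    using c by (simp add: cmod_def real_sqrt_mult)
  finally have 4: "norm (contour_integral (linepath ?a4 ?a1) f) \<le> V * (2 * c)" .
  show ?thesis
    unfolding eq
    by (rule order_trans[OF norm_triangle_mono[OF 1 norm_triangle_mono[OF 2 norm_triangle_mono[OF 3 4]]]]) simp
qed

section \<open>The Sinc kernel on rectangles that avoid the grid\<close>

lemma norm_sin_ge_sinh: "norm (sin z) \<ge> \<bar>sinh (Im z)\<bar>" for z :: complex
proof -
  have "(sinh (Im z))\<^sup>2 = (exp (2 * Im z) + inverse (exp (2 * Im z)) - 2) / 4"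
    by (simp add: sinh_field_def exp_double power2_diff power_inverse power_divide exp_minus mult.assoc)
  also have "\<dots> \<le> (norm (sin z))\<^sup>2"
    unfolding norm_sin_squared by (simp add: field_simps)
  finally show ?thesis
    by (metis abs_le_square_iff abs_norm_cancel)
qed

text \<open>The hypothesis says sin^2(Re z) = 1, and then |sin z| = cosh(Im z).\<close>

lemma norm_sin_ge_1:
  fixes z :: complex assumes "cos (2 * Re z) = - 1"
  shows "norm (sin z) \<ge> 1"
proof -
  have "(exp (Im z) - inverse (exp (Im z)))\<^sup>2 \<ge> 0" by simp
  hence "exp (2 * Im z) + inverse (exp (2 * Im z)) \<ge> 2"
    by (simp add: power2_diff exp_double power_inverse mult.assoc)
  hence "(norm (sin z))\<^sup>2 \<ge> 1\<^sup>2"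
    unfolding norm_sin_squared assms by simp
  thus ?thesis using power2_le_imp_le norm_ge_zero by blast
qed

lemma exp_le_sinh:
  fixes t :: real assumes "1 \<le> t" shows "exp t / 4 \<le> sinh t"
proof -
  have "2 \<le> exp (1::real)" using exp_ge_add_one_self[of 1] by simp
  also have "\<dots> \<le> exp t" using assms by simp
  finally have "2 \<le> exp t" .
  moreover have "exp (- t) \<le> 1" using assms by simp
  ultimately have "exp (- t) \<le> exp t / 2" by linarith
  thus ?thesis by (simp add: sinh_field_def)
qed

text \<open>The decay 1/cosh^2 is chosen because it is integrable along horizontal lines with the
  bounded primitive tanh; the double-exponential decay enters later, through the size of the samples
  beyond N. The condition h \<le> d keeps pi c/h \<ge> pi/2 for all heights c \<ge> d/2, where |sin|
  on the horizontal sides is comparable to an exponential.\<close>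

locale sinc_strip =
  fixes d h B :: real and F :: "complex \<Rightarrow> complex"
  assumes d_pos: "0 < d" and h_pos: "0 < h" and h_le: "h \<le> d"
    and holo: "F holomorphic_on strip d"
    and decay: "\<And>z. z \<in> strip d \<Longrightarrow> norm (F z) \<le> B / (cosh (Re z))\<^sup>2"
begin

definition sn :: "complex \<Rightarrow> complex" where
  "sn z = sin (of_real (pi / h) * z)"

text \<open>The term 1/2 puts the vertical sides midway between two grid points, where the sine has
  modulus at least 1. The multiple 2L leaves a distance of at least L h between these sides and all
  x with |x| \<le> L h.\<close>

definition half_width :: "nat \<Rightarrow> real" where
  "half_width L = (2 * real L + 1 / 2) * h"

definition rect :: "nat \<Rightarrow> real \<Rightarrow> real \<Rightarrow> complex" where
  "rect L c = rectpath (Complex (- half_width L) (- c)) (Complex (half_width L) c)"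

text \<open>The Sinc interpolation error divided by sin(pi x/h), written as a Cauchy-type integral.
  Keeping the oscillating sine outside allows it to be integrated by parts against the slowly
  varying \<open>Theta\<close>.\<close>

definition Theta :: "nat \<Rightarrow> real \<Rightarrow> complex \<Rightarrow> complex" where
  "Theta L c x = contour_integral (rect L c) (\<lambda>z. F z / sn z / (z - x)) / (2 * pi * \<i>)"

definition Theta' :: "nat \<Rightarrow> real \<Rightarrow> complex \<Rightarrow> complex" where
  "Theta' L c x = contour_integral (rect L c) (\<lambda>z. F z / sn z / (z - x)\<^sup>2) / (2 * pi * \<i>)"

lemma half_width_pos: "0 < half_width L"
  using h_pos by (simp add: half_width_def)

lemma B_nonneg: "0 \<le> B"
  using decay[of 0] d_pos norm_ge_zero[of "F 0"] by (simp add: strip_def del: norm_ge_zero)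

lemma sn_eq_0_iff: "sn z = 0 \<longleftrightarrow> (\<exists>q::int. z = of_real (of_int q * h))"
proof -
  have "(of_real (pi / h) * z = of_real (of_int q * pi)) \<longleftrightarrow> z = of_real (of_int q * h)" for q :: int
  proof -
    have "of_real (of_int q * pi) = of_real (pi / h) * (of_real (of_int q * h) :: complex)"
      using h_pos by (simp only: of_real_mult[symmetric] of_real_eq_iff) simp
    thus ?thesis using h_pos by (metis mult_cancel_left of_real_eq_0_iff divide_eq_0_iff pi_neq_zero less_irrefl)
  qed
  thus ?thesis by (simp add: sn_def Complex_Transcendental.sin_eq_0)
qed

lemma path_image_rect:
  assumes "0 < c"
  shows "path_image (rect L c) = {z. (\<bar>Re z\<bar> = half_width L \<and> \<bar>Im z\<bar> \<le> c) \<or> (\<bar>Re z\<bar> \<le> half_width L \<and> \<bar>Im z\<bar> = c)}"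
proof -
  have "path_image (rect L c) = {z. Re z \<in> {- half_width L, half_width L} \<and> Im z \<in> {- c..c}} \<union>
      {z. Im z \<in> {- c, c} \<and> Re z \<in> {- half_width L..half_width L}}"
    unfolding rect_def using assms half_width_pos[of L] by (subst path_image_rectpath) simp_all
  also have "\<dots> = {z. (\<bar>Re z\<bar> = half_width L \<and> \<bar>Im z\<bar> \<le> c) \<or> (\<bar>Re z\<bar> \<le> half_width L \<and> \<bar>Im z\<bar> = c)}"
    by (rule Set.set_eqI, insert assms half_width_pos[of L]) (simp, arith)
  finally show ?thesis .
qed

lemma norm_sn_horizontal:
  assumes "d / 2 \<le> c" "\<bar>Im z\<bar> = c"
  shows "norm (sn z) \<ge> exp (pi * c / h) / 4"
proof -
  \<comment> \<open>Here c \<ge> d/2 and h \<le> d combine to pi c/h \<ge> 1, the range in which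
    sinh is at least a quarter of exp.\<close>
  have "1 \<le> pi / 2" using pi_gt3 by simp
  also have "pi / 2 \<le> pi * c / h"
    using assms h_le h_pos d_pos by (simp add: field_simps)
  finally have ge1: "1 \<le> pi * c / h" .
  have "exp (pi * c / h) / 4 \<le> sinh (pi * c / h)"
    by (rule exp_le_sinh[OF ge1])
  also have "\<dots> \<le> \<bar>sinh (Im (of_real (pi / h) * z))\<bar>"
    using assms(2) h_pos by (cases "Im z \<ge> 0") (auto simp: mult.commute)
  also have "\<dots> \<le> norm (sn z)"
    unfolding sn_def by (rule norm_sin_ge_sinh)
  finally show ?thesis .
qed

lemma norm_sn_vertical:
  assumes "\<bar>Re z\<bar> = half_width L"
  shows "norm (sn z) \<ge> 1"
proof -
  have "2 * ((2 * real L + 1 / 2) * pi) = pi * of_int (4 * int L + 1)"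
    by (simp add: algebra_simps)
  hence *: "cos (2 * ((2 * real L + 1 / 2) * pi)) = - 1"
    by (simp only: cos_npi_int) simp
  have "\<bar>pi / h * Re z\<bar> = (2 * real L + 1 / 2) * pi"
    using assms h_pos by (simp add: abs_mult half_width_def)
  hence "cos (2 * (pi / h * Re z)) = cos (2 * ((2 * real L + 1 / 2) * pi))"
    using cos_abs_real[of "2 * (pi / h * Re z)"] by (simp only: abs_mult abs_numeral)
  hence "cos (2 * Re (of_real (pi / h) * z)) = - 1"
    using * by simp
  thus ?thesis unfolding sn_def by (rule norm_sin_ge_1)
qed

lemma sn_nonzero_on_rect:
  assumes "d / 2 \<le> c" "z \<in> path_image (rect L c)"
  shows "sn z \<noteq> 0"
proof
  assume "sn z = 0"
  hence "\<not> norm (sn z) \<ge> 1" "\<not> norm (sn z) \<ge> exp (pi * c / h) / 4"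
    by (simp_all add: not_le)
  thus False
    using assms d_pos norm_sn_horizontal[of c z] norm_sn_vertical[of z L]
    by (auto simp: path_image_rect)
qed

lemma sn_holomorphic [holomorphic_intros]: "sn holomorphic_on A"
  unfolding sn_def by (intro holomorphic_intros)

lemma rect_in_strip: "0 < c \<Longrightarrow> c < d \<Longrightarrow> path_image (rect L c) \<subseteq> strip d"
  by (auto simp: path_image_rect strip_def)

lemma kernel_continuous:
  assumes "d / 2 \<le> c" "c < d"
  shows "continuous_on (path_image (rect L c)) (\<lambda>z. F z / sn z)"
proof (intro continuous_intros)
  show "continuous_on (path_image (rect L c)) F"
    using holo rect_in_strip[of c L] assms d_pos
    by (meson continuous_on_subset half_gt_zero holomorphic_on_imp_continuous_on less_le_trans)
  show "continuous_on (path_image (rect L c)) sn"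
    by (intro holomorphic_on_imp_continuous_on holomorphic_intros)
qed (use sn_nonzero_on_rect assms in auto)

text \<open>The partial fraction form that matches the residue at q h. The factor
  \<open>cos (pi * of_int q)\<close> is the sign (-1)^q; being its own inverse, it may stand in the
  denominator.\<close>

lemma sinc_basis_alt:
  assumes "x \<noteq> of_int q * h"
  shows "sinc_basis q h x = sin (pi / h * x) * h / (pi * cos (pi * of_int q) * (x - of_int q * h))"
proof -
  have c2: "cos (pi * of_int q) * cos (pi * of_int q) = (1::real)"
    by simp
  have c0: "cos (pi * of_int q) \<noteq> (0::real)" using c2 by auto
  have s0: "sin (pi * of_int q) = (0::real)" by (rule sin_npi_int)
  have "sinc_basis q h x = sin (pi * (x / h - of_int q)) / (pi * (x / h - of_int q))"
    using assms h_pos by (simp add: sinc_basis_def field_simps)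
  also have "sin (pi * (x / h - of_int q)) = sin (pi / h * x) * cos (pi * of_int q)"
    by (simp only: right_diff_distrib sin_diff s0 mult_zero_right diff_zero) (simp add: mult.commute)
  also have "\<dots> / (pi * (x / h - of_int q)) = sin (pi / h * x) * h / (pi * cos (pi * of_int q) * (x - of_int q * h))"
    using assms h_pos c0 c2 by (simp add: divide_simps)
  finally show ?thesis .
qed

end

section \<open>Differentiating Cauchy-type integrals over a rectangle\<close>

lemma Cauchy_integral_linepath_derivative:
  assumes "continuous_on (closed_segment a b) f" "w \<notin> closed_segment a b"
  shows "((\<lambda>w. contour_integral (linepath a b) (\<lambda>u. f u / (u - w))) has_field_derivative
           contour_integral (linepath a b) (\<lambda>u. f u / (u - w)\<^sup>2)) (at w)"
proof -
  have "((\<lambda>w. contour_integral (linepath a b) (\<lambda>u. f u / (u - w))) has_field_derivative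
      of_nat 1 * contour_integral (linepath a b) (\<lambda>u. f u / (u - w) ^ Suc 1)) (at w)"
  proof (rule Cauchy_next_derivative(2)[where S = UNIV and B = "norm (b - a)"])
    fix v assume "v \<in> UNIV - path_image (linepath a b)"
    hence "(\<lambda>u. f u / (u - v) ^ 1) contour_integrable_on linepath a b"
      using assms by (intro contour_integrable_continuous_linepath continuous_intros) auto
    thus "((\<lambda>u. f u / (u - v) ^ 1) has_contour_integral
        contour_integral (linepath a b) (\<lambda>u. f u / (u - v))) (linepath a b)"
      using has_contour_integral_integral by fastforce
  qed (use assms in \<open>auto simp: vector_derivative_linepath_at\<close>)
  thus ?thesis by (simp add: numeral_2_eq_2)
qed

lemma contour_integral_rectpath_split:
  assumes "continuous_on (path_image (rectpath a b)) f"
  shows "contour_integral (rectpath a b) f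
     = contour_integral (linepath a (Complex (Re b) (Im a))) f
     + contour_integral (linepath (Complex (Re b) (Im a)) b) f
     + contour_integral (linepath b (Complex (Re a) (Im b))) f
     + contour_integral (linepath (Complex (Re a) (Im b)) a) f"
proof -
  let ?p = "Complex (Re b) (Im a)" and ?q = "Complex (Re a) (Im b)"
  have image: "path_image (rectpath a b) = closed_segment a ?p \<union> closed_segment ?p b
      \<union> closed_segment b ?q \<union> closed_segment ?q a"
    by (simp add: rectpath_def Let_def path_image_join Un_assoc)
  have "continuous_on (closed_segment a ?p) f" "continuous_on (closed_segment ?p b) f"
    "continuous_on (closed_segment b ?q) f" "continuous_on (closed_segment ?q a) f"
    using assms unfolding image by (auto elim: continuous_on_subset)
  note this[THEN contour_integrable_continuous_linepath]
  thus ?thesis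
    by (simp add: rectpath_def Let_def)
qed

text \<open>Differentiation under the integral asks for a bound on the velocity of the path at every
  parameter, which is immediate on a segment but not at corners. Hence each side is treated
  separately; splitting the integral into sides is legitimate for all w off the boundary, which is
  an open set.\<close>

lemma Cauchy_integral_rectpath_derivative:
  assumes cont: "continuous_on (path_image (rectpath a b)) f" and w: "w \<notin> path_image (rectpath a b)"
  shows "((\<lambda>w. contour_integral (rectpath a b) (\<lambda>u. f u / (u - w))) has_field_derivative
           contour_integral (rectpath a b) (\<lambda>u. f u / (u - w)\<^sup>2)) (at w)"
proof -
  let ?p = "Complex (Re b) (Im a)" and ?q = "Complex (Re a) (Im b)"
  have image: "path_image (rectpath a b) = closed_segment a ?p \<union> closed_segment ?p b
      \<union> closed_segment b ?q \<union> closed_segment ?q a"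
    by (simp add: rectpath_def Let_def path_image_join Un_assoc)
  have conts: "continuous_on (closed_segment a ?p) f" "continuous_on (closed_segment ?p b) f"
    "continuous_on (closed_segment b ?q) f" "continuous_on (closed_segment ?q a) f"
    using cont unfolding image by (auto elim: continuous_on_subset)
  have off: "w \<notin> closed_segment a ?p" "w \<notin> closed_segment ?p b"
    "w \<notin> closed_segment b ?q" "w \<notin> closed_segment ?q a"
    using w unfolding image by auto
  have "((\<lambda>w. contour_integral (linepath a ?p) (\<lambda>u. f u / (u - w))
        + contour_integral (linepath ?p b) (\<lambda>u. f u / (u - w))
        + contour_integral (linepath b ?q) (\<lambda>u. f u / (u - w))
        + contour_integral (linepath ?q a) (\<lambda>u. f u / (u - w))) has_field_derivative
      contour_integral (linepath a ?p) (\<lambda>u. f u / (u - w)\<^sup>2)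
        + contour_integral (linepath ?p b) (\<lambda>u. f u / (u - w)\<^sup>2)
        + contour_integral (linepath b ?q) (\<lambda>u. f u / (u - w)\<^sup>2)
        + contour_integral (linepath ?q a) (\<lambda>u. f u / (u - w)\<^sup>2)) (at w)"
    by (intro DERIV_add Cauchy_integral_linepath_derivative conts off)
  also have "contour_integral (linepath a ?p) (\<lambda>u. f u / (u - w)\<^sup>2)
        + contour_integral (linepath ?p b) (\<lambda>u. f u / (u - w)\<^sup>2)
        + contour_integral (linepath b ?q) (\<lambda>u. f u / (u - w)\<^sup>2)
        + contour_integral (linepath ?q a) (\<lambda>u. f u / (u - w)\<^sup>2)
      = contour_integral (rectpath a b) (\<lambda>u. f u / (u - w)\<^sup>2)"
    by (rule contour_integral_rectpath_split[symmetric]) (use w cont in \<open>auto intro!: continuous_intros\<close>)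
  finally show ?thesis
  proof (rule has_field_derivative_transform_within_open[where S = "- path_image (rectpath a b)"])
    show "open (- path_image (rectpath a b))"
      by (simp add: closed_path_image open_Compl)
    fix v assume "v \<in> - path_image (rectpath a b)"
    hence "continuous_on (path_image (rectpath a b)) (\<lambda>u. f u / (u - v))"
      using cont by (auto intro!: continuous_intros)
    from contour_integral_rectpath_split[OF this]
    show "contour_integral (linepath a ?p) (\<lambda>u. f u / (u - v))
        + contour_integral (linepath ?p b) (\<lambda>u. f u / (u - v))
        + contour_integral (linepath b ?q) (\<lambda>u. f u / (u - v))
        + contour_integral (linepath ?q a) (\<lambda>u. f u / (u - v))
        = contour_integral (rectpath a b) (\<lambda>u. f u / (u - v))" by simp
  qed (use w in auto)
qed

section \<open>Integrable majorants built from cosh\<close>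

lemma has_real_derivative_arctan_exp:
  "((\<lambda>s. 2 * arctan (exp s)) has_real_derivative 1 / cosh s) (at s)" for s :: real
proof -
  have "((\<lambda>s. 2 * arctan (exp s)) has_real_derivative 2 * (exp s / (1 + (exp s)\<^sup>2))) (at s)"
    by (auto intro!: derivative_eq_intros simp: field_simps)
  also have "2 * (exp s / (1 + (exp s)\<^sup>2)) = 1 / cosh s"
    by (simp add: cosh_field_def exp_minus field_simps power2_eq_square add_pos_pos)
  finally show ?thesis .
qed

lemma inverse_cosh_square: "1 / (cosh x)\<^sup>2 = 1 - (tanh x)\<^sup>2" for x :: real
proof -
  have "1 / (cosh x)\<^sup>2 = ((cosh x)\<^sup>2 - (sinh x)\<^sup>2) / (cosh x)\<^sup>2"
    by (simp add: cosh_square_eq)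
  also have "\<dots> = 1 - (tanh x)\<^sup>2"
    by (simp add: tanh_def diff_divide_distrib power_divide)
  finally show ?thesis .
qed

lemma has_real_derivative_tanh: "(tanh has_real_derivative 1 / (cosh s)\<^sup>2) (at s)" for s :: real
  unfolding inverse_cosh_square by (auto intro!: derivative_eq_intros)

text \<open>A consequence of cosh s \<ge> 1 + s^2/2, proved by differentiating twice. It later
  trades one factor cosh for polynomial decay in another variable.\<close>

lemma one_plus_square_le_cosh: "1 + s\<^sup>2 \<le> 2 * cosh s" for s :: real
proof -
  have *: "1 + s\<^sup>2 / 2 \<le> cosh s" if "0 \<le> s" for s :: real
  proof -
    have "cosh 0 - 0\<^sup>2 / 2 \<le> cosh s - s\<^sup>2 / 2"
    proof (rule DERIV_nonneg_imp_nondecreasing[OF that])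
      fix x :: real assume x: "0 \<le> x"
      have "sinh 0 - 0 \<le> sinh x - x"
        by (rule DERIV_nonneg_imp_nondecreasing[OF x])
          (auto intro!: exI derivative_eq_intros simp: cosh_real_ge_1)
      thus "\<exists>y. ((\<lambda>s. cosh s - s\<^sup>2 / 2) has_real_derivative y) (at x) \<and> 0 \<le> y"
        by (intro exI[of _ "sinh x - x"]) (auto intro!: derivative_eq_intros)
    qed
    thus ?thesis by simp
  qed
  have "1 + \<bar>s\<bar>\<^sup>2 / 2 \<le> cosh \<bar>s\<bar>" by (rule *) simp
  thus ?thesis by simp
qed

section \<open>The residue identity and bounds for \<open>Theta\<close> and
  \<open>Theta'\<close>\<close>

context sinc_strip
begin

lemma grid_point_in_strip: "of_real x \<in> strip d"
  using d_pos by (simp add: strip_def)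

text \<open>Residue theorem for F(z) / (sn(z) (z - x)). As x is off the grid, its pole does not
  merge with a zero of \<open>sn\<close>, so every singularity is handled as a simple pole. The
  residue at x yields F(x), those at the grid points with |q| \<le> 2L yield the Sinc sum.\<close>

lemma sinc_interpolation_identity_off_grid:
  assumes c: "d / 2 \<le> c" "c < d" and x: "\<bar>x\<bar> \<le> real L * h"
    and off: "\<And>q::int. x \<noteq> of_int q * h"
  shows "F (of_real x) - (\<Sum>q = - int (2 * L)..int (2 * L). F (of_real (of_int q * h)) * of_real (sinc_basis q h x))
           = of_real (sin (pi / h * x)) * Theta L c (of_real x)"
proof -
  \<comment> \<open>The half-width (2L + 3/4) h lies between the vertical side at (2L + 1/2) h and
    the next grid point at (2L + 1) h: the convex open set \<open>S\<close> contains the rectangle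
    but no further zero of \<open>sn\<close>.\<close>
  define S where "S = strip d \<inter> {z. \<bar>Re z\<bar> < (2 * real L + 3 / 4) * h}"
  define node :: "int \<Rightarrow> complex" where "node = (\<lambda>q. of_real (of_int q * h))"
  define nodes where "nodes = node ` {- int (2 * L)..int (2 * L)}"
  define pts where "pts = insert (of_real x) nodes"
  define f where "f = (\<lambda>z. F z / sn z / (z - of_real x))"
  have c_pos: "0 < c" using c d_pos by linarith
  have off': "of_real x \<noteq> node q" for q
    using off[of q] unfolding node_def of_real_eq_iff by simp
  have S_eq: "S = strip d \<inter> ({z. Re z < (2 * real L + 3 / 4) * h} \<inter> {z. Re z > - ((2 * real L + 3 / 4) * h)})"
    by (auto simp: S_def)
  have S: "open S" "convex S"
    unfolding S_eq by (intro open_Int convex_Int open_strip convex_strip open_halfspace_Re_lt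
        open_halfspace_Re_gt convex_halfspace_Re_lt convex_halfspace_Re_gt)+
  have Fsub: "F holomorphic_on S" using holo by (rule holomorphic_on_subset) (auto simp: S_def)
  have zeros: "z \<in> nodes" if "z \<in> S" and sn0: "sn z = 0" for z
  proof -
    obtain q :: int where q: "z = node q" using sn_eq_0_iff[THEN iffD1, OF sn0] unfolding node_def by blast
    have "\<bar>of_int q\<bar> * h < (2 * real L + 3 / 4) * h"
      using that h_pos by (simp add: S_def q node_def abs_mult)
    hence "\<bar>of_int q\<bar> < 2 * real L + 3 / 4" using h_pos by simp
    hence "\<bar>q\<bar> \<le> int (2 * L)" by linarith
    thus ?thesis unfolding nodes_def q by (intro imageI) (simp add: abs_le_iff)
  qed
  have hw: "half_width L < (2 * real L + 3 / 4) * h" "real L * h < half_width L"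
    using h_pos by (auto simp: half_width_def intro!: mult_strict_right_mono)
  have image_S: "path_image (rect L c) \<subseteq> S"
    using rect_in_strip[OF c_pos c(2), of L] hw c_pos
    by (auto simp: S_def path_image_rect)
  have pts_real: "Im z = 0 \<and> \<bar>Re z\<bar> < half_width L" if "z \<in> pts" for z
  proof -
    have "\<bar>of_int q\<bar> * h < half_width L" if "\<bar>q\<bar> \<le> int (2 * L)" for q :: int
    proof -
      have "\<bar>of_int q\<bar> < 2 * real L + 1 / 2" using that by linarith
      thus ?thesis using h_pos by (simp add: half_width_def)
    qed
    thus ?thesis using that x hw h_pos
      by (force simp: pts_def nodes_def node_def abs_mult)
  qed
  have image_pts: "path_image (rect L c) \<inter> pts = {}"
    using pts_real c_pos by (fastforce simp: path_image_rect)
  have pts_S: "pts \<subseteq> S"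
    using pts_real hw d_pos by (fastforce simp: S_def strip_def)
  have fin: "finite pts" by (simp add: pts_def nodes_def)
  have holo_f: "f holomorphic_on S - pts"
    unfolding f_def using zeros
    by (intro holomorphic_intros holomorphic_on_subset[OF Fsub]) (auto simp: pts_def)
  have winding: "winding_number (rect L c) z = 1" if "z \<in> pts" for z
    unfolding rect_def using pts_real[OF that] c_pos
    by (intro winding_number_rectpath) (auto simp: in_box_complex_iff)
  have "contour_integral (rect L c) f = 2 * pi * \<i> * (\<Sum>z\<in>pts. winding_number (rect L c) z * residue f z)"
  proof (rule Residue_theorem)
    show "open S" "connected S" "finite pts" using S fin by (auto intro: convex_connected)
    show "f holomorphic_on S - pts" by (rule holo_f)
    show "valid_path (rect L c)" "pathfinish (rect L c) = pathstart (rect L c)"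
      by (auto simp: rect_def)
    show "path_image (rect L c) \<subseteq> S - pts" using image_S image_pts by blast
    show "\<forall>z. z \<notin> S \<longrightarrow> winding_number (rect L c) z = 0"
      using winding_number_zero_outside[OF _ S(2) _ _ image_S] by (auto simp: rect_def)
  qed
  also have "\<dots> = 2 * pi * \<i> * (\<Sum>z\<in>pts. residue f z)"
    using winding by simp
  finally have Theta: "Theta L c (of_real x) = (\<Sum>z\<in>pts. residue f z)"
    by (simp add: Theta_def f_def)
  have residue_f: "residue f z = l" if "z \<in> pts" "((\<lambda>w. f w * (w - z)) \<longlongrightarrow> l) (at z)" for z l
  proof (rule residue_simple'[where s = "S - (pts - {z})"])
    show "open (S - (pts - {z}))" using S fin by (auto intro: open_Diff finite_imp_closed)
    show "z \<in> S - (pts - {z})" using that pts_S by auto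
    show "f holomorphic_on S - (pts - {z}) - {z}"
      by (rule holomorphic_on_subset[OF holo_f]) auto
  qed fact
  have cont_F: "F \<midarrow>z\<rightarrow> F z" if "z \<in> S" for z
    using continuous_on_eq_continuous_at[OF S(1)] holomorphic_on_imp_continuous_on[OF Fsub] that
    by (auto simp: isCont_def)
  have sn_x: "sn (of_real x) = of_real (sin (pi / h * x))"
    by (simp add: sn_def flip: of_real_mult sin_of_real of_real_divide)
  have sn_x0: "sn (of_real x) \<noteq> 0"
    using off' by (auto simp: sn_eq_0_iff node_def)
  have sn_deriv: "(sn has_field_derivative of_real (pi / h) * cos (of_real (pi / h) * z)) (at z)" for z
    unfolding sn_def using h_pos by (auto intro!: derivative_eq_intros)
  have cont_sn: "sn \<midarrow>z\<rightarrow> sn z" for z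
    using sn_deriv[of z] DERIV_isCont isCont_def by blast
  have res_x: "residue f (of_real x) = F (of_real x) / sn (of_real x)"
  proof (rule residue_f)
    have "of_real x \<in> S" using pts_S by (simp add: pts_def)
    hence "((\<lambda>w. F w / sn w) \<longlongrightarrow> F (of_real x) / sn (of_real x)) (at (of_real x))"
      by (intro tendsto_divide cont_F cont_sn sn_x0)
    thus "((\<lambda>w. f w * (w - of_real x)) \<longlongrightarrow> F (of_real x) / sn (of_real x)) (at (of_real x))"
      by (rule Lim_transform_eventually) (auto simp: eventually_at_filter f_def)
  qed (simp add: pts_def)
  have res_q: "residue f (node q) = - F (node q) * of_real (sinc_basis q h x) / sn (of_real x)"
    if q: "q \<in> {- int (2 * L)..int (2 * L)}" for q
  proof (rule residue_f)
    let ?C = "cos (pi * of_int q)"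
    have node_in: "node q \<in> pts" using q by (simp add: pts_def nodes_def)
    thus "node q \<in> pts" .
    have cos_node: "cos (of_real (pi / h) * node q) = of_real ?C"
    proof -
      have "of_real (pi / h) * node q = of_real (pi * of_int q)"
        unfolding node_def of_real_mult[symmetric] of_real_eq_iff using h_pos by simp
      thus ?thesis by (simp only: cos_of_real)
    qed
    have C0: "?C \<noteq> 0" by simp
    have sn0: "sn (node q) = 0" by (auto simp: sn_eq_0_iff node_def)
    have "((\<lambda>w. (sn w - sn (node q)) / (w - node q)) \<longlongrightarrow> of_real (pi / h) * of_real ?C) (at (node q))"
      using sn_deriv[of "node q"] unfolding cos_node has_field_derivative_iff .
    hence 1: "((\<lambda>w. sn w / (w - node q)) \<longlongrightarrow> of_real (pi / h * ?C)) (at (node q))"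
      by (simp only: sn0 of_real_mult diff_zero)
    have "node q \<in> S" using pts_S node_in by auto
    \<comment> \<open>Near \<open>node q\<close> the product f(w) (w - node q) is F(w)/(w - x)
      divided by the difference quotient of \<open>sn\<close>, whose limit (pi/h) (-1)^q is
      nonzero.\<close>
    have "((\<lambda>w. F w / (w - of_real x) / (sn w / (w - node q))) \<longlongrightarrow>
        F (node q) / (node q - of_real x) / of_real (pi / h * ?C)) (at (node q))"
      using off'[of q] h_pos C0
      by (intro tendsto_divide cont_F 1 tendsto_diff tendsto_ident_at tendsto_const \<open>node q \<in> S\<close>)
        (auto simp del: cos_npi_int)
    moreover have "F (node q) / (node q - of_real x) / of_real (pi / h * ?C)
        = - F (node q) * of_real (sinc_basis q h x) / sn (of_real x)"
    proof -
      have "sin (pi / h * x) \<noteq> 0" using sn_x0 unfolding sn_x by simp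
      hence "1 / (of_int q * h - x) / (pi / h * ?C) = - sinc_basis q h x / sin (pi / h * x)"
        unfolding sinc_basis_alt[OF off] using C0 h_pos off[of q]
        by (simp add: divide_simps del: cos_npi_int) (simp add: algebra_simps del: cos_npi_int)
      from arg_cong[OF this, of complex_of_real]
      have "1 / (node q - of_real x) / of_real (pi / h * ?C) = - of_real (sinc_basis q h x) / sn (of_real x)"
        unfolding sn_x node_def
        by (simp only: of_real_diff of_real_divide of_real_minus of_real_1)
      hence "F (node q) * (1 / (node q - of_real x) / of_real (pi / h * ?C))
         = F (node q) * (- of_real (sinc_basis q h x) / sn (of_real x))"
        by (simp only: )
      thus ?thesis by simp
    qed
    ultimately have "((\<lambda>w. F w / (w - of_real x) / (sn w / (w - node q))) \<longlongrightarrow>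
        - F (node q) * of_real (sinc_basis q h x) / sn (of_real x)) (at (node q))"
      by simp
    thus "((\<lambda>w. f w * (w - node q)) \<longlongrightarrow> - F (node q) * of_real (sinc_basis q h x) / sn (of_real x)) (at (node q))"
      by (rule Lim_transform_eventually) (simp add: f_def eventually_at_filter)
  qed
  have inj: "inj_on node {- int (2 * L)..int (2 * L)}"
    using h_pos by (auto simp: node_def inj_on_def)
  have "(\<Sum>z\<in>pts. residue f z) = residue f (of_real x) + (\<Sum>z\<in>nodes. residue f z)"
    unfolding pts_def using off' by (subst sum.insert) (auto simp: nodes_def)
  also have "(\<Sum>z\<in>nodes. residue f z) = (\<Sum>q = - int (2 * L)..int (2 * L). residue f (node q))"
    unfolding nodes_def by (rule sum.reindex_cong[OF inj]) auto
  also have "\<dots> = - (\<Sum>q = - int (2 * L)..int (2 * L). F (node q) * of_real (sinc_basis q h x)) / sn (of_real x)"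
    by (simp add: res_q sum_divide_distrib sum_negf)
  finally show ?thesis
    unfolding Theta res_x sn_x[symmetric] node_def[symmetric] using sn_x0
    by (simp add: field_simps node_def)
qed

lemma real_off_rect:
  assumes "0 < c" "\<bar>x\<bar> \<le> real L * h"
  shows "of_real x \<notin> path_image (rect L c)"
proof -
  have "real L * h < half_width L"
    using h_pos by (auto simp: half_width_def intro!: mult_strict_right_mono)
  thus ?thesis using assms by (auto simp: path_image_rect)
qed

lemma Theta_has_derivative:
  assumes "d / 2 \<le> c" "c < d" "\<bar>x\<bar> \<le> real L * h"
  shows "(Theta L c has_field_derivative Theta' L c (of_real x)) (at (of_real x))"
proof -
  have "0 < c" using assms d_pos by linarith
  have "((\<lambda>w. contour_integral (rect L c) (\<lambda>u. F u / sn u / (u - w)) / (2 * pi * \<i>)) has_field_derivative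
      Theta' L c (of_real x)) (at (of_real x))"
    unfolding Theta'_def rect_def
    by (intro DERIV_cdivide Cauchy_integral_rectpath_derivative)
      (use kernel_continuous[OF assms(1,2)] real_off_rect[OF \<open>0 < c\<close> assms(3)] in \<open>auto simp: rect_def\<close>)
  thus ?thesis by (simp add: Theta_def [abs_def])
qed

lemma kernel_horizontal:
  assumes "d / 2 \<le> c" "c < d" "\<bar>Im z\<bar> = c"
  shows "norm (F z / sn z) \<le> 4 * exp (- pi * c / h) * B / (cosh (Re z))\<^sup>2"
proof -
  have "norm (F z / sn z) \<le> (B / (cosh (Re z))\<^sup>2) / (exp (pi * c / h) / 4)"
    unfolding norm_divide
    by (rule frac_le[OF _ decay _ norm_sn_horizontal]) (use assms B_nonneg in \<open>auto simp: strip_def\<close>)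
  also have "\<dots> = 4 * exp (- pi * c / h) * B / (cosh (Re z))\<^sup>2"
    by (simp add: exp_minus field_simps)
  finally show ?thesis .
qed

lemma kernel_vertical:
  assumes "c < d" "\<bar>Re z\<bar> = half_width L" "\<bar>Im z\<bar> \<le> c"
  shows "norm (F z / sn z) \<le> B"
proof -
  have "norm (F z / sn z) \<le> (B / (cosh (Re z))\<^sup>2) / 1"
    unfolding norm_divide
    by (rule frac_le[OF _ decay _ norm_sn_vertical]) (use assms B_nonneg in \<open>auto simp: strip_def\<close>)
  also have "\<dots> \<le> B / 1"
    using cosh_real_ge_1[of "Re z"] B_nonneg
    by (simp only: div_by_1) (rule divide_left_mono[of 1 _ B, simplified], auto simp: one_le_power)
  finally show ?thesis by simp
qed

text \<open>On the horizontal sides |z - x| \<ge> c \<ge> d/2 and the kernel is exponentially small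
  in 1/h, with tanh as bounded primitive of the majorant. On the vertical sides only |z - x| \<ge> L
  h helps; that contribution vanishes for L to infinity. The constant 32 is not sharp: the division
  by 2 pi is spent on the second term alone.\<close>

lemma norm_Theta_le:
  assumes c: "d / 2 \<le> c" "c < d" and L: "0 < L" and x: "\<bar>x\<bar> \<le> real L * h"
  shows "norm (Theta L c (of_real x)) \<le> 32 * B / d * exp (- pi * c / h) + d * B / (real L * h)"
proof -
  define k where "k = 4 * exp (- pi * c / h) * B / c"
  define I where "I = contour_integral (rect L c) (\<lambda>z. F z / sn z / (z - of_real x))"
  have c_pos: "0 < c" using c d_pos by linarith
  have Lh: "0 < real L * h" using L h_pos by simp
  have k0: "0 \<le> k" using B_nonneg c_pos by (simp add: k_def)
  have "norm I \<le> 2 * (k * tanh (half_width L) - k * tanh (- half_width L)) + 4 * c * (B / (real L * h))"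
    unfolding I_def rect_def
  proof (rule contour_integral_rectpath_bound[where w = "\<lambda>s. k * (1 / (cosh s)\<^sup>2)"])
    show "0 < half_width L" "0 < c" by (fact half_width_pos c_pos)+
    show "continuous_on (path_image (rectpath (Complex (- half_width L) (- c)) (Complex (half_width L) c)))
        (\<lambda>z. F z / sn z / (z - of_real x))"
      by (rule continuous_on_divide[OF kernel_continuous[OF c, of L, unfolded rect_def]])
        (use real_off_rect[OF c_pos x] in \<open>auto simp: rect_def intro!: continuous_intros\<close>)
    show "((\<lambda>s. k * tanh s) has_real_derivative k * (1 / (cosh s)\<^sup>2)) (at s)" for s
      by (intro DERIV_cmult has_real_derivative_tanh)
  next
    fix s e :: real assume s: "\<bar>e\<bar> = c"
    have "c \<le> norm (Complex s e - of_real x)"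
      using abs_Im_le_cmod[of "Complex s e - of_real x"] s by simp
    hence "norm (F (Complex s e) / sn (Complex s e) / (Complex s e - of_real x))
        \<le> (4 * exp (- pi * c / h) * B / (cosh s)\<^sup>2) / c"
      unfolding norm_divide[of _ "Complex s e - of_real x"]
      using kernel_horizontal[OF c, of "Complex s e"] s c_pos B_nonneg
      by (intro frac_le) auto
    thus "norm (F (Complex s e) / sn (Complex s e) / (Complex s e - of_real x)) \<le> k * (1 / (cosh s)\<^sup>2)"
      by (simp add: k_def mult_ac)
  next
    fix s e :: real assume s: "\<bar>s\<bar> = half_width L" "\<bar>e\<bar> \<le> c"
    have "real L * h + real L * h \<le> half_width L"
      using h_pos by (simp add: half_width_def algebra_simps)
    hence "real L * h \<le> \<bar>s - x\<bar>" using s x by linarith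
    also have "\<dots> \<le> norm (Complex s e - of_real x)"
      using abs_Re_le_cmod[of "Complex s e - of_real x"] by simp
    finally show "norm (F (Complex s e) / sn (Complex s e) / (Complex s e - of_real x)) \<le> B / (real L * h)"
      unfolding norm_divide[of _ "Complex s e - of_real x"]
      using kernel_vertical[OF c(2), of "Complex s e" L] s Lh B_nonneg
      by (intro frac_le) auto
  qed
  also have "\<dots> \<le> 4 * k + 4 * c * (B / (real L * h))"
    using mult_left_mono[OF less_imp_le[OF tanh_real_lt_1] k0, of "half_width L"] by simp
  also have "\<dots> \<le> 4 * (8 * B / d * exp (- pi * c / h)) + 4 * (d * B / (real L * h))"
  proof -
    have "4 * exp (- pi * c / h) * B / c \<le> 4 * exp (- pi * c / h) * B / (d / 2)"
      using c d_pos B_nonneg by (intro divide_left_mono) auto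
    hence 1: "k \<le> 8 * B / d * exp (- pi * c / h)" by (simp add: k_def mult_ac)
    have "c * (B / (real L * h)) \<le> d * (B / (real L * h))"
      using c B_nonneg Lh by (intro mult_right_mono) auto
    thus ?thesis using 1 by simp
  qed
  finally have "norm I \<le> 32 * B / d * exp (- pi * c / h) + 4 * (d * B / (real L * h))" by simp
  moreover have "norm (Theta L c (of_real x)) = norm I / (2 * pi)"
    by (simp add: Theta_def I_def norm_divide norm_mult)
  moreover have "norm I / (2 * pi) \<le> norm I / 4"
    using pi_gt3 by (intro divide_left_mono) auto
  moreover have "0 \<le> 32 * B / d * exp (- pi * c / h)" using B_nonneg d_pos by simp
  ultimately show ?thesis by linarith
qed

text \<open>Besides exp(-pi c/h), decay in x is essential: \<open>Theta'\<close> will be integrated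
  over an interval of length up to 2 L h, and the factor 1/(1 + x^2) keeps that integral bounded as
  L grows.\<close>

lemma norm_Theta'_le:
  assumes c: "d / 2 \<le> c" "c < d" and L: "0 < L" and x: "\<bar>x\<bar> \<le> real L * h"
  shows "norm (Theta' L c (of_real x))
     \<le> 16 * (1 + 4 / d\<^sup>2) * B * exp (- pi * c / h) * (1 / (1 + x\<^sup>2)) + d * B / (real L * h)\<^sup>2"
proof -
  define k where "k = 4 * exp (- pi * c / h) * B * (4 * (1 + 4 / d\<^sup>2) / (1 + x\<^sup>2))"
  define I where "I = contour_integral (rect L c) (\<lambda>z. F z / sn z / (z - of_real x)\<^sup>2)"
  have c_pos: "0 < c" using c d_pos by linarith
  have Lh: "0 < real L * h" using L h_pos by simp
  have x2: "0 < 1 + x\<^sup>2" by (simp add: add_pos_nonneg)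
  have k0: "0 \<le> k" using B_nonneg x2 by (simp add: k_def)
  have "norm I \<le> 2 * (k * (2 * arctan (exp (half_width L))) - k * (2 * arctan (exp (- half_width L))))
      + 4 * c * (B / (real L * h)\<^sup>2)"
    unfolding I_def rect_def
  proof (rule contour_integral_rectpath_bound[where w = "\<lambda>s. k * (1 / cosh s)"])
    show "0 < half_width L" "0 < c" by (fact half_width_pos c_pos)+
    show "continuous_on (path_image (rectpath (Complex (- half_width L) (- c)) (Complex (half_width L) c)))
        (\<lambda>z. F z / sn z / (z - of_real x)\<^sup>2)"
      by (rule continuous_on_divide[OF kernel_continuous[OF c, of L, unfolded rect_def]])
        (use real_off_rect[OF c_pos x] in \<open>auto simp: rect_def intro!: continuous_intros\<close>)
    show "((\<lambda>s. k * (2 * arctan (exp s))) has_real_derivative k * (1 / cosh s)) (at s)" for s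
      by (intro DERIV_cmult has_real_derivative_arctan_exp)
  next
    fix s e :: real assume s: "\<bar>e\<bar> = c"
    define D where "D = norm ((Complex s e - of_real x)\<^sup>2)"
    have e2: "e\<^sup>2 = c\<^sup>2" using s by (metis power2_abs)
    have D: "D = (s - x)\<^sup>2 + c\<^sup>2"
      using e2 by (simp add: D_def norm_power cmod_power2)
    have D_pos: "0 < D" unfolding D using c_pos by (simp add: add_nonneg_pos)
    \<comment> \<open>Peetre's inequality: moving the decay from s - x to x costs 1 + s^2. This is
      paid with one of the two factors cosh s in the kernel; the remaining 1/cosh s still has a
      bounded primitive.\<close>
    have "1 + x\<^sup>2 \<le> 2 * (1 + s\<^sup>2) * (1 + (s - x)\<^sup>2)"
    proof -
      have "0 \<le> (2 * s - x)\<^sup>2 + 1 + 2 * s\<^sup>2 * (s - x)\<^sup>2" by simp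
      thus ?thesis by (simp add: power2_eq_square algebra_simps)
    qed
    also have "\<dots> \<le> 2 * (1 + s\<^sup>2) * ((1 + 4 / d\<^sup>2) * D)"
    proof (rule mult_left_mono)
      have "(d / 2)\<^sup>2 \<le> c\<^sup>2" using c d_pos by (intro power_mono) auto
      hence "1 \<le> 4 / d\<^sup>2 * c\<^sup>2" using d_pos by (simp add: field_simps power2_eq_square)
      moreover have "0 \<le> 4 / d\<^sup>2 * (s - x)\<^sup>2" by simp
      ultimately show "1 + (s - x)\<^sup>2 \<le> (1 + 4 / d\<^sup>2) * D"
        unfolding D by (simp only: distrib_left distrib_right) (smt (verit) mult_1 zero_le_power2)
    qed simp
    also have "\<dots> \<le> 2 * (2 * cosh s) * ((1 + 4 / d\<^sup>2) * D)"
      using one_plus_square_le_cosh[of s] D_pos by (intro mult_right_mono) auto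
    finally have "1 / D \<le> 4 * (1 + 4 / d\<^sup>2) / (1 + x\<^sup>2) * cosh s"
      using D_pos x2 by (simp add: field_simps)
    hence "(4 * exp (- pi * c / h) * B / (cosh s)\<^sup>2) * (1 / D) \<le>
        (4 * exp (- pi * c / h) * B / (cosh s)\<^sup>2) * (4 * (1 + 4 / d\<^sup>2) / (1 + x\<^sup>2) * cosh s)"
      using B_nonneg by (intro mult_left_mono) auto
    also have "\<dots> = k * (1 / cosh s)"
      by (simp add: k_def power2_eq_square mult_ac)
    finally have *: "(4 * exp (- pi * c / h) * B / (cosh s)\<^sup>2) * (1 / D) \<le> k * (1 / cosh s)" .
    have "norm (F (Complex s e) / sn (Complex s e) / (Complex s e - of_real x)\<^sup>2)
        \<le> (4 * exp (- pi * c / h) * B / (cosh s)\<^sup>2) / D"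
      unfolding norm_divide[of _ "(Complex s e - of_real x)\<^sup>2"] D_def
      using kernel_horizontal[OF c, of "Complex s e"] s D_pos
      by (intro divide_right_mono) auto
    thus "norm (F (Complex s e) / sn (Complex s e) / (Complex s e - of_real x)\<^sup>2) \<le> k * (1 / cosh s)"
      using * by simp
  next
    fix s e :: real assume s: "\<bar>s\<bar> = half_width L" "\<bar>e\<bar> \<le> c"
    have "real L * h + real L * h \<le> half_width L"
      using h_pos by (simp add: half_width_def algebra_simps)
    hence "real L * h \<le> \<bar>s - x\<bar>" using s x by linarith
    also have "\<dots> \<le> norm (Complex s e - of_real x)"
      using abs_Re_le_cmod[of "Complex s e - of_real x"] by simp
    finally have "(real L * h)\<^sup>2 \<le> norm ((Complex s e - of_real x)\<^sup>2)"
      unfolding norm_power using Lh by (intro power_mono) auto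
    thus "norm (F (Complex s e) / sn (Complex s e) / (Complex s e - of_real x)\<^sup>2) \<le> B / (real L * h)\<^sup>2"
      unfolding norm_divide[of _ "(Complex s e - of_real x)\<^sup>2"]
      using kernel_vertical[OF c(2), of "Complex s e" L] s Lh B_nonneg L
      by (intro frac_le) auto
  qed
  also have "\<dots> \<le> 2 * (k * pi) + 4 * (d * B / (real L * h)\<^sup>2)"
  proof -
    have "2 * arctan (exp (half_width L)) - 2 * arctan (exp (- half_width L)) \<le> pi"
    proof -
      have "0 \<le> arctan (exp (- half_width L))" by simp
      thus ?thesis using arctan_ubound[of "exp (half_width L)"] by linarith
    qed
    from mult_left_mono[OF this k0]
    have "k * (2 * arctan (exp (half_width L))) - k * (2 * arctan (exp (- half_width L))) \<le> k * pi"
      by (simp add: algebra_simps)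
    moreover have "c * (B / (real L * h)\<^sup>2) \<le> d * (B / (real L * h)\<^sup>2)"
      using c B_nonneg by (intro mult_right_mono) auto
    ultimately show ?thesis by simp
  qed
  finally have "norm I / (2 * pi) \<le> (2 * (k * pi) + 4 * (d * B / (real L * h)\<^sup>2)) / (2 * pi)"
    by (intro divide_right_mono) auto
  also have "\<dots> = k + (4 * (d * B / (real L * h)\<^sup>2)) / (2 * pi)"
    by (simp add: field_simps)
  also have "\<dots> \<le> k + (4 * (d * B / (real L * h)\<^sup>2)) / 4"
    using pi_gt3 B_nonneg d_pos by (intro add_left_mono divide_left_mono) auto
  finally have "norm I / (2 * pi) \<le> k + d * B / (real L * h)\<^sup>2" by simp
  moreover have "norm (Theta' L c (of_real x)) = norm I / (2 * pi)"
    by (simp add: Theta'_def I_def norm_divide norm_mult)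
  moreover have "k = 16 * (1 + 4 / d\<^sup>2) * B * exp (- pi * c / h) * (1 / (1 + x\<^sup>2))"
    by (simp add: k_def)
  ultimately show ?thesis by simp
qed

end

section \<open>The sine integral, the weights \<open>sigma\<close>, and sums over the grid\<close>

text \<open>Adding cos t / t to Si t cancels the slowly decaying part of the derivative and leaves
  -cos t / t^2. Hence R - 1/t increases and R + 1/t decreases, both to pi/2, so that R is within 1/y
  of the limit; the term cos y / y costs another 1/y.\<close>

lemma Si_asymptotics:
  assumes "0 < y"
  shows "\<bar>Si y - pi / 2\<bar> \<le> 2 / y"
proof -
  define R where "R = (\<lambda>t. Si t + cos t / t)"
  have R_deriv: "(R has_real_derivative - cos t / t\<^sup>2) (at t)" if "0 < t" for t
    unfolding R_def using that
    by (auto intro!: derivative_eq_intros DERIV_Si simp: field_simps power2_eq_square)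
  have inv_lim: "((\<lambda>t::real. 1 / t) \<longlongrightarrow> 0) at_top"
    by (rule tendsto_divide_0[OF tendsto_const filterlim_at_top_imp_at_infinity[OF filterlim_ident]])
  have "((\<lambda>t::real. cos t / t) \<longlongrightarrow> 0) at_top"
    by (rule Lim_null_comparison[OF _ inv_lim])
      (auto simp: eventually_at_top_linorder intro!: exI[of _ 1] divide_right_mono)
  from tendsto_add[OF Si_at_top this] have R_lim: "(R \<longlongrightarrow> pi / 2) at_top"
    by (simp add: R_def)
  have lim1: "((\<lambda>t. R t - 1 / t) \<longlongrightarrow> pi / 2) at_top" and lim2: "((\<lambda>t. R t + 1 / t) \<longlongrightarrow> pi / 2) at_top"
    using tendsto_diff[OF R_lim inv_lim] tendsto_add[OF R_lim inv_lim] by simp_all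
  have "R y - 1 / y \<le> pi / 2"
  proof (rule tendsto_lowerbound[OF lim1])
    have "R y - 1 / y \<le> R t - 1 / t" if "y \<le> t" for t
    proof (rule DERIV_nonneg_imp_nondecreasing[OF that])
      fix x assume "y \<le> x"
      hence x: "0 < x" using assms by simp
      have "((\<lambda>t. R t - 1 / t) has_real_derivative (1 - cos x) / x\<^sup>2) (at x)"
        using x by (auto intro!: derivative_eq_intros R_deriv simp: field_simps power2_eq_square)
      thus "\<exists>D. ((\<lambda>t. R t - 1 / t) has_real_derivative D) (at x) \<and> 0 \<le> D"
        by (intro exI[of _ "(1 - cos x) / x\<^sup>2"]) auto
    qed
    thus "\<forall>\<^sub>F t in at_top. R y - 1 / y \<le> R t - 1 / t"
      by (auto simp: eventually_at_top_linorder)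
  qed simp
  moreover have "pi / 2 \<le> R y + 1 / y"
  proof (rule tendsto_upperbound[OF lim2])
    have "R t + 1 / t \<le> R y + 1 / y" if "y \<le> t" for t
    proof (rule DERIV_nonpos_imp_nonincreasing[OF that])
      fix x assume "y \<le> x"
      hence x: "0 < x" using assms by simp
      have "((\<lambda>t. R t + 1 / t) has_real_derivative - (1 + cos x) / x\<^sup>2) (at x)"
        using x by (auto intro!: derivative_eq_intros R_deriv simp: field_simps power2_eq_square)
      moreover have "- (1 + cos x) / x\<^sup>2 \<le> 0"
        using cos_ge_minus_one[of x] by (simp add: divide_le_0_iff)
      ultimately show "\<exists>D. ((\<lambda>t. R t + 1 / t) has_real_derivative D) (at x) \<and> D \<le> 0"
        by blast
    qed
    thus "\<forall>\<^sub>F t in at_top. R t + 1 / t \<le> R y + 1 / y"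
      by (auto simp: eventually_at_top_linorder)
  qed simp
  moreover have "cos y / y \<le> 1 / y"
    using assms by (intro divide_right_mono) simp_all
  moreover have "- 1 / y \<le> cos y / y"
    using assms by (intro divide_right_mono) simp_all
  moreover have "2 / y = 1 / y + 1 / y" "- 1 / y = - (1 / y)" by simp_all
  ultimately have "Si y - pi / 2 \<le> 2 / y" "- (Si y - pi / 2) \<le> 2 / y"
    unfolding R_def by linarith+
  thus ?thesis by (rule abs_leI)
qed

lemma sigma_minus: "sigma (- k) = 1 - sigma k"
  by (cases "k \<ge> 0") (auto simp: sigma_def Si_neg Si_neg[of "- (pi * of_int k)", simplified]
      mult_nonneg_nonpos field_simps)

text \<open>For k > 0 the tail bound of Si gives 2/(pi^2 k), and negative k follow by reflection.
  The step takes the value 0 at k = 0, so the matrix of its values is strictly lower triangular; the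
  diagonal value sigma(0) = 1/2 is left to the remainder.\<close>

lemma sigma_close_to_step: "\<bar>sigma k - of_bool (k > 0)\<bar> \<le> 1 / (1 + \<bar>of_int k\<bar>)"
proof -
  have pos: "\<bar>sigma k - 1\<bar> \<le> 1 / (1 + of_int k)" if "k > 0" for k
  proof -
    have "\<bar>sigma k - 1\<bar> = \<bar>Si (pi * of_int k) - pi / 2\<bar> / pi"
    proof -
      have "sigma k - 1 = (Si (pi * of_int k) - pi / 2) / pi"
        by (simp add: sigma_def field_simps)
      thus ?thesis by (simp add: abs_divide)
    qed
    also have "\<dots> \<le> 2 / (pi * of_int k) / pi"
      using that by (intro divide_right_mono Si_asymptotics) auto
    also have "\<dots> \<le> 1 / (1 + of_int k)"
    proof -
      have "9 \<le> pi * pi" using mult_mono[of 3 pi 3 pi] pi_gt3 by simp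
      hence "9 * of_int k \<le> pi * pi * (of_int k :: real)"
        using that by (intro mult_right_mono) auto
      moreover have "1 \<le> (of_int k :: real)" using that by simp
      ultimately have "2 * (1 + of_int k) \<le> pi * pi * (of_int k :: real)"
        unfolding distrib_left by linarith
      thus ?thesis using that by (simp add: divide_simps mult_ac)
    qed
    finally show ?thesis .
  qed
  consider "k > 0" | "k = 0" | "k < 0" by linarith
  thus ?thesis
  proof cases
    case 1 thus ?thesis using pos by simp
  next
    case 2
    moreover have "Si 0 = 0" using Si_neg[of 0] by simp
    ultimately show ?thesis by (simp add: sigma_def)
  next
    case 3
    hence "\<bar>sigma k\<bar> = \<bar>sigma (- k) - 1\<bar>" using sigma_minus[of k] by simp
    thus ?thesis using 3 pos[of "- k"] by simp
  qed
qed

lemma abs_sigma_le: "\<bar>sigma k\<bar> \<le> 2"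
proof -
  have "1 / (1 + \<bar>of_int k\<bar>) \<le> (1::real)" by simp
  with sigma_close_to_step[of k] have "\<bar>sigma k - of_bool (k > 0)\<bar> \<le> 1" by linarith
  thus ?thesis by (cases "k > 0") simp_all
qed

lemma abs_sinc_le_1: "\<bar>sinc x\<bar> \<le> 1"
  using abs_sin_x_le_abs_x[of x] by (simp add: abs_divide divide_le_eq)

lemma abs_sinc_basis_le_1: "\<bar>sinc_basis q h x\<bar> \<le> 1"
  unfolding sinc_basis_def by (rule abs_sinc_le_1)

lemma sinc_basis_grid:
  assumes "h \<noteq> 0"
  shows "sinc_basis q h (of_int p * h) = of_bool (p = q)"
  using assms sin_npi_int[of "p - q"] by (auto simp: sinc_basis_def)

lemma sum_symmetric_int:
  fixes f :: "int \<Rightarrow> 'a::comm_monoid_add"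
  shows "(\<Sum>q = - int M..int M. f q) = f 0 + (\<Sum>q = 1..M. f (int q) + f (- int q))"
proof (induction M)
  case (Suc M)
  have range: "{- int (Suc M)..int (Suc M)} = insert (- int (Suc M)) (insert (int (Suc M)) {- int M..int M})"
    by auto
  have "(\<Sum>q = - int (Suc M)..int (Suc M). f q)
      = f (- int (Suc M)) + (f (int (Suc M)) + (\<Sum>q = - int M..int M. f q))"
    unfolding range by (simp add: sum.insert del: of_nat_Suc)
  thus ?case using Suc by (simp add: add_ac)
qed simp

text \<open>The integral test, carried out with a primitive: by the mean value theorem each h w(q h)
  with q > 0 is at most the increment of \<open>W\<close> over the cell to its left. The central
  term has no such cell and contributes h w(0).\<close>

lemma symmetric_decreasing_sum_le:
  fixes w W :: "real \<Rightarrow> real"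
  assumes deriv: "\<And>x. (W has_real_derivative w x) (at x)"
    and even: "\<And>x. w (- x) = w x"
    and decr: "\<And>x y. 0 \<le> x \<Longrightarrow> x \<le> y \<Longrightarrow> w y \<le> w x"
    and h: "0 < h"
  shows "h * (\<Sum>q = - int M..int M. w (of_int q * h)) \<le> h * w 0 + 2 * (W (real M * h) - W 0)"
proof -
  have "h * (\<Sum>q = 1..M. w (real q * h)) \<le> W (real M * h) - W 0"
  proof (induction M)
    case (Suc M)
    have "real M * h < real (Suc M) * h" using h by simp
    then obtain \<xi> where \<xi>: "real M * h < \<xi>" "\<xi> < real (Suc M) * h"
        "W (real (Suc M) * h) - W (real M * h) = (real (Suc M) * h - real M * h) * w \<xi>"
      using MVT2[of _ _ W w] deriv by blast
    have "0 \<le> real M * h" using h by simp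
    hence "w (real (Suc M) * h) \<le> w \<xi>"
      using \<xi> by (intro decr) linarith+
    hence "h * w (real (Suc M) * h) \<le> h * w \<xi>" using h by simp
    also have "\<dots> = W (real (Suc M) * h) - W (real M * h)"
      unfolding \<xi>(3) by (simp add: algebra_simps)
    finally show ?case using Suc by (simp add: algebra_simps)
  qed simp
  moreover have "(\<Sum>q = - int M..int M. w (of_int q * h)) = w 0 + 2 * (\<Sum>q = 1..M. w (real q * h))"
    unfolding sum_symmetric_int
    by (simp add: even sum_distrib_left flip: mult_2)
  ultimately show ?thesis by (simp add: algebra_simps)
qed

lemma sum_inverse_cosh_square_le:
  fixes h :: real
  assumes "0 < h"
  shows "h * (\<Sum>q = - int M..int M. 1 / (cosh (of_int q * h))\<^sup>2) \<le> h + 2"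
proof -
  have "h * (\<Sum>q = - int M..int M. 1 / (cosh (of_int q * h))\<^sup>2)
      \<le> h * (1 / (cosh (0::real))\<^sup>2) + 2 * (tanh (real M * h) - tanh 0)"
    using assms
    by (intro symmetric_decreasing_sum_le has_real_derivative_tanh)
      (auto intro!: divide_left_mono power_mono simp: cosh_real_nonneg_le_iff)
  thus ?thesis using tanh_real_lt_1[of "real M * h"] by simp
qed

lemma sum_inverse_cosh_le:
  fixes h :: real
  assumes "0 < h"
  shows "h * (\<Sum>q = - int M..int M. 1 / cosh (of_int q * h)) \<le> h + 2 * pi"
proof -
  have "h * (\<Sum>q = - int M..int M. 1 / cosh (of_int q * h))
      \<le> h * (1 / cosh (0::real)) + 2 * (2 * arctan (exp (real M * h)) - 2 * arctan (exp 0))"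
    using assms
    by (intro symmetric_decreasing_sum_le has_real_derivative_arctan_exp)
      (auto intro!: divide_left_mono simp: cosh_real_nonneg_le_iff)
  hence "h * (\<Sum>q = - int M..int M. 1 / cosh (of_int q * h)) \<le> h + (4 * arctan (exp (real M * h)) - pi)"
    by simp
  moreover have "2 * arctan (exp (real M * h)) \<le> pi" using arctan_ubound[of "exp (real M * h)"] by simp
  ultimately show ?thesis using pi_gt_zero by linarith
qed

section \<open>Interpolation and indefinite integration errors\<close>

context sinc_strip
begin

text \<open>The contour has to stay inside the open strip. Since K and r do not depend on c,
  continuity lets c tend to d and recovers the full exponent pi d/h.\<close>

lemma le_limit_height:
  assumes "\<And>c. d / 2 \<le> c \<Longrightarrow> c < d \<Longrightarrow> a \<le> K * exp (- pi * c / h) + r"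
  shows "a \<le> K * exp (- pi * d / h) + r"
proof (rule tendsto_lowerbound)
  show "((\<lambda>c. K * exp (- pi * c / h) + r) \<longlongrightarrow> K * exp (- pi * d / h) + r) (at_left d)"
    using h_pos by (intro tendsto_intros) auto
  show "\<forall>\<^sub>F c in at_left d. a \<le> K * exp (- pi * c / h) + r"
    unfolding eventually_at_left_field
    using d_pos by (intro exI[of _ "d / 2"] conjI allI impI assms) auto
qed simp

text \<open>At a grid point both sides vanish, the left one by the cardinal property of the basis
  and the right one by the zero of the sine; elsewhere the residue identity applies.\<close>

lemma sinc_interpolation_identity:
  assumes c: "d / 2 \<le> c" "c < d" and x: "\<bar>x\<bar> \<le> real L * h"
  shows "F (of_real x) - (\<Sum>q = - int (2 * L)..int (2 * L). F (of_real (of_int q * h)) * of_real (sinc_basis q h x))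
           = of_real (sin (pi / h * x)) * Theta L c (of_real x)"
proof (cases "\<exists>p::int. x = of_int p * h")
  case True
  then obtain p :: int where p: "x = of_int p * h" by blast
  have "\<bar>of_int p\<bar> * h \<le> real L * h" using x h_pos by (simp add: p abs_mult)
  hence "\<bar>of_int p\<bar> \<le> real L" using h_pos by simp
  hence p_le: "\<bar>p\<bar> \<le> int L" by linarith
  have "(\<Sum>q = - int (2 * L)..int (2 * L). F (of_real (of_int q * h)) * of_real (sinc_basis q h x))
      = (\<Sum>q = - int (2 * L)..int (2 * L). if p = q then F (of_real (of_int q * h)) else 0)"
    using h_pos by (intro sum.cong) (auto simp: p sinc_basis_grid)
  also have "\<dots> = F (of_real x)" using p_le by (auto simp: p abs_le_iff)
  finally have eq: "(\<Sum>q = - int (2 * L)..int (2 * L). F (of_real (of_int q * h)) * of_real (sinc_basis q h x))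
      = F (of_real x)" .
  have "sin (pi / h * x) = 0" using h_pos sin_npi_int[of p] by (simp add: p)
  thus ?thesis unfolding eq by simp
next
  case False
  thus ?thesis using sinc_interpolation_identity_off_grid[OF assms] by blast
qed

lemma sinc_interpolation_wide:
  assumes L: "0 < L" and x: "\<bar>x\<bar> \<le> real L * h"
  shows "norm (F (of_real x) - (\<Sum>q = - int (2 * L)..int (2 * L). F (of_real (of_int q * h)) * of_real (sinc_basis q h x)))
           \<le> 32 * B / d * exp (- pi * d / h) + d * B / (real L * h)"
proof (rule le_limit_height)
  fix c assume c: "d / 2 \<le> c" "c < d"
  have "norm (of_real (sin (pi / h * x)) * Theta L c (of_real x)) \<le> 1 * norm (Theta L c (of_real x))"
    unfolding norm_mult by (intro mult_right_mono) simp_all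
  thus "norm (F (of_real x) - (\<Sum>q = - int (2 * L)..int (2 * L). F (of_real (of_int q * h)) * of_real (sinc_basis q h x)))
           \<le> 32 * B / d * exp (- pi * c / h) + d * B / (real L * h)"
    unfolding sinc_interpolation_identity[OF c x] using norm_Theta_le[OF c L x] by simp
qed

text \<open>The weight of the q-th sample is the integral of \<open>sinc_basis q h\<close> from
  minus infinity to x, expressed by Si. At x = p h it equals h sigma(p - q), the weight used in the
  linear system.\<close>

definition indef_error :: "(real \<Rightarrow> complex) \<Rightarrow> complex \<Rightarrow> nat \<Rightarrow> real \<Rightarrow> complex" where
  "indef_error u r M x = u x - r -
     (\<Sum>q = - int M..int M. F (of_real (of_int q * h)) * of_real (h * (1 / 2 + Si (pi * (x / h - of_int q)) / pi)))"

lemma indef_error_grid: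
  "indef_error u r M (of_int p * h) = u (of_int p * h) - r -
     of_real h * (\<Sum>q = - int M..int M. F (of_real (of_int q * h)) * of_real (sigma (p - q)))"
  using h_pos by (simp add: indef_error_def sigma_def sum_distrib_left mult_ac)

text \<open>Integration starts at -L h instead of minus infinity, so the error at that point remains
  as a summand; it is shown separately to vanish for L to infinity. In the main term the factor h
  appears without any factor for the length of the interval.\<close>

lemma indef_error_wide:
  assumes u: "\<And>x. (u has_vector_derivative F (of_real x)) (at x)" and L: "0 < L" and p: "\<bar>p\<bar> \<le> int L"
  shows "norm (indef_error u r (2 * L) (of_int p * h)) \<le>
     64 * (1 / d + 1 + 1 / d\<^sup>2) * B * h * exp (- pi * d / h) +
     (norm (indef_error u r (2 * L) (of_int (- int L) * h)) + 4 * d * B / real L)"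
proof (rule le_limit_height)
  fix c assume c: "d / 2 \<le> c" "c < d"
  define x0 where "x0 = - (real L * h)"
  define x1 where "x1 = of_int p * h"
  define e where "e = exp (- pi * c / h)"
  define K where "K = 16 * (1 + 4 / d\<^sup>2) * B * e"
  define V where "V = d * B / (real L * h)\<^sup>2"
  define \<rho> where "\<rho> = indef_error u r (2 * L)"
  \<comment> \<open>\<open>\<rho>' = sin (\<pi>x/h) \<Theta>(x)\<close>: integrating the oscillating factor gains \<open>h\<close>, since \<open>\<chi>' = (h/\<pi>) cos (\<pi>x/h) \<Theta>'(x)\<close>.\<close>
  define \<chi> where "\<chi> = (\<lambda>x. \<rho> x + of_real (h / pi * cos (pi / h * x)) * Theta L c (of_real x))"
  \<comment> \<open>A primitive of the majorant of |\<chi>'|. Its arctan part varies by at most pi,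
    uniformly in L; its linear part has slope proportional to V, and after multiplication by the
    length 2 L h and by h it is of order 1/L.\<close>
  define \<phi> where "\<phi> = (\<lambda>x. h / pi * (K * arctan x + V * x))"
  have Lh: "0 < real L * h" using L h_pos by simp
  have nonneg: "0 \<le> K" "0 \<le> V" "0 \<le> e" using B_nonneg d_pos by (simp_all add: K_def V_def e_def)
  have "- real L \<le> of_int p" "of_int p \<le> real L" using p by linarith+
  hence le_x1: "- real L * h \<le> of_int p * h" "of_int p * h \<le> real L * h"
    using mult_right_mono[of "- real L" "of_int p" h] mult_right_mono[of "of_int p" "real L" h] h_pos
    by simp_all
  hence x1: "x0 \<le> x1" "\<bar>x1\<bar> \<le> real L * h" by (auto simp: x0_def x1_def abs_le_iff)
  have range: "\<bar>x\<bar> \<le> real L * h" if "x0 \<le> x" "x \<le> x1" for x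
    using that x1 by (auto simp: x0_def)
  have \<rho>_deriv: "(\<rho> has_vector_derivative of_real (sin (pi / h * x)) * Theta L c (of_real x)) (at x)"
    if "\<bar>x\<bar> \<le> real L * h" for x
  proof -
    have "((\<lambda>x. of_real (h * (1 / 2 + Si (pi * (x / h - of_int q)) / pi)) :: complex) has_vector_derivative
        of_real (sinc_basis q h x)) (at x)" for q
    proof (rule has_vector_derivative_of_real)
      have "((\<lambda>x. h * (1 / 2 + Si (pi * (x / h - of_int q)) / pi)) has_real_derivative
          h * (sinc (pi * (x / h - of_int q)) * (pi / h) / pi)) (at x)"
        using h_pos by (auto intro!: derivative_eq_intros DERIV_chain2[OF DERIV_Si])
      also have "h * (sinc (pi * (x / h - of_int q)) * (pi / h) / pi) = sinc_basis q h x"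
        using h_pos by (simp add: sinc_basis_def)
      finally show "((\<lambda>x. h * (1 / 2 + Si (pi * (x / h - of_int q)) / pi)) has_real_derivative sinc_basis q h x) (at x)" .
    qed
    hence "(\<rho> has_vector_derivative F (of_real x) - 0
        - (\<Sum>q = - int (2 * L)..int (2 * L). F (of_real (of_int q * h)) * of_real (sinc_basis q h x))) (at x)"
      unfolding \<rho>_def indef_error_def
      by (intro has_vector_derivative_diff u has_vector_derivative_const has_vector_derivative_sum
          has_vector_derivative_mult_right)
    thus ?thesis using sinc_interpolation_identity[OF c that] by simp
  qed
  have \<chi>_deriv: "(\<chi> has_vector_derivative of_real (h / pi * cos (pi / h * x)) * Theta' L c (of_real x)) (at x)"
    if "\<bar>x\<bar> \<le> real L * h" for x
  proof -
    have "((\<lambda>x. of_real (h / pi * cos (pi / h * x)) :: complex) has_vector_derivative of_real (- sin (pi / h * x))) (at x)"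
      using h_pos by (intro has_vector_derivative_of_real)
        (auto intro!: derivative_eq_intros)
    moreover have "((\<lambda>x. Theta L c (of_real x)) has_vector_derivative Theta' L c (of_real x)) (at x)"
      by (rule has_vector_derivative_real_field) (rule Theta_has_derivative[OF c that])
    ultimately have "((\<lambda>x. of_real (h / pi * cos (pi / h * x)) * Theta L c (of_real x)) has_vector_derivative
        (of_real (h / pi * cos (pi / h * x)) * Theta' L c (of_real x) + of_real (- sin (pi / h * x)) * Theta L c (of_real x))) (at x)"
      by (rule has_vector_derivative_mult)
    from has_vector_derivative_add[OF \<rho>_deriv[OF that] this]
    have "(\<chi> has_vector_derivative of_real (sin (pi / h * x)) * Theta L c (of_real x) +
        (of_real (h / pi * cos (pi / h * x)) * Theta' L c (of_real x) + of_real (- sin (pi / h * x)) * Theta L c (of_real x))) (at x)"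
      unfolding \<chi>_def .
    thus ?thesis by simp
  qed
  have \<phi>_deriv: "(\<phi> has_real_derivative h / pi * (K * (1 / (1 + x\<^sup>2)) + V)) (at x)" for x
    unfolding \<phi>_def by (auto intro!: derivative_eq_intros simp: inverse_eq_divide)
  have "norm (\<chi> x1 - \<chi> x0) \<le> \<phi> x1 - \<phi> x0"
  proof (cases "x0 = x1")
    case False
    show ?thesis
    proof (rule differentiable_bound_general)
      show "x0 < x1" using False x1 by simp
      show "continuous_on {x0..x1} \<chi>"
        by (intro continuous_at_imp_continuous_on ballI has_vector_derivative_continuous[OF \<chi>_deriv] range) auto
      show "continuous_on {x0..x1} \<phi>"
        by (intro continuous_at_imp_continuous_on ballI DERIV_isCont[OF \<phi>_deriv])
      fix x assume "x0 < x" "x < x1"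
      hence x: "\<bar>x\<bar> \<le> real L * h" by (intro range) auto
      show "(\<chi> has_vector_derivative of_real (h / pi * cos (pi / h * x)) * Theta' L c (of_real x)) (at x)"
        by (rule \<chi>_deriv[OF x])
      show "(\<phi> has_vector_derivative h / pi * (K * (1 / (1 + x\<^sup>2)) + V)) (at x)"
        using \<phi>_deriv by (simp add: has_real_derivative_iff_has_vector_derivative)
      have "\<bar>h / pi * cos (pi / h * x)\<bar> \<le> h / pi"
        using h_pos by (simp add: abs_mult divide_right_mono mult_left_le)
      thus "norm (of_real (h / pi * cos (pi / h * x)) * Theta' L c (of_real x)) \<le> h / pi * (K * (1 / (1 + x\<^sup>2)) + V)"
        unfolding norm_mult norm_of_real K_def V_def e_def
        using norm_Theta'_le[OF c L x] h_pos by (intro mult_mono) auto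
    qed
  qed simp
  also have "\<phi> x1 - \<phi> x0 = h / pi * (K * (arctan x1 - arctan x0) + V * (x1 - x0))"
    by (simp add: \<phi>_def algebra_simps)
  also have "\<dots> \<le> h / pi * (K * pi + V * (2 * (real L * h)))"
  proof -
    have "arctan x1 - arctan x0 \<le> pi"
      using arctan_ubound[of x1] arctan_lbound[of x0] by simp
    moreover have "x1 - x0 \<le> 2 * (real L * h)" using x1(2) unfolding x0_def by linarith
    ultimately show ?thesis using h_pos nonneg by (intro mult_left_mono add_mono) auto
  qed
  also have "\<dots> = h * K + 2 / pi * (h * (V * (real L * h)))"
    by (simp add: field_simps)
  also have "h * (V * (real L * h)) = d * B / real L"
    using L h_pos by (simp add: V_def power2_eq_square)
  also have "h * K + 2 / pi * (d * B / real L) \<le> h * K + 1 * (d * B / real L)"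
    using pi_gt3 B_nonneg d_pos by (intro add_left_mono mult_right_mono) auto
  finally have 1: "norm (\<chi> x1 - \<chi> x0) \<le> h * K + d * B / real L" by simp
  have 2: "norm (of_real (h / pi * cos (pi / h * x)) * Theta L c (of_real x)) \<le> h * (32 * B / d * e) + d * B / real L"
    if "\<bar>x\<bar> \<le> real L * h" for x
  proof -
    have "\<bar>h / pi * cos (pi / h * x)\<bar> \<le> h / pi"
      using h_pos by (simp add: abs_mult divide_right_mono mult_left_le)
    also have "\<dots> \<le> h" using h_pos pi_gt3 by (simp add: field_simps)
    finally have "norm (of_real (h / pi * cos (pi / h * x)) * Theta L c (of_real x)) \<le> h * (32 * B / d * e + d * B / (real L * h))"
      unfolding norm_mult norm_of_real e_def using norm_Theta_le[OF c L that] h_pos by (intro mult_mono) auto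
    also have "\<dots> = h * (32 * B / d * e) + d * B / real L"
      using h_pos by (simp add: field_simps)
    finally show ?thesis .
  qed
  \<comment> \<open>Returning from \<chi> to \<rho> leaves the boundary terms of the integration by
    parts; they carry the factor h/pi as well, so they are of the same order as the
    integral.\<close>
  have "\<rho> x1 = (\<chi> x1 - \<chi> x0) + \<rho> x0 + of_real (h / pi * cos (pi / h * x0)) * Theta L c (of_real x0)
      - of_real (h / pi * cos (pi / h * x1)) * Theta L c (of_real x1)"
    by (simp add: \<chi>_def)
  also have "norm \<dots> \<le> (h * K + d * B / real L) + norm (\<rho> x0) + (h * (32 * B / d * e) + d * B / real L)
      + (h * (32 * B / d * e) + d * B / real L)"
  proof -
    have "norm (p + q + s - t) \<le> norm p + norm q + norm s + norm t" for p q s t :: complex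
      by (smt (verit) norm_triangle_ineq norm_triangle_ineq4)
    moreover have "\<bar>x0\<bar> \<le> real L * h" using Lh by (simp add: x0_def)
    ultimately show ?thesis using 1 2[of x0] 2[of x1] x1 by (smt (verit))
  qed
  \<comment> \<open>The constant collects 16 (1 + 4/d^2) from \<open>Theta'\<close> and twice 32/d
    from the two boundary terms; it is rounded up to a common factor 64.\<close>
  also have "\<dots> = (norm (\<rho> x0) + 3 * (d * B / real L)) + (16 + 64 / d\<^sup>2 + 64 / d) * (B * h * e)"
    by (simp add: K_def distrib_left distrib_right mult_ac)
  also have "\<dots> \<le> (norm (\<rho> x0) + 4 * (d * B / real L)) + (64 * (1 / d + 1 + 1 / d\<^sup>2)) * (B * h * e)"
    using d_pos B_nonneg h_pos nonneg by (intro add_mono mult_right_mono) auto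
  finally have "norm (\<rho> x1) \<le> (norm (\<rho> x0) + 4 * (d * B / real L)) + (64 * (1 / d + 1 + 1 / d\<^sup>2)) * (B * h * e)" .
  moreover have "of_int (- int L) * h = x0" by (simp add: x0_def)
  moreover have "64 * (1 / d + 1 + 1 / d\<^sup>2) * B * h * exp (- pi * c / h) = (64 * (1 / d + 1 + 1 / d\<^sup>2)) * (B * h * e)"
    by (simp only: e_def mult.assoc)
  moreover have "4 * d * B / real L = 4 * (d * B / real L)" by simp
  ultimately show "norm (indef_error u r (2 * L) (of_int p * h)) \<le>
     64 * (1 / d + 1 + 1 / d\<^sup>2) * B * h * exp (- pi * c / h) +
     (norm (indef_error u r (2 * L) (of_int (- int L) * h)) + 4 * d * B / real L)"
    unfolding \<rho>_def x1_def by (simp only:)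
qed

end

lemma one_plus_abs_int_le_cosh:
  fixes h :: real assumes "0 < h"
  shows "1 + \<bar>of_int q\<bar> \<le> 4 * (1 + 1 / h) * cosh (of_int q * h)"
proof -
  define y where "y = \<bar>of_int q\<bar> * h"
  have "0 \<le> y" using assms by (simp add: y_def)
  have "(1 + y) * 1 \<le> 2 * (1 + y\<^sup>2)"
  proof -
    have "0 \<le> 2 * (y - 1 / 4)\<^sup>2 + 7 / 8" by simp
    thus ?thesis by (simp add: power2_eq_square algebra_simps)
  qed
  also have "2 * (1 + y\<^sup>2) \<le> 2 * (2 * cosh y)"
    by (intro mult_left_mono one_plus_square_le_cosh) simp
  finally have "1 + y \<le> 4 * cosh y" by simp
  moreover have "y = \<bar>of_int q * h\<bar>"
    using assms by (simp add: y_def abs_mult)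
  hence "cosh y = cosh (of_int q * h)"
    by (simp only: cosh_real_abs)
  ultimately have *: "1 + y \<le> 4 * cosh (of_int q * h)" by simp
  have "1 + \<bar>of_int q\<bar> \<le> (1 + 1 / h) * (1 + y)"
    using assms by (simp add: y_def field_simps)
  also have "\<dots> \<le> (1 + 1 / h) * (4 * cosh (of_int q * h))"
    using assms * by (intro mult_left_mono) auto
  finally show ?thesis by (simp only: mult_ac)
qed

context sinc_strip
begin

text \<open>The first moment of the samples is bounded uniformly in M. Its growth for small h is
  harmless, because it serves only in a limit at fixed h.\<close>

lemma weighted_sample_sum_le:
  "(\<Sum>q = - int M..int M. norm (F (of_real (of_int q * h))) * (1 + \<bar>of_int q\<bar>)) \<le> 4 * (1 + 1 / h) * B * (1 + 2 * pi / h)"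
proof -
  have "(\<Sum>q = - int M..int M. norm (F (of_real (of_int q * h))) * (1 + \<bar>of_int q\<bar>))
      \<le> (\<Sum>q = - int M..int M. 4 * (1 + 1 / h) * B * (1 / cosh (of_int q * h)))"
  proof (rule sum_mono)
    fix q :: int
    have "norm (F (of_real (of_int q * h))) * (1 + \<bar>of_int q\<bar>)
        \<le> (B / (cosh (of_int q * h))\<^sup>2) * (4 * (1 + 1 / h) * cosh (of_int q * h))"
      using decay[OF grid_point_in_strip[of "of_int q * h"]] one_plus_abs_int_le_cosh[OF h_pos, of q] B_nonneg
      by (intro mult_mono) auto
    thus "norm (F (of_real (of_int q * h))) * (1 + \<bar>of_int q\<bar>) \<le> 4 * (1 + 1 / h) * B * (1 / cosh (of_int q * h))"
      by (simp add: power2_eq_square mult_ac)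
  qed
  also have "\<dots> = 4 * (1 + 1 / h) * B * (\<Sum>q = - int M..int M. 1 / cosh (of_int q * h))"
    by (simp only: sum_distrib_left)
  also have "\<dots> \<le> 4 * (1 + 1 / h) * B * (1 + 2 * pi / h)"
    using sum_inverse_cosh_le[OF h_pos, of M] h_pos B_nonneg
    by (intro mult_left_mono) (auto simp: field_simps)
  finally show ?thesis .
qed

text \<open>If -L - q > 0 then |q| exceeds L and the right side is at least 2. Otherwise sigma is
  compared with the value 0 of the step, and 1 + L \<le> (1 + k)(1 + |q|) for the distance k = |L +
  q|.\<close>

lemma abs_sigma_shift_le:
  "\<bar>sigma (- int L - q)\<bar> \<le> 2 * (1 + \<bar>of_int q\<bar>) / (1 + real L)"
proof (cases "- int L - q > 0")
  case True
  hence "2 * 1 \<le> 2 * ((1 + \<bar>of_int q\<bar>) / (1 + real L))"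
    by (intro mult_left_mono) (auto simp: field_simps)
  thus ?thesis using abs_sigma_le[of "- int L - q"] by simp
next
  case False
  define k where "k = \<bar>of_int (- int L - q) :: real\<bar>"
  have k0: "0 \<le> k" by (simp add: k_def)
  have "real L \<le> k + \<bar>of_int q\<bar>" unfolding k_def by linarith
  moreover have "0 \<le> k * \<bar>of_int q\<bar>" using k0 by simp
  ultimately have "1 + real L \<le> (1 + k) * (1 + \<bar>of_int q\<bar>)" by (simp add: algebra_simps)
  also have "\<dots> \<le> (1 + k) * (2 * (1 + \<bar>of_int q\<bar>))" by (intro mult_left_mono) (use k0 in auto)
  finally have "(1 + real L) / (1 + k) \<le> 2 * (1 + \<bar>of_int q\<bar>)"
    using k0 by (simp add: pos_divide_le_eq mult.commute)
  hence "(1 + real L) / (1 + k) / (1 + real L) \<le> 2 * (1 + \<bar>of_int q\<bar>) / (1 + real L)"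
    by (intro divide_right_mono) auto
  hence "1 / (1 + k) \<le> 2 * (1 + \<bar>of_int q\<bar>) / (1 + real L)"
    by simp
  moreover have "\<bar>sigma (- int L - q)\<bar> \<le> 1 / (1 + k)"
    using sigma_close_to_step[of "- int L - q"] False by (simp add: k_def)
  ultimately show ?thesis by linarith
qed

text \<open>Far to the left all weights belonging to moderate q are close to 0. The shift bound
  turns the sum into the first moment of the samples divided by 1 + L.\<close>

lemma indef_error_start_tendsto:
  assumes "(u \<longlongrightarrow> r) at_bot"
  shows "(\<lambda>L. norm (indef_error u r (2 * L) (of_int (- int L) * h))) \<longlonglongrightarrow> 0"
proof -
  define S where "S = 4 * (1 + 1 / h) * B * (1 + 2 * pi / h)"
  have lim_bot: "filterlim (\<lambda>L. of_int (- int L) * h) at_bot sequentially"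
    using filterlim_uminus_at_top[THEN iffD1, OF filterlim_tendsto_pos_mult_at_top[OF tendsto_const h_pos filterlim_real_sequentially]]
    by (simp add: mult.commute)
  have "(\<lambda>L. 1 / (1 + real L)) \<longlonglongrightarrow> 0"
    using LIMSEQ_inverse_real_of_nat by (simp add: inverse_eq_divide add_ac)
  from tendsto_add[OF tendsto_norm[OF LIM_zero[OF filterlim_compose[OF assms lim_bot]]]
      tendsto_mult_left[OF this, of "h * 2 * S"]]
  have upper: "(\<lambda>L. norm (u (of_int (- int L) * h) - r) + h * 2 * S * (1 / (1 + real L))) \<longlonglongrightarrow> 0" by simp
  have le: "\<forall>\<^sub>F L in sequentially. norm (indef_error u r (2 * L) (of_int (- int L) * h))
      \<le> norm (u (of_int (- int L) * h) - r) + h * 2 * S * (1 / (1 + real L))"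
  proof (rule always_eventually, rule allI)
    fix L
    have "norm (\<Sum>q = - int (2 * L)..int (2 * L). F (of_real (of_int q * h)) * of_real (sigma (- int L - q)))
        \<le> (\<Sum>q = - int (2 * L)..int (2 * L). norm (F (of_real (of_int q * h))) * (2 * (1 + \<bar>of_int q\<bar>) / (1 + real L)))"
      by (rule sum_norm_le) (auto simp only: norm_mult norm_of_real intro!: mult_left_mono abs_sigma_shift_le norm_ge_zero)
    also have "\<dots> = 2 / (1 + real L) * (\<Sum>q = - int (2 * L)..int (2 * L). norm (F (of_real (of_int q * h))) * (1 + \<bar>of_int q\<bar>))"
      unfolding sum_distrib_left by (intro sum.cong refl) (simp only: mult_ac times_divide_eq_right times_divide_eq_left)
    also have "\<dots> \<le> 2 / (1 + real L) * S"
      unfolding S_def by (intro mult_left_mono weighted_sample_sum_le) auto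
    finally have "norm (of_real h * (\<Sum>q = - int (2 * L)..int (2 * L). F (of_real (of_int q * h)) * of_real (sigma (- int L - q))))
        \<le> h * (2 / (1 + real L) * S)"
      unfolding norm_mult norm_of_real using h_pos by (intro mult_mono) auto
    thus "norm (indef_error u r (2 * L) (of_int (- int L) * h))
      \<le> norm (u (of_int (- int L) * h) - r) + h * 2 * S * (1 / (1 + real L))"
      unfolding indef_error_grid by - (rule order_trans[OF norm_triangle_ineq4], simp add: mult_ac)
  qed
  show ?thesis
    by (rule tendsto_sandwich[OF _ le tendsto_const upper]) simp
qed

text \<open>\<open>T\<close> is a separate, much smaller amplitude for the samples beyond N. Keeping
  1/cosh^2 next to it makes the tail summable with a bound free of M.\<close>

lemma sample_tail_le:
  assumes tail: "\<And>q::int. int N < \<bar>q\<bar> \<Longrightarrow> norm (F (of_real (of_int q * h))) \<le> T / (cosh (of_int q * h))\<^sup>2"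
  shows "(\<Sum>q\<in>{- int M..int M} - {- int N..int N}. norm (F (of_real (of_int q * h)))) \<le> T * (1 + 2 / h)"
proof -
  have "norm (F (of_real (of_int (int N + 1) * h))) \<le> T / (cosh (of_int (int N + 1) * h))\<^sup>2"
    by (rule tail) simp
  hence "0 \<le> T / (cosh (of_int (int N + 1) * h))\<^sup>2"
    by (rule order_trans[OF norm_ge_zero])
  hence T: "0 \<le> T" by (simp add: zero_le_divide_iff)
  have "(\<Sum>q\<in>{- int M..int M} - {- int N..int N}. norm (F (of_real (of_int q * h))))
      \<le> (\<Sum>q\<in>{- int M..int M} - {- int N..int N}. T / (cosh (of_int q * h))\<^sup>2)"
    by (intro sum_mono tail) auto
  also have "\<dots> \<le> (\<Sum>q = - int M..int M. T / (cosh (of_int q * h))\<^sup>2)"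
    using T by (intro sum_mono2) auto
  also have "\<dots> = T * (\<Sum>q = - int M..int M. 1 / (cosh (of_int q * h))\<^sup>2)"
    by (simp add: sum_distrib_left)
  also have "\<dots> \<le> T * (1 + 2 / h)"
    using sum_inverse_cosh_square_le[OF h_pos, of M] h_pos T
    by (intro mult_left_mono) (auto simp: field_simps)
  finally show ?thesis .
qed

text \<open>The window |q| \<le> 2L of the contour estimate is split at N, and |sinc| \<le> 1 leaves
  the sample tail. As the left side is free of L, the contribution d B/(L h) of the vertical sides
  disappears in the limit.\<close>

lemma sinc_interpolation_error:
  assumes tail: "\<And>q::int. int N < \<bar>q\<bar> \<Longrightarrow> norm (F (of_real (of_int q * h))) \<le> T / (cosh (of_int q * h))\<^sup>2"
  shows "norm (F (of_real x) - (\<Sum>q = - int N..int N. F (of_real (of_int q * h)) * of_real (sinc_basis q h x)))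
           \<le> 32 * B / d * exp (- pi * d / h) + T * (1 + 2 / h)"
proof (rule tendsto_lowerbound)
  let ?f = "\<lambda>q. F (of_real (of_int q * h)) * of_real (sinc_basis q h x)"
  have "(\<lambda>L. d * B / h * (1 / real L)) \<longlonglongrightarrow> d * B / h * 0"
    by (intro tendsto_mult_left lim_1_over_n)
  from tendsto_add[OF tendsto_const[of "32 * B / d * exp (- pi * d / h) + T * (1 + 2 / h)"] this]
  show "(\<lambda>L. 32 * B / d * exp (- pi * d / h) + T * (1 + 2 / h) + d * B / h * (1 / real L))
      \<longlonglongrightarrow> 32 * B / d * exp (- pi * d / h) + T * (1 + 2 / h)" by simp
  show "\<forall>\<^sub>F L in sequentially. norm (F (of_real x) - (\<Sum>q = - int N..int N. ?f q))
      \<le> 32 * B / d * exp (- pi * d / h) + T * (1 + 2 / h) + d * B / h * (1 / real L)"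
  proof (rule eventually_sequentiallyI)
    fix L assume L: "nat \<lceil>\<bar>x\<bar> / h\<rceil> + N + 1 \<le> L"
    hence "\<bar>x\<bar> / h \<le> real L" by linarith
    hence x: "\<bar>x\<bar> \<le> real L * h" using h_pos by (simp add: field_simps)
    have "(\<Sum>q = - int (2 * L)..int (2 * L). ?f q) =
        (\<Sum>q\<in>{- int (2 * L)..int (2 * L)} - {- int N..int N}. ?f q) + (\<Sum>q = - int N..int N. ?f q)"
      using L by (intro sum.subset_diff) auto
    hence "F (of_real x) - (\<Sum>q = - int N..int N. ?f q) =
        (F (of_real x) - (\<Sum>q = - int (2 * L)..int (2 * L). ?f q))
        + (\<Sum>q\<in>{- int (2 * L)..int (2 * L)} - {- int N..int N}. ?f q)" by simp
    also have "norm \<dots> \<le> (32 * B / d * exp (- pi * d / h) + d * B / (real L * h)) + T * (1 + 2 / h)"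
    proof (rule norm_triangle_mono)
      show "norm (F (of_real x) - (\<Sum>q = - int (2 * L)..int (2 * L). ?f q))
          \<le> 32 * B / d * exp (- pi * d / h) + d * B / (real L * h)"
        using L x by (intro sinc_interpolation_wide) auto
      have "norm (\<Sum>q\<in>{- int (2 * L)..int (2 * L)} - {- int N..int N}. ?f q)
          \<le> (\<Sum>q\<in>{- int (2 * L)..int (2 * L)} - {- int N..int N}. norm (F (of_real (of_int q * h))) * 1)"
        by (rule sum_norm_le) (auto simp only: norm_mult norm_of_real intro!: mult_left_mono abs_sinc_basis_le_1 norm_ge_zero)
      also have "\<dots> \<le> T * (1 + 2 / h)" using sample_tail_le[of N T "2 * L", OF tail] by simp
      finally show "norm (\<Sum>q\<in>{- int (2 * L)..int (2 * L)} - {- int N..int N}. ?f q) \<le> T * (1 + 2 / h)" .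
    qed
    finally show "norm (F (of_real x) - (\<Sum>q = - int N..int N. ?f q))
      \<le> 32 * B / d * exp (- pi * d / h) + T * (1 + 2 / h) + d * B / h * (1 / real L)"
      by (simp add: mult_ac)
  qed
qed simp

text \<open>The same splitting, with |sigma| \<le> 2 for the tail; the start error and the vertical
  sides vanish with growing L. Compared with interpolation, the contour term has gained the factor
  h.\<close>

lemma indefinite_integration_error:
  assumes u: "\<And>x. (u has_vector_derivative F (of_real x)) (at x)" and lim: "(u \<longlongrightarrow> r) at_bot"
    and tail: "\<And>q::int. int N < \<bar>q\<bar> \<Longrightarrow> norm (F (of_real (of_int q * h))) \<le> T / (cosh (of_int q * h))\<^sup>2"
  shows "norm (u (of_int p * h) - r -
      of_real h * (\<Sum>q = - int N..int N. F (of_real (of_int q * h)) * of_real (sigma (p - q))))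
     \<le> 64 * (1 / d + 1 + 1 / d\<^sup>2) * B * h * exp (- pi * d / h) + 2 * T * (h + 2)"
proof (rule tendsto_lowerbound)
  define K where "K = 64 * (1 / d + 1 + 1 / d\<^sup>2) * B * h * exp (- pi * d / h)"
  define start where "start = (\<lambda>L. norm (indef_error u r (2 * L) (of_int (- int L) * h)))"
  let ?f = "\<lambda>q. F (of_real (of_int q * h)) * of_real (sigma (p - q))"
  have "(\<lambda>L. start L + 4 * d * B * (1 / real L)) \<longlonglongrightarrow> 0 + 4 * d * B * 0"
    unfolding start_def by (intro tendsto_add indef_error_start_tendsto lim tendsto_mult_left lim_1_over_n)
  from tendsto_add[OF tendsto_const[of "K + 2 * T * (h + 2)"] this]
  show "(\<lambda>L. K + 2 * T * (h + 2) + (start L + 4 * d * B * (1 / real L)))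
      \<longlonglongrightarrow> 64 * (1 / d + 1 + 1 / d\<^sup>2) * B * h * exp (- pi * d / h) + 2 * T * (h + 2)"
    by (simp add: K_def)
  show "\<forall>\<^sub>F L in sequentially. norm (u (of_int p * h) - r - of_real h * (\<Sum>q = - int N..int N. ?f q))
      \<le> K + 2 * T * (h + 2) + (start L + 4 * d * B * (1 / real L))"
  proof (rule eventually_sequentiallyI)
    fix L assume L: "nat \<bar>p\<bar> + N + 1 \<le> L"
    have split: "(\<Sum>q = - int (2 * L)..int (2 * L). ?f q) =
        (\<Sum>q\<in>{- int (2 * L)..int (2 * L)} - {- int N..int N}. ?f q) + (\<Sum>q = - int N..int N. ?f q)"
      using L by (intro sum.subset_diff) auto
    have "u (of_int p * h) - r - of_real h * (\<Sum>q = - int N..int N. ?f q) =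
        indef_error u r (2 * L) (of_int p * h)
        + of_real h * (\<Sum>q\<in>{- int (2 * L)..int (2 * L)} - {- int N..int N}. ?f q)"
      unfolding indef_error_grid split by (simp add: distrib_left)
    also have "norm \<dots> \<le> (K + (start L + 4 * d * B / real L)) + 2 * T * (h + 2)"
    proof (rule norm_triangle_mono)
      show "norm (indef_error u r (2 * L) (of_int p * h)) \<le> K + (start L + 4 * d * B / real L)"
        unfolding K_def start_def using L by (intro indef_error_wide u) auto
      have "norm (\<Sum>q\<in>{- int (2 * L)..int (2 * L)} - {- int N..int N}. ?f q)
          \<le> (\<Sum>q\<in>{- int (2 * L)..int (2 * L)} - {- int N..int N}. norm (F (of_real (of_int q * h))) * 2)"
        by (rule sum_norm_le) (auto simp only: norm_mult norm_of_real intro!: mult_left_mono abs_sigma_le norm_ge_zero)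
      also have "\<dots> = 2 * (\<Sum>q\<in>{- int (2 * L)..int (2 * L)} - {- int N..int N}. norm (F (of_real (of_int q * h))))"
        by (simp only: sum_distrib_left mult.commute)
      also have "\<dots> \<le> 2 * (T * (1 + 2 / h))" using sample_tail_le[of N T "2 * L", OF tail] by simp
      finally have "norm (of_real h * (\<Sum>q\<in>{- int (2 * L)..int (2 * L)} - {- int N..int N}. ?f q)) \<le> h * (2 * (T * (1 + 2 / h)))"
        unfolding norm_mult norm_of_real using h_pos by (simp add: mult_left_mono)
      also have "\<dots> = 2 * T * (h + 2)" using h_pos by (simp add: field_simps)
      finally show "norm (of_real h * (\<Sum>q\<in>{- int (2 * L)..int (2 * L)} - {- int N..int N}. ?f q)) \<le> 2 * T * (h + 2)" .
    qed
    finally show "norm (u (of_int p * h) - r - of_real h * (\<Sum>q = - int N..int N. ?f q))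
      \<le> K + 2 * T * (h + 2) + (start L + 4 * d * B * (1 / real L))"
      by simp
  qed
qed simp

end

section \<open>Linear differential equations on a strip\<close>

lemma strip_increment_bound:
  fixes w W :: "real \<Rightarrow> real"
  assumes P: "\<And>z. z \<in> strip d \<Longrightarrow> (P has_field_derivative H z) (at z)"
    and W: "\<And>x. (W has_real_derivative w x) (at x)"
    and bound: "\<And>x. x1 < x \<Longrightarrow> x < x2 \<Longrightarrow> norm (H (Complex x y)) \<le> w x"
    and "x1 \<le> x2" "\<bar>y\<bar> < d"
  shows "norm (P (Complex x2 y) - P (Complex x1 y)) \<le> W x2 - W x1"
proof (cases "x1 = x2")
  case False
  have deriv: "((\<lambda>x. P (Complex x y)) has_vector_derivative H (Complex x y)) (at x)" for x
  proof -
    have "((\<lambda>x. Complex x y) has_vector_derivative 1) (at x)"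
      unfolding Complex_eq by (auto intro!: derivative_eq_intros)
    from field_vector_diff_chain_at[OF this P, unfolded o_def] show ?thesis
      using assms(5) by (simp add: Complex_in_strip_iff)
  qed
  show ?thesis
  proof (rule differentiable_bound_general[where f = "\<lambda>x. P (Complex x y)"])
    show "x1 < x2" using False assms(4) by simp
    show "continuous_on {x1..x2} (\<lambda>x. P (Complex x y))" "continuous_on {x1..x2} W"
      by (intro continuous_at_imp_continuous_on ballI has_vector_derivative_continuous[OF deriv] DERIV_isCont[OF W])+
    show "(W has_vector_derivative w x) (at x)" for x
      using W by (simp add: has_real_derivative_iff_has_vector_derivative)
  qed (use deriv bound in auto)
qed simp

lemma vertical_increment_bound:
  assumes P: "\<And>z. z \<in> strip d \<Longrightarrow> (P has_field_derivative H z) (at z)"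
    and bound: "\<And>e. \<bar>e\<bar> < d \<Longrightarrow> norm (H (Complex x e)) \<le> c"
    and y: "\<bar>y\<bar> < d"
  shows "norm (P (Complex x y) - P (of_real x)) \<le> c * \<bar>y\<bar>"
proof -
  have 0: "0 < d" using y by simp
  have "norm (P (Complex x y) - P (of_real x)) \<le> c * norm (Complex x y - of_real x)"
  proof (rule field_differentiable_bound[where S = "strip d \<inter> {z. Re z = x}" and f' = H])
    have "{z. Re z = x} = {z. Re z \<le> x} \<inter> {z. Re z \<ge> x}" by auto
    thus "convex (strip d \<inter> {z. Re z = x})"
      by (simp add: convex_Int convex_strip convex_halfspace_Re_le convex_halfspace_Re_ge)
    fix z assume z: "z \<in> strip d \<inter> {z. Re z = x}"
    show "(P has_field_derivative H z) (at z within strip d \<inter> {z. Re z = x})"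
      by (rule has_field_derivative_at_within[OF P]) (use z in auto)
    show "norm (H z) \<le> c" using z bound[of "Im z"] by (auto simp: strip_def)
  qed (use y 0 in \<open>auto simp: strip_def\<close>)
  also have "norm (Complex x y - of_real x) = \<bar>y\<bar>"
    by (simp add: cmod_def)
  finally show ?thesis .
qed

text \<open>The limit is known along the real axis only. The point z is joined to it by a vertical
  segment far to the left, which costs at most w(x) |Im z| and vanishes in the limit, followed by a
  horizontal line. Requiring the bound only for Re z \<le> t permits majorants that depend on the
  end point.\<close>

lemma strip_primitive_bound:
  fixes w W :: "real \<Rightarrow> real"
  assumes P: "\<And>z. z \<in> strip d \<Longrightarrow> (P has_field_derivative H z) (at z)"
    and lim: "((\<lambda>x. P (of_real x)) \<longlongrightarrow> l) at_bot"
    and W: "\<And>x. (W has_real_derivative w x) (at x)" and W0: "(W \<longlongrightarrow> 0) at_bot" and w0: "(w \<longlongrightarrow> 0) at_bot"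
    and bound: "\<And>z. z \<in> strip d \<Longrightarrow> Re z \<le> t \<Longrightarrow> norm (H z) \<le> w (Re z)"
    and z: "z \<in> strip d" "Re z \<le> t"
  shows "norm (P z - l) \<le> W (Re z)"
proof (rule tendsto_lowerbound)
  define y where "y = Im z"
  have y: "\<bar>y\<bar> < d" using z by (simp add: y_def strip_def)
  have bound': "norm (H (Complex x e)) \<le> w x" if "x \<le> t" "\<bar>e\<bar> < d" for x e
    using bound[of "Complex x e"] that by (simp add: Complex_in_strip_iff)
  have "((\<lambda>x. W (Re z) - W x + w x * \<bar>y\<bar> + norm (P (of_real x) - l)) \<longlongrightarrow> W (Re z) - 0 + 0 * \<bar>y\<bar> + norm (l - l)) at_bot"
    by (intro tendsto_intros W0 w0 lim)
  thus "((\<lambda>x. W (Re z) - W x + w x * \<bar>y\<bar> + norm (P (of_real x) - l)) \<longlongrightarrow> W (Re z)) at_bot" by simp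
  show "\<forall>\<^sub>F x in at_bot. norm (P z - l) \<le> W (Re z) - W x + w x * \<bar>y\<bar> + norm (P (of_real x) - l)"
  proof (rule eventually_at_bot_linorderI)
    fix x assume x: "x \<le> Re z"
    have "norm (P (Complex (Re z) y) - P (Complex x y)) \<le> W (Re z) - W x"
      by (rule strip_increment_bound[OF P W _ x y]) (use bound' y z in auto)
    moreover have "norm (P (Complex x y) - P (of_real x)) \<le> w x * \<bar>y\<bar>"
      by (rule vertical_increment_bound[OF P _ y]) (use bound' x z in auto)
    moreover have "P z - l = (P (Complex (Re z) y) - P (Complex x y)) + (P (Complex x y) - P (of_real x)) + (P (of_real x) - l)"
      by (simp add: y_def)
    ultimately show "norm (P z - l) \<le> W (Re z) - W x + w x * \<bar>y\<bar> + norm (P (of_real x) - l)"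
      by (smt (verit) norm_triangle_ineq)
  qed
qed simp

lemma tendsto_tanh_at_bot: "((\<lambda>x::real. 1 + tanh x) \<longlongrightarrow> 0) at_bot"
  using tendsto_add[OF tendsto_const[of "1::real"] tanh_real_at_bot] by simp

lemma tendsto_inverse_cosh_square_at_bot: "((\<lambda>x::real. 1 / (cosh x)\<^sup>2) \<longlongrightarrow> 0) at_bot"
proof -
  have "((\<lambda>x::real. 1 - (tanh x)\<^sup>2) \<longlongrightarrow> 1 - (- 1)\<^sup>2) at_bot"
    by (intro tendsto_intros tanh_real_at_bot)
  thus ?thesis by (simp add: inverse_cosh_square)
qed

lemma has_real_derivative_scaled_tanh:
  "((\<lambda>x. K * (1 + tanh x)) has_real_derivative K / (cosh x)\<^sup>2) (at x)" for x :: real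
  using DERIV_cmult[OF DERIV_add[OF DERIV_const has_real_derivative_tanh], of K] by simp

text \<open>Some primitive exists by convexity. Its increments along the real axis are dominated by
  those of K (1 + tanh x), which tends to 0, so Cauchy's criterion supplies the limit at minus
  infinity, and this limit is subtracted.\<close>

lemma strip_primitive_exists:
  assumes d: "0 < d" and holo: "H holomorphic_on strip d"
    and bound: "\<And>z. z \<in> strip d \<Longrightarrow> norm (H z) \<le> K / (cosh (Re z))\<^sup>2"
  shows "\<exists>P. (\<forall>z\<in>strip d. (P has_field_derivative H z) (at z)) \<and> ((\<lambda>x. P (of_real x)) \<longlongrightarrow> 0) at_bot"
proof -
  obtain P where "\<And>z. z \<in> strip d \<Longrightarrow> (P has_field_derivative H z) (at z within strip d)"
    using holomorphic_convex_primitive'[OF convex_strip open_strip holo] by blast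
  hence P: "\<And>z. z \<in> strip d \<Longrightarrow> (P has_field_derivative H z) (at z)"
    by (simp add: at_within_open[OF _ open_strip])
  have bound': "norm (H (Complex x 0)) \<le> K / (cosh x)\<^sup>2" for x
    using bound[of "Complex x 0"] d by (simp add: Complex_in_strip_iff)
  have incr: "norm (P (of_real x2) - P (of_real x1)) \<le> K * (1 + tanh x2) - K * (1 + tanh x1)" if "x1 \<le> x2" for x1 x2
  proof -
    have "norm (P (Complex x2 0) - P (Complex x1 0)) \<le> K * (1 + tanh x2) - K * (1 + tanh x1)"
      by (rule strip_increment_bound[OF P has_real_derivative_scaled_tanh _ that]) (use bound' d in auto)
    thus ?thesis by (simp add: complex_of_real_def)
  qed
  have K: "0 \<le> K" using bound[of 0] d norm_ge_zero[of "H 0"] by (simp add: strip_def del: norm_ge_zero)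
  have W0: "((\<lambda>x. K * (1 + tanh x)) \<longlongrightarrow> K * 0) at_bot"
    by (intro tendsto_mult_left tendsto_tanh_at_bot)
  have "\<exists>l. ((\<lambda>x. P (of_real x)) \<longlongrightarrow> l) at_bot"
  proof -
    have "cauchy_filter (filtermap (\<lambda>x. P (of_real x)) at_bot)"
      unfolding cauchy_filter_metric_filtermap
    proof (intro allI impI)
      fix e :: real assume e: "0 < e"
      have ev: "\<forall>\<^sub>F x in at_bot. K * (1 + tanh x) < e"
        using W0 e by (intro order_tendstoD) auto
      show "\<exists>Pa. eventually Pa at_bot \<and> (\<forall>x y. Pa x \<and> Pa y \<longrightarrow> dist (P (of_real x)) (P (of_real y)) < e)"
      proof (intro exI conjI allI impI)
        show "\<forall>\<^sub>F x in at_bot. K * (1 + tanh x) < e" by (rule ev)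
        fix x y assume xy: "K * (1 + tanh x) < e \<and> K * (1 + tanh y) < e"
        have nonneg: "0 \<le> K * (1 + tanh t)" for t
          using K tanh_real_gt_neg1[of t] by (intro mult_nonneg_nonneg) auto
        show "dist (P (of_real x)) (P (of_real y)) < e"
          using incr[of x y] incr[of y x] xy nonneg[of x] nonneg[of y]
          by (cases "x \<le> y") (auto simp: dist_norm norm_minus_commute)
      qed
    qed
    moreover have "filtermap (\<lambda>x. P (of_real x)) at_bot \<noteq> bot"
      by (simp add: filtermap_bot_iff trivial_limit_at_bot_linorder)
    ultimately obtain l where "filtermap (\<lambda>x. P (of_real x)) at_bot \<le> nhds l"
      using complete_uniform[THEN iffD1, OF complete_UNIV, rule_format, of "filtermap (\<lambda>x. P (of_real x)) at_bot"]
      by auto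
    thus ?thesis by (auto simp: filterlim_def)
  qed
  then obtain l where "((\<lambda>x. P (of_real x)) \<longlongrightarrow> l) at_bot" by blast
  hence "((\<lambda>x. P (of_real x) - l) \<longlongrightarrow> 0) at_bot" by (rule LIM_zero)
  thus ?thesis using P by (intro exI[of _ "\<lambda>z. P z - l"]) (auto intro!: derivative_eq_intros)
qed

section \<open>Picard iteration from minus infinity\<close>

lemma one_plus_tanh_nonneg: "0 \<le> 1 + tanh x" and one_plus_tanh_le_2: "1 + tanh x \<le> 2" for x :: real
  using tanh_real_gt_neg1[of x] tanh_real_lt_1[of x] by auto

text \<open>With 1 + tanh x as the time variable, whose differential is dx/cosh^2 x, the equation
  lives on an interval of length 2, and the Picard estimates have the familiar form power over
  factorial.\<close>

lemma has_real_derivative_tanh_power: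
  "((\<lambda>x. c * (1 + tanh x) ^ Suc m / fact (Suc m)) has_real_derivative
     (c * (1 + tanh x) ^ m / fact m) / (cosh x)\<^sup>2) (at x)" for x c :: real
proof -
  have "((\<lambda>x. c * (1 + tanh x) ^ Suc m / fact (Suc m)) has_real_derivative
      c * (of_nat (Suc m) * (1 + tanh x) ^ m * (0 + 1 / (cosh x)\<^sup>2)) / fact (Suc m)) (at x)"
    using DERIV_cdivide[OF DERIV_cmult[OF DERIV_power[OF DERIV_add[OF DERIV_const has_real_derivative_tanh], where n = "Suc m"], of c], of 1 "fact (Suc m)" x]
    by (simp add: mult_ac)
  also have "c * (of_nat (Suc m) * (1 + tanh x) ^ m * (0 + 1 / (cosh x)\<^sup>2)) / fact (Suc m)
      = (c * (1 + tanh x) ^ m / fact m) / (cosh x)\<^sup>2"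
    by (simp add: fact_Suc divide_simps del: of_nat_Suc)
  finally show ?thesis .
qed

locale strip_ode =
  fixes d M :: real and n :: nat and A :: "nat \<Rightarrow> nat \<Rightarrow> complex \<Rightarrow> complex"
    and G :: "nat \<Rightarrow> complex \<Rightarrow> complex" and r :: "nat \<Rightarrow> complex"
  assumes d_pos: "0 < d"
    and A_holo: "\<And>i j. i < n \<Longrightarrow> j < n \<Longrightarrow> A i j holomorphic_on strip d"
    and G_holo: "\<And>i. i < n \<Longrightarrow> G i holomorphic_on strip d"
    and A_bound: "\<And>i j z. i < n \<Longrightarrow> j < n \<Longrightarrow> z \<in> strip d \<Longrightarrow> norm (A i j z) \<le> M / (cosh (Re z))\<^sup>2"
    and G_bound: "\<And>i z. i < n \<Longrightarrow> z \<in> strip d \<Longrightarrow> norm (G i z) \<le> M / (cosh (Re z))\<^sup>2"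
    and M_nonneg: "0 \<le> M"
begin

definition prim :: "(complex \<Rightarrow> complex) \<Rightarrow> complex \<Rightarrow> complex" where
  "prim H = (SOME P. (\<forall>z\<in>strip d. (P has_field_derivative H z) (at z)) \<and> ((\<lambda>x. P (of_real x)) \<longlongrightarrow> 0) at_bot)"

primrec picard :: "nat \<Rightarrow> nat \<Rightarrow> complex \<Rightarrow> complex" where
  "picard 0 i z = r i"
| "picard (Suc m) i z = r i + prim (\<lambda>\<zeta>. G i \<zeta> + (\<Sum>j<n. A i j \<zeta> * picard m j \<zeta>)) z"

definition rhs :: "nat \<Rightarrow> nat \<Rightarrow> complex \<Rightarrow> complex" where
  "rhs m i z = G i z + (\<Sum>j<n. A i j z * picard m j z)"

definition r_max :: real where
  "r_max = (\<Sum>i<n. norm (r i))"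

text \<open>The amplitude of the right-hand side when the constant initial vector is
  inserted.\<close>

definition c0 :: real where
  "c0 = M * (1 + real n * r_max)"

text \<open>The Picard estimate with 1 + tanh x replaced by its upper bound 2, hence a majorant
  independent of the point; its sum is of exponential series type.\<close>

definition increment :: "nat \<Rightarrow> real" where
  "increment m = c0 * (real n * M) ^ m * 2 ^ Suc m / fact (Suc m)"

lemma r_le: "i < n \<Longrightarrow> norm (r i) \<le> r_max"
  unfolding r_max_def by (rule member_le_sum) auto

lemma r_max_nonneg: "0 \<le> r_max"
  unfolding r_max_def by (intro sum_nonneg) auto

lemma c0_nonneg: "0 \<le> c0"
  using M_nonneg r_max_nonneg by (simp add: c0_def)

lemma rhs_bound:
  assumes "i < n" "z \<in> strip d" "\<And>j. j < n \<Longrightarrow> norm (v j) \<le> U" "0 \<le> U"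
  shows "norm (G i z + (\<Sum>j<n. A i j z * v j)) \<le> M * (1 + real n * U) / (cosh (Re z))\<^sup>2"
proof -
  have "norm (\<Sum>j<n. A i j z * v j) \<le> (\<Sum>j<n. M / (cosh (Re z))\<^sup>2 * U)"
    by (intro sum_norm_le, unfold norm_mult, intro mult_mono) (use assms A_bound M_nonneg in auto)
  hence "norm (G i z + (\<Sum>j<n. A i j z * v j)) \<le> M / (cosh (Re z))\<^sup>2 + (\<Sum>j<n. M / (cosh (Re z))\<^sup>2 * U)"
    by (intro norm_triangle_mono G_bound assms)
  also have "\<dots> = M * (1 + real n * U) / (cosh (Re z))\<^sup>2"
    by (simp add: add_divide_distrib algebra_simps)
  finally show ?thesis .
qed

lemma prim_props:
  assumes "H holomorphic_on strip d" "\<And>z. z \<in> strip d \<Longrightarrow> norm (H z) \<le> K / (cosh (Re z))\<^sup>2"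
  shows "z \<in> strip d \<Longrightarrow> (prim H has_field_derivative H z) (at z)"
    and "((\<lambda>x. prim H (of_real x)) \<longlongrightarrow> 0) at_bot"
  using someI_ex[OF strip_primitive_exists[OF d_pos assms]] unfolding prim_def by blast+

lemma picard_step:
  assumes "\<And>i. i < n \<Longrightarrow> picard m i holomorphic_on strip d"
    and "\<And>i z. i < n \<Longrightarrow> z \<in> strip d \<Longrightarrow> norm (picard m i z) \<le> U" "0 \<le> U" and i: "i < n"
  shows "\<And>z. z \<in> strip d \<Longrightarrow> (picard (Suc m) i has_field_derivative rhs m i z) (at z)"
    and "((\<lambda>x. picard (Suc m) i (of_real x)) \<longlongrightarrow> r i) at_bot"
    and "rhs m i holomorphic_on strip d"
    and "\<And>z. z \<in> strip d \<Longrightarrow> norm (rhs m i z) \<le> M * (1 + real n * U) / (cosh (Re z))\<^sup>2"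
proof -
  show holo: "rhs m i holomorphic_on strip d"
    unfolding rhs_def using assms A_holo G_holo by (intro holomorphic_intros) auto
  show bound: "\<And>z. z \<in> strip d \<Longrightarrow> norm (rhs m i z) \<le> M * (1 + real n * U) / (cosh (Re z))\<^sup>2"
    unfolding rhs_def using assms by (intro rhs_bound) auto
  have eq: "picard (Suc m) i = (\<lambda>z. r i + prim (rhs m i) z)"
    by (simp add: fun_eq_iff rhs_def [abs_def])
  show "(picard (Suc m) i has_field_derivative rhs m i z) (at z)" if "z \<in> strip d" for z
    unfolding eq using prim_props(1)[OF holo bound that]
    by (auto intro!: derivative_eq_intros)
  show "((\<lambda>x. picard (Suc m) i (of_real x)) \<longlongrightarrow> r i) at_bot"
    unfolding eq using tendsto_add[OF tendsto_const[of "r i"] prim_props(2)[OF holo bound]] by simp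
qed

text \<open>The next iterate is defined through a primitive whose properties require decay of the
  integrand, hence boundedness of the current iterate. The bound U may depend on m here; a uniform
  one follows later by telescoping.\<close>

lemma picard_regular:
  "\<exists>U\<ge>0. \<forall>i<n. picard m i holomorphic_on strip d \<and> (\<forall>z\<in>strip d. norm (picard m i z) \<le> U)"
proof (induction m)
  case 0
  have "picard 0 i = (\<lambda>_. r i)" for i by (simp add: fun_eq_iff)
  thus ?case using r_le r_max_nonneg by auto
next
  case (Suc m)
  then obtain U where U: "0 \<le> U" "\<And>i. i < n \<Longrightarrow> picard m i holomorphic_on strip d"
    "\<And>i z. i < n \<Longrightarrow> z \<in> strip d \<Longrightarrow> norm (picard m i z) \<le> U" by blast
  define K where "K = M * (1 + real n * U)"
  have K: "0 \<le> K" using M_nonneg U by (simp add: K_def)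
  have "picard (Suc m) i holomorphic_on strip d \<and> (\<forall>z\<in>strip d. norm (picard (Suc m) i z) \<le> K * 2 + r_max)"
    if i: "i < n" for i
  proof (intro conjI ballI)
    note step = picard_step[OF U(2,3,1) i]
    show "picard (Suc m) i holomorphic_on strip d"
      using step(1) by (auto simp: holomorphic_on_open[OF open_strip])
    fix z assume z: "z \<in> strip d"
    have "((\<lambda>x. K * (1 + tanh x)) \<longlongrightarrow> K * 0) at_bot" "((\<lambda>x. K * (1 / (cosh x)\<^sup>2)) \<longlongrightarrow> K * 0) at_bot"
      by (intro tendsto_mult_left tendsto_tanh_at_bot tendsto_inverse_cosh_square_at_bot)+
    hence "norm (picard (Suc m) i z - r i) \<le> K * (1 + tanh (Re z))"
      using step z
      by (intro strip_primitive_bound[OF _ _ has_real_derivative_scaled_tanh, where t = "Re z" and H = "rhs m i" and d = d])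
        (auto simp: K_def simp del: picard.simps)
    also have "\<dots> \<le> K * 2" using K one_plus_tanh_le_2 by (intro mult_left_mono)
    finally show "norm (picard (Suc m) i z) \<le> K * 2 + r_max"
      using norm_triangle_sub[of "picard (Suc m) i z" "r i"] r_le[OF i] by linarith
  qed
  thus ?case using K r_max_nonneg by (intro exI[of _ "K * 2 + r_max"]) (auto simp del: picard.simps)
qed

lemma picard_props:
  assumes "i < n"
  shows "\<And>z. z \<in> strip d \<Longrightarrow> (picard (Suc m) i has_field_derivative rhs m i z) (at z)"
    and "((\<lambda>x. picard m i (of_real x)) \<longlongrightarrow> r i) at_bot"
    and "picard m i holomorphic_on strip d"
proof -
  obtain U where "0 \<le> U" "\<And>i. i < n \<Longrightarrow> picard m i holomorphic_on strip d"
    "\<And>i z. i < n \<Longrightarrow> z \<in> strip d \<Longrightarrow> norm (picard m i z) \<le> U" using picard_regular[of m] by blast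
  thus "\<And>z. z \<in> strip d \<Longrightarrow> (picard (Suc m) i has_field_derivative rhs m i z) (at z)"
    "picard m i holomorphic_on strip d"
    using picard_step(1)[of m U i] assms by blast+
  show "((\<lambda>x. picard m i (of_real x)) \<longlongrightarrow> r i) at_bot"
  proof (cases m)
    case (Suc k)
    obtain U where "0 \<le> U" "\<And>i. i < n \<Longrightarrow> picard k i holomorphic_on strip d"
      "\<And>i z. i < n \<Longrightarrow> z \<in> strip d \<Longrightarrow> norm (picard k i z) \<le> U" using picard_regular[of k] by blast
    thus ?thesis unfolding Suc using picard_step(2)[of k U i] assms by blast
  qed simp
qed

text \<open>Subtracting consecutive right-hand sides cancels \<open>G\<close> and leaves n M/cosh^2
  times the previous increment; integration from minus infinity raises the power of 1 + tanh and the
  factorial by one.\<close>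

lemma picard_increment:
  "i < n \<Longrightarrow> z \<in> strip d \<Longrightarrow> norm (picard (Suc m) i z - picard m i z)
     \<le> c0 * (real n * M) ^ m * (1 + tanh (Re z)) ^ Suc m / fact (Suc m)"
proof (induction m arbitrary: i z)
  case (0 i z)
  have bound: "norm (rhs 0 i z) \<le> c0 / (cosh (Re z))\<^sup>2" if "z \<in> strip d" for z
    unfolding rhs_def c0_def using 0 that r_le r_max_nonneg by (intro rhs_bound) auto
  have "((\<lambda>x. c0 * (1 + tanh x)) \<longlongrightarrow> c0 * 0) at_bot" "((\<lambda>x. c0 * (1 / (cosh x)\<^sup>2)) \<longlongrightarrow> c0 * 0) at_bot"
    by (intro tendsto_mult_left tendsto_tanh_at_bot tendsto_inverse_cosh_square_at_bot)+
  hence "norm (picard (Suc 0) i z - r i) \<le> c0 * (1 + tanh (Re z))"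
    using picard_props[of i] 0 bound
    by (intro strip_primitive_bound[OF _ _ has_real_derivative_scaled_tanh, where t = "Re z" and H = "rhs 0 i" and d = d])
      (auto simp del: picard.simps)
  thus ?case by simp
next
  case (Suc m i z)
  define c where "c = c0 * (real n * M) ^ Suc m"
  have deriv: "((\<lambda>z. picard (Suc (Suc m)) i z - picard (Suc m) i z) has_field_derivative rhs (Suc m) i z - rhs m i z) (at z)"
    if "z \<in> strip d" for z
    using Suc.prems that by (intro DERIV_diff picard_props) auto
  have "((\<lambda>x. picard (Suc (Suc m)) i (of_real x) - picard (Suc m) i (of_real x)) \<longlongrightarrow> r i - r i) at_bot"
    using Suc.prems by (intro tendsto_diff picard_props) auto
  hence lim: "((\<lambda>x. picard (Suc (Suc m)) i (of_real x) - picard (Suc m) i (of_real x)) \<longlongrightarrow> 0) at_bot" by simp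
  have bound: "norm (rhs (Suc m) i z - rhs m i z) \<le> (c * (1 + tanh (Re z)) ^ Suc m / fact (Suc m)) / (cosh (Re z))\<^sup>2"
    if z: "z \<in> strip d" for z
  proof -
    define D where "D = c0 * (real n * M) ^ m * (1 + tanh (Re z)) ^ Suc m / fact (Suc m)"
    have "rhs (Suc m) i z - rhs m i z = (\<Sum>j<n. A i j z * (picard (Suc m) j z - picard m j z))"
      unfolding rhs_def by (simp add: sum_subtractf right_diff_distrib del: picard.simps)
    also have "norm \<dots> \<le> (\<Sum>j<n. M / (cosh (Re z))\<^sup>2 * D)"
      unfolding D_def by (intro sum_norm_le, unfold norm_mult, intro mult_mono Suc.IH)
        (use Suc.prems z A_bound M_nonneg in auto)
    also have "\<dots> = (c * (1 + tanh (Re z)) ^ Suc m / fact (Suc m)) / (cosh (Re z))\<^sup>2"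
      by (simp add: c_def D_def mult_ac)
    finally show ?thesis .
  qed
  have lim_W: "((\<lambda>x. c * (1 + tanh x) ^ Suc (Suc m) / fact (Suc (Suc m))) \<longlongrightarrow> c * 0 ^ Suc (Suc m) / fact (Suc (Suc m))) at_bot"
    by (intro tendsto_intros tendsto_tanh_at_bot) auto
  have "((\<lambda>x. (c * (1 + tanh x) ^ Suc m / fact (Suc m)) * (1 / (cosh x)\<^sup>2)) \<longlongrightarrow> (c * 0 ^ Suc m / fact (Suc m)) * 0) at_bot"
    by (intro tendsto_mult[of _ _ _ "\<lambda>x. 1 / (cosh x)\<^sup>2"] tendsto_inverse_cosh_square_at_bot tendsto_divide tendsto_power tendsto_mult tendsto_const tendsto_tanh_at_bot) auto
  hence lim_w: "((\<lambda>x. (c * (1 + tanh x) ^ Suc m / fact (Suc m)) / (cosh x)\<^sup>2) \<longlongrightarrow> 0) at_bot" by simp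
  have "norm (picard (Suc (Suc m)) i z - picard (Suc m) i z - 0) \<le> c * (1 + tanh (Re z)) ^ Suc (Suc m) / fact (Suc (Suc m))"
    by (rule strip_primitive_bound[OF deriv lim has_real_derivative_tanh_power _ lim_w bound _ order_refl])
      (use lim_W Suc.prems in auto)
  thus ?case unfolding c_def by (simp del: picard.simps)
qed

lemma summable_increment: "summable increment"
proof -
  have "summable (\<lambda>m. 2 * c0 * (inverse (fact m) * (2 * real n * M) ^ m))"
    by (intro summable_mult summable_exp)
  moreover have "norm (increment m) \<le> 2 * c0 * (inverse (fact m) * (2 * real n * M) ^ m)" for m
  proof -
    have "increment m = 2 * c0 * (2 * real n * M) ^ m / fact (Suc m)"
      by (simp add: increment_def power_mult_distrib mult_ac)
    also have "\<dots> \<le> 2 * c0 * (2 * real n * M) ^ m / fact m"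
      using c0_nonneg M_nonneg by (intro divide_left_mono fact_mono) auto
    finally show ?thesis using c0_nonneg M_nonneg by (simp add: increment_def field_simps)
  qed
  ultimately show ?thesis by (rule summable_comparison_test'[where N = 0])
qed

lemma picard_increment_uniform:
  assumes "i < n" "z \<in> strip d"
  shows "norm (picard (Suc m) i z - picard m i z) \<le> increment m"
proof -
  have "c0 * (real n * M) ^ m * (1 + tanh (Re z)) ^ Suc m / fact (Suc m) \<le> increment m"
    unfolding increment_def using c0_nonneg M_nonneg one_plus_tanh_nonneg one_plus_tanh_le_2
    by (intro divide_right_mono mult_left_mono power_mono) auto
  thus ?thesis using picard_increment[OF assms, of m] by linarith
qed

lemma solution_exists:
  "\<exists>u U. 0 \<le> U \<and> (\<forall>i<n. ((\<lambda>x. u i (of_real x)) \<longlongrightarrow> r i) at_bot \<and>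
     (\<forall>z\<in>strip d. norm (u i z) \<le> U \<and> (u i has_field_derivative G i z + (\<Sum>j<n. A i j z * u j z)) (at z)))"
proof -
  define U where "U = r_max + suminf increment"
  define u where "u = (\<lambda>i z. r i + (\<Sum>m. picard (Suc m) i z - picard m i z))"
  have inc_nonneg: "0 \<le> increment m" for m
    using c0_nonneg M_nonneg by (simp add: increment_def)
  have U: "0 \<le> U" unfolding U_def using r_max_nonneg suminf_nonneg[OF summable_increment] inc_nonneg by simp
  have telescope: "picard N i z = r i + (\<Sum>m<N. picard (Suc m) i z - picard m i z)" for N i z
    by (induction N) (simp_all del: picard.simps(2))
  have picard_U: "norm (picard N i z) \<le> U" if "i < n" "z \<in> strip d" for N i z
  proof -
    have "norm (\<Sum>m<N. picard (Suc m) i z - picard m i z) \<le> (\<Sum>m<N. increment m)"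
      using that by (intro sum_norm_le picard_increment_uniform) auto
    also have "\<dots> \<le> suminf increment"
      using inc_nonneg by (intro sum_le_suminf summable_increment) auto
    finally show ?thesis unfolding U_def telescope[of N] using r_le[OF that(1)]
      by (intro norm_triangle_mono)
  qed
  have unif: "uniform_limit (strip d) (\<lambda>N. picard N i) (u i) sequentially" if "i < n" for i
  proof -
    have "uniform_limit (strip d) (\<lambda>N z. \<Sum>m<N. picard (Suc m) i z - picard m i z)
        (\<lambda>z. \<Sum>m. picard (Suc m) i z - picard m i z) sequentially"
      by (rule Weierstrass_m_test[OF _ summable_increment]) (rule picard_increment_uniform[OF that])
    from uniform_limit_add[OF uniform_limit_const this, of "\<lambda>_. r i"]
    have "uniform_limit (strip d) (\<lambda>N z. r i + (\<Sum>m<N. picard (Suc m) i z - picard m i z)) (u i) sequentially"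
      unfolding u_def .
    moreover have "(\<lambda>N z. r i + (\<Sum>m<N. picard (Suc m) i z - picard m i z)) = (\<lambda>N. picard N i)"
      unfolding fun_eq_iff using telescope by metis
    ultimately show ?thesis by (simp only:)
  qed
  have lim: "(\<lambda>N. picard N i z) \<longlonglongrightarrow> u i z" if "i < n" "z \<in> strip d" for i z
    using tendsto_uniform_limitI[OF unif[OF that(1)] that(2)] .
  have u_bound: "norm (u i z) \<le> U" if "i < n" "z \<in> strip d" for i z
    by (rule tendsto_upperbound[OF tendsto_norm[OF lim[OF that]]]) (use picard_U that in auto)
  have lim': "((\<lambda>x. u i (of_real x)) \<longlongrightarrow> r i) at_bot" if i: "i < n" for i
  proof -
    \<comment> \<open>Built from the uniform bound U, so that |picard - r| \<le> K (1 + tanh x)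
      holds for all iterates at once and passes to the limit function. This exchanges the limits in
      m and in x.\<close>
    define K where "K = M * (1 + real n * U)"
    have rhs_K: "norm (rhs m i z) \<le> K / (cosh (Re z))\<^sup>2" if "z \<in> strip d" for m z
      unfolding rhs_def K_def using i that picard_U U by (intro rhs_bound) auto
    have K0: "((\<lambda>x. K * (1 + tanh x)) \<longlongrightarrow> 0) at_bot" "((\<lambda>x. K / (cosh x)\<^sup>2) \<longlongrightarrow> 0) at_bot"
      using tendsto_mult_left[OF tendsto_tanh_at_bot, of K] tendsto_mult_left[OF tendsto_inverse_cosh_square_at_bot, of K]
      by simp_all
    have b1: "norm (picard (Suc m) i (of_real x) - r i) \<le> K * (1 + tanh (Re (of_real x)))" for m x
      by (rule strip_primitive_bound[OF picard_props(1)[OF i] picard_props(2)[OF i] has_real_derivative_scaled_tanh K0 rhs_K _ order_refl])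
        (use d_pos in \<open>auto simp: strip_def\<close>)
    have b2: "(\<lambda>m. norm (picard (Suc m) i (of_real x) - r i)) \<longlonglongrightarrow> norm (u i (of_real x) - r i)" for x
      using lim[OF i, of "of_real x"] d_pos
      by (intro tendsto_norm tendsto_diff tendsto_const LIMSEQ_Suc) (simp add: strip_def)
    have "norm (u i (of_real x) - r i) \<le> K * (1 + tanh x)" for x
    proof (rule tendsto_upperbound[OF b2])
      show "\<forall>\<^sub>F m in sequentially. norm (picard (Suc m) i (of_real x) - r i) \<le> K * (1 + tanh x)"
        using b1[of _ x] by (intro always_eventually allI) (simp only: Re_complex_of_real)
    qed simp
    hence "((\<lambda>x. u i (of_real x) - r i) \<longlongrightarrow> 0) at_bot"
      by (intro Lim_null_comparison[OF _ K0(1)]) auto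
    thus ?thesis by (simp add: LIM_zero_iff)
  qed
  have deriv: "(u i has_field_derivative G i z + (\<Sum>j<n. A i j z * u j z)) (at z)" if i: "i < n" and z: "z \<in> strip d" for i z
  proof -
    \<comment> \<open>Uniform convergence carries derivatives of holomorphic functions to the limit.
      The sequence is shifted by one because \<open>rhs m\<close> is the derivative of
      \<open>picard (Suc m)\<close>.\<close>
    have "\<exists>g'. \<forall>x\<in>strip d. (u i has_field_derivative g' x) (at x) \<and> ((\<lambda>m. rhs m i x) \<longlongrightarrow> g' x) sequentially"
    proof (rule has_complex_derivative_uniform_sequence[OF open_strip])
      show "(picard (Suc m) i has_field_derivative rhs m i x) (at x)" if "x \<in> strip d" for m x
        using picard_props(1)[OF i that] .
      fix x assume "x \<in> strip d"
      then obtain e where e: "0 < e" "cball x e \<subseteq> strip d"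
        using open_strip open_contains_cball by blast
      have "uniform_limit (strip d) (\<lambda>m. picard (Suc m) i) (u i) sequentially"
        unfolding uniform_limit_iff
      proof (intro allI impI)
        fix \<epsilon> :: real assume "0 < \<epsilon>"
        hence "\<forall>\<^sub>F m in sequentially. \<forall>z\<in>strip d. dist (picard m i z) (u i z) < \<epsilon>"
          using unif[OF i] unfolding uniform_limit_iff by blast
        thus "\<forall>\<^sub>F m in sequentially. \<forall>z\<in>strip d. dist (picard (Suc m) i z) (u i z) < \<epsilon>"
          by (subst eventually_sequentially_Suc)
      qed
      hence "uniform_limit (cball x e) (\<lambda>m. picard (Suc m) i) (u i) sequentially"
        using e by (auto intro: uniform_limit_on_subset)
      thus "\<exists>e>0. cball x e \<subseteq> strip d \<and> uniform_limit (cball x e) (\<lambda>m. picard (Suc m) i) (u i) sequentially"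
        using e by blast
    qed
    then obtain g' where g': "(u i has_field_derivative g' z) (at z)" "(\<lambda>m. rhs m i z) \<longlonglongrightarrow> g' z"
      using z by blast
    have "(\<lambda>m. rhs m i z) \<longlonglongrightarrow> G i z + (\<Sum>j<n. A i j z * u j z)"
      unfolding rhs_def using z by (intro tendsto_intros lim) auto
    with g'(2) have "g' z = G i z + (\<Sum>j<n. A i j z * u j z)"
      by (rule LIMSEQ_unique)
    thus ?thesis using g'(1) by simp
  qed
  show ?thesis using U u_bound lim' deriv by blast
qed

end

section \<open>Double-exponential decay\<close>

text \<open>The exponential is what makes truncated samples small, while 1/cosh^2 keeps the weight
  within the estimates for primitives and contour integrals.\<close>

definition omega :: "real \<Rightarrow> real \<Rightarrow> real" where
  "omega \<gamma> x = exp (- \<gamma> * \<bar>sinh x\<bar>) / (cosh x)\<^sup>2"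

lemma omega_nonneg: "0 \<le> omega \<gamma> x"
  by (simp add: omega_def)

lemma omega_minus [simp]: "omega \<gamma> (- x) = omega \<gamma> x"
  by (simp add: omega_def)

lemma omega_le_inverse_cosh_square: "0 \<le> \<gamma> \<Longrightarrow> omega \<gamma> x \<le> 1 / (cosh x)\<^sup>2"
  by (simp add: omega_def divide_right_mono)

lemma Re_sinh: "Re (sinh z) = sinh (Re z) * cos (Im z)"
  by (simp add: sinh_field_def Re_exp diff_divide_distrib left_diff_distrib)

lemma norm_cosh_le: "norm (cosh z) \<le> cosh (Re z)" for z :: complex
proof -
  have "norm (exp z + exp (- z)) \<le> exp (Re z) + exp (- Re z)"
    by (rule norm_triangle_mono) simp_all
  thus ?thesis by (simp add: cosh_field_def norm_divide)
qed

lemma norm_cosh_ge: "\<bar>sinh (Re z)\<bar> \<le> norm (cosh z)" for z :: complex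
proof -
  have "\<bar>exp (Re z) - exp (- Re z)\<bar> \<le> norm (exp z - (- exp (- z)))"
    using norm_triangle_ineq3[of "exp z" "- exp (- z)"] by simp
  thus ?thesis by (simp add: cosh_field_def sinh_field_def norm_divide)
qed

lemma abs_le_abs_sinh: "\<bar>x\<bar> \<le> \<bar>sinh x\<bar>" for x :: real
  using real_le_abs_sinh[of x] by (simp add: sinh_field_def exp_minus)

lemma cosh_real_le: "cosh x \<le> 1 + \<bar>sinh x\<bar>" for x :: real
proof -
  have "(cosh x)\<^sup>2 \<le> (1 + \<bar>sinh x\<bar>)\<^sup>2"
    by (simp add: cosh_square_eq power2_sum)
  thus ?thesis by (rule power2_le_imp_le) simp
qed

text \<open>With s = |sinh x| one has cosh x \<le> 1 + s \<le> (1 + 3/\<gamma>) exp(\<gamma> s/3);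
  then cube. The third power covers one cosh from the derivative of the transformation and two from
  \<open>omega\<close>.\<close>

lemma cosh_cube_le_exp:
  fixes \<gamma> :: real assumes "0 < \<gamma>"
  shows "(cosh x) ^ 3 \<le> (1 + 3 / \<gamma>) ^ 3 * exp (\<gamma> * \<bar>sinh x\<bar>)"
proof -
  define s where "s = \<bar>sinh x\<bar>"
  have "0 \<le> s" by (simp add: s_def)
  have "cosh x \<le> 1 + s" using cosh_real_le by (simp add: s_def)
  also have "\<dots> \<le> (1 + 3 / \<gamma>) * (1 + \<gamma> * s / 3)"
    using assms \<open>0 \<le> s\<close> by (simp add: field_simps)
  also have "\<dots> \<le> (1 + 3 / \<gamma>) * exp (\<gamma> * s / 3)"
    using assms exp_ge_add_one_self[of "\<gamma> * s / 3"] by (intro mult_left_mono) auto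
  finally have "cosh x ^ 3 \<le> ((1 + 3 / \<gamma>) * exp (\<gamma> * s / 3)) ^ 3"
    by (intro power_mono) auto
  also have "\<dots> = (1 + 3 / \<gamma>) ^ 3 * exp (\<gamma> * s)"
    by (simp add: power_mult_distrib flip: exp_of_nat_mult)
  finally show ?thesis by (simp add: s_def)
qed

text \<open>Half of the exponent 2\<gamma> is sacrificed to absorb cosh^3; the other half survives
  in \<open>omega\<close>.\<close>

lemma cosh_times_exp_le_omega:
  assumes "0 < \<gamma>"
  shows "cosh x * exp (- (2 * \<gamma> * \<bar>sinh x\<bar>)) \<le> (1 + 3 / \<gamma>) ^ 3 * omega \<gamma> x"
proof -
  define e where "e = exp (\<gamma> * \<bar>sinh x\<bar>)"
  have e: "0 < e" by (simp add: e_def)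
  have "exp (- (2 * \<gamma> * \<bar>sinh x\<bar>)) = 1 / e / e"
    by (simp add: e_def exp_minus mult.assoc exp_double power2_eq_square field_simps flip: exp_add)
  moreover have "omega \<gamma> x = 1 / e / (cosh x)\<^sup>2"
    by (simp add: omega_def e_def exp_minus field_simps)
  moreover have "cosh x * (1 / e / e) = cosh x ^ 3 * (1 / e / e / (cosh x)\<^sup>2)"
    by (simp add: power2_eq_square power3_eq_cube)
  moreover have "cosh x ^ 3 * (1 / e / e / (cosh x)\<^sup>2) \<le> (1 + 3 / \<gamma>) ^ 3 * e * (1 / e / e / (cosh x)\<^sup>2)"
    using cosh_cube_le_exp[OF assms, of x] e by (intro mult_right_mono) (auto simp: e_def)
  ultimately show ?thesis using e by simp
qed

lemma exp_le_omega:
  assumes "0 < \<gamma>"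
  shows "exp (- (2 * \<gamma> * \<bar>sinh x\<bar>)) \<le> (1 + 3 / \<gamma>) ^ 3 * omega \<gamma> x"
proof -
  have "exp (- (2 * \<gamma> * \<bar>sinh x\<bar>)) \<le> cosh x * exp (- (2 * \<gamma> * \<bar>sinh x\<bar>))"
    using cosh_real_ge_1[of x] by simp
  thus ?thesis using cosh_times_exp_le_omega[OF assms, of x] by linarith
qed

lemma one_plus_tanh_le_inverse_cosh_square: "x \<le> 0 \<Longrightarrow> 1 + tanh x \<le> 1 / (cosh x)\<^sup>2" for x :: real
proof -
  assume "x \<le> 0"
  hence "tanh x \<le> 0" by simp
  hence "(1 + tanh x) * 1 \<le> (1 + tanh x) * (1 - tanh x)"
    using one_plus_tanh_nonneg[of x] by (intro mult_left_mono) auto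
  also have "\<dots> = 1 / (cosh x)\<^sup>2"
    unfolding inverse_cosh_square by (simp add: power2_eq_square algebra_simps)
  finally show ?thesis by simp
qed

text \<open>Where |sinh(Re z)| is large, |cosh w| \<ge> |sinh(Re w)| already grows like the
  exponential. The remaining points lie in a compact box, on which a continuous function without
  zeros has a positive minimum.\<close>

lemma cosh_sinh_lower_bound:
  assumes d: "0 < d" "d < pi / 2"
  shows "\<exists>c>0. \<forall>z. \<bar>Im z\<bar> \<le> d \<longrightarrow>
    c * exp (pi / 2 * cos d * \<bar>sinh (Re z)\<bar>) \<le> norm (cosh (of_real (pi / 2) * sinh z))"
proof -
  define \<kappa> where "\<kappa> = pi / 2 * cos d"
  \<comment> \<open>Since |x| \<le> |sinh x|, all z in the closed strip with \<kappa> |sinh(Re z)| <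
    1 lie in this box.\<close>
  define S where "S = cbox (Complex (- 1 / \<kappa>) (- d)) (Complex (1 / \<kappa>) d)"
  let ?w = "\<lambda>z. of_real (pi / 2) * sinh z :: complex"
  have \<kappa>: "0 < \<kappa>" using d by (simp add: \<kappa>_def cos_gt_zero)
  have S_iff: "z \<in> S \<longleftrightarrow> \<bar>Re z\<bar> \<le> 1 / \<kappa> \<and> \<bar>Im z\<bar> \<le> d" for z
    by (auto simp: S_def in_cbox_complex_iff)
  have cos_pos: "cos d \<le> cos (Im z)" if "\<bar>Im z\<bar> \<le> d" for z :: complex
    using that d cos_monotone_0_pi_le[of "\<bar>Im z\<bar>" d] by simp
  \<comment> \<open>A zero would force Re z = 0. On the imaginary axis w = i (pi/2) sin y, so cosh w
    = cos((pi/2) sin y), which is positive because |y| \<le> d < pi/2 gives |sin y| < 1.\<close>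
  have nonzero: "cosh (?w z) \<noteq> 0" if z: "\<bar>Im z\<bar> \<le> d" for z
  proof
    assume 0: "cosh (?w z) = 0"
    have "sinh (Re (?w z)) = 0" using norm_cosh_ge[of "?w z"] 0 by simp
    hence "sinh (Re z) * cos (Im z) = 0" by (simp add: Re_sinh)
    moreover have "cos (Im z) \<noteq> 0" using cos_pos[OF z] d cos_gt_zero[of d] by auto
    ultimately have "Re z = 0" by simp
    define y where "y = Im z"
    have "\<i> * z = - of_real y" using \<open>Re z = 0\<close> by (simp add: complex_eq_iff y_def)
    hence "sinh z = \<i> * of_real (sin y)"
      by (simp add: sinh_conv_sin sin_of_real)
    hence "\<i> * ?w z = - of_real (pi / 2 * sin y)" by (simp add: complex_eq_iff)
    hence "cosh (?w z) = cos (- of_real (pi / 2 * sin y))"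
      by (simp only: cosh_conv_cos)
    hence "cosh (?w z) = of_real (cos (pi / 2 * sin (Im z)))"
      by (simp only: cos_minus cos_of_real y_def)
    moreover have "\<bar>sin (Im z)\<bar> < 1"
    proof -
      have "0 < cos (Im z)" using cos_pos[OF z] d cos_gt_zero[of d] by linarith
      hence "(sin (Im z))\<^sup>2 < 1" by (simp add: sin_squared_eq)
      thus ?thesis by (simp add: abs_square_less_1)
    qed
    hence "pi / 2 * (- 1) < pi / 2 * sin (Im z)" "pi / 2 * sin (Im z) < pi / 2 * 1"
      by (intro mult_strict_left_mono; simp add: abs_less_iff)+
    hence "0 < cos (pi / 2 * sin (Im z))"
      by (intro cos_gt_zero_pi) auto
    ultimately show False using 0 by simp
  qed
  have "continuous_on S (\<lambda>z. norm (cosh (?w z)))" by (intro continuous_intros)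
  moreover have "compact S" by (simp add: S_def)
  moreover have "S \<noteq> {}" using S_iff[of 0] \<kappa> d by auto
  ultimately obtain z0 where z0: "z0 \<in> S" "\<And>z. z \<in> S \<Longrightarrow> norm (cosh (?w z0)) \<le> norm (cosh (?w z))"
    using continuous_attains_inf by metis
  \<comment> \<open>The entry 1/4 serves the outer region, where exp/4 \<le> sinh; division by exp 1
    accounts for the exponential on the box region, where its exponent is below 1.\<close>
  define c where "c = min (1 / 4) (norm (cosh (?w z0)) / exp 1)"
  have "0 < norm (cosh (?w z0))" using nonzero[of z0] z0(1) S_iff by simp
  hence "0 < c" by (simp add: c_def)
  moreover have "c * exp (\<kappa> * \<bar>sinh (Re z)\<bar>) \<le> norm (cosh (?w z))" if z: "\<bar>Im z\<bar> \<le> d" for z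
  proof (cases "1 \<le> \<kappa> * \<bar>sinh (Re z)\<bar>")
    case True
    have "\<kappa> * \<bar>sinh (Re z)\<bar> \<le> \<bar>Re (?w z)\<bar>"
    proof -
      have "cos d \<le> \<bar>cos (Im z)\<bar>" using cos_pos[OF z] by linarith
      hence "pi / 2 * \<bar>sinh (Re z)\<bar> * cos d \<le> pi / 2 * \<bar>sinh (Re z)\<bar> * \<bar>cos (Im z)\<bar>"
        by (intro mult_left_mono) auto
      thus ?thesis by (simp add: Re_sinh abs_mult \<kappa>_def mult_ac)
    qed
    hence "sinh (\<kappa> * \<bar>sinh (Re z)\<bar>) \<le> sinh \<bar>Re (?w z)\<bar>" by simp
    also have "\<dots> = \<bar>sinh (Re (?w z))\<bar>" by (rule sinh_real_abs)
    also have "\<dots> \<le> norm (cosh (?w z))" by (rule norm_cosh_ge)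
    finally have "exp (\<kappa> * \<bar>sinh (Re z)\<bar>) / 4 \<le> norm (cosh (?w z))"
      using exp_le_sinh[OF True] by linarith
    moreover have "c \<le> 1 / 4" unfolding c_def by (rule min.cobounded1)
    hence "c * exp (\<kappa> * \<bar>sinh (Re z)\<bar>) \<le> 1 / 4 * exp (\<kappa> * \<bar>sinh (Re z)\<bar>)"
      by (rule mult_right_mono) simp
    ultimately show ?thesis by linarith
  next
    case False
    hence "\<kappa> * \<bar>Re z\<bar> \<le> 1"
      using mult_left_mono[OF abs_le_abs_sinh[of "Re z"], of \<kappa>] \<kappa> by linarith
    hence "z \<in> S" using z \<kappa> by (simp add: S_iff field_simps)
    have "c * exp (\<kappa> * \<bar>sinh (Re z)\<bar>) \<le> norm (cosh (?w z0)) / exp 1 * exp 1"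
      using False \<open>0 < c\<close> by (intro mult_mono) (auto simp: c_def)
    also have "\<dots> \<le> norm (cosh (?w z))" using z0(2)[OF \<open>z \<in> S\<close>] by simp
    finally show ?thesis .
  qed
  ultimately show ?thesis unfolding \<kappa>_def by blast
qed

lemma norm_half_one_plus_tanh:
  fixes w :: complex
  assumes "cosh w \<noteq> 0"
  shows "norm ((1 + tanh w) / 2) = exp (Re w) / (2 * norm (cosh w))"
    and "norm ((1 - tanh w) / 2) = exp (- Re w) / (2 * norm (cosh w))"
proof -
  have "(1 + tanh w) / 2 = exp w / (2 * cosh w)"
    using assms cosh_plus_sinh[of w] by (simp add: tanh_def add_divide_distrib[symmetric] field_simps)
  thus "norm ((1 + tanh w) / 2) = exp (Re w) / (2 * norm (cosh w))"
    by (simp add: norm_divide norm_mult)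
  have "(1 - tanh w) / 2 = exp (- w) / (2 * cosh w)"
    using assms cosh_minus_sinh[of w] by (simp add: tanh_def diff_divide_distrib[symmetric] field_simps)
  thus "norm ((1 - tanh w) / 2) = exp (- Re w) / (2 * norm (cosh w))"
    by (simp add: norm_divide norm_mult)
qed

section \<open>Decay in the strip after the double-exponential transformation\<close>

locale de_strip =
  fixes a b d \<alpha> :: real
  assumes ab: "a < b" and d_pos: "0 < d" and d_less: "d < pi / 2" and \<alpha>_pos: "0 < \<alpha>" and \<alpha>_le: "\<alpha> \<le> 1"
begin

definition kap :: real where "kap = pi / 2 * cos d"

text \<open>Half of the rate 2 alpha kap at which |Q|^alpha decays; the other half pays for the
  powers of cosh in \<open>omega\<close>. By alpha \<le> 1 it is at most kap, so the interpolation
  weight decays at this rate too.\<close>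

definition gam :: real where "gam = \<alpha> * kap"

definition cosh_const :: real where
  "cosh_const = (SOME c. 0 < c \<and> (\<forall>z. \<bar>Im z\<bar> \<le> d \<longrightarrow>
     c * exp (pi / 2 * cos d * \<bar>sinh (Re z)\<bar>) \<le> norm (cosh (of_real (pi / 2) * sinh z))))"

lemma cosh_const: "0 < cosh_const" "\<bar>Im z\<bar> \<le> d \<Longrightarrow> cosh_const * exp (kap * \<bar>sinh (Re z)\<bar>) \<le> norm (cosh (of_real (pi / 2) * sinh z))"
  using someI_ex[OF cosh_sinh_lower_bound[OF d_pos d_less, unfolded Bex_def]]
  unfolding cosh_const_def[symmetric] kap_def by blast+

lemma kap_pos: "0 < kap" using d_pos d_less by (simp add: kap_def cos_gt_zero)

lemma gam_pos: "0 < gam" and gam_le: "gam \<le> kap"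
  using kap_pos \<alpha>_pos \<alpha>_le by (simp_all add: gam_def)

lemma cosh_nonzero: "z \<in> strip d \<Longrightarrow> cosh (of_real (pi / 2) * sinh z) \<noteq> 0"
  using cosh_const(2)[of z] cosh_const(1) by (auto simp: strip_def mult_le_0_iff)

text \<open>The weight \<open>w_b\<close> composed with the transformation and continued from the
  real line to the strip.\<close>

definition wb :: "complex \<Rightarrow> complex" where
  "wb z = (1 + tanh (of_real (pi / 2) * sinh z)) / 2"

lemma wb_holomorphic: "wb holomorphic_on strip d"
proof -
  have eq: "wb z = (1 + sinh (of_real (pi / 2) * sinh z) / cosh (of_real (pi / 2) * sinh z)) / 2" for z
    by (simp add: wb_def tanh_def)
  have "(\<lambda>z. (1 + sinh (of_real (pi / 2) * sinh z) / cosh (of_real (pi / 2) * sinh z)) / 2) holomorphic_on strip d"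
    using cosh_nonzero unfolding sinh_field_def cosh_field_def
    by (intro holomorphic_intros) (auto simp: sinh_field_def cosh_field_def)
  thus ?thesis unfolding eq [abs_def] .
qed

lemma kap_abs_sinh_le:
  assumes "z \<in> strip d"
  shows "kap * \<bar>sinh (Re z)\<bar> \<le> \<bar>Re (of_real (pi / 2) * sinh z)\<bar>"
proof -
  have "cos d \<le> cos (Im z)"
    using assms d_less cos_monotone_0_pi_le[of "\<bar>Im z\<bar>" d] by (simp add: strip_def)
  hence "cos d \<le> \<bar>cos (Im z)\<bar>" by linarith
  hence "pi / 2 * \<bar>sinh (Re z)\<bar> * cos d \<le> pi / 2 * \<bar>sinh (Re z)\<bar> * \<bar>cos (Im z)\<bar>"
    by (intro mult_left_mono) auto
  thus ?thesis by (simp add: Re_sinh abs_mult kap_def mult_ac)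
qed

lemma Re_sign:
  assumes "z \<in> strip d"
  shows "Re z \<le> 0 \<Longrightarrow> Re (of_real (pi / 2) * sinh z) \<le> 0" "0 \<le> Re z \<Longrightarrow> 0 \<le> Re (of_real (pi / 2) * sinh z)"
proof -
  have "0 < cos (Im z)"
    using assms d_less cos_gt_zero_pi[of "Im z"] by (simp add: strip_def abs_less_iff)
  thus "Re z \<le> 0 \<Longrightarrow> Re (of_real (pi / 2) * sinh z) \<le> 0" "0 \<le> Re z \<Longrightarrow> 0 \<le> Re (of_real (pi / 2) * sinh z)"
    by (auto simp: Re_sinh mult_le_0_iff zero_le_mult_iff)
qed

definition wb_const :: real where
  "wb_const = (1 + 3 / gam) ^ 3 / (2 * cosh_const)"

lemma wb_const_nonneg: "0 \<le> wb_const"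
  using cosh_const(1) gam_pos by (simp add: wb_const_def)

text \<open>Numerator and denominator each contribute a factor exp(-kap |sinh(Re z)|), which
  together give the rate 2 kap \<ge> 2 gam.\<close>

lemma half_exp_quotient_le:
  assumes z: "z \<in> strip d"
  shows "exp (- \<bar>Re (of_real (pi / 2) * sinh z)\<bar>) / (2 * norm (cosh (of_real (pi / 2) * sinh z))) \<le> wb_const * omega gam (Re z)"
proof -
  define s where "s = \<bar>sinh (Re z)\<bar>"
  have s: "0 \<le> s" by (simp add: s_def)
  have "exp (- \<bar>Re (of_real (pi / 2) * sinh z)\<bar>) / (2 * norm (cosh (of_real (pi / 2) * sinh z)))
      \<le> exp (- (kap * s)) / (2 * (cosh_const * exp (kap * s)))"
    using kap_abs_sinh_le[OF z] cosh_const(2)[of z] cosh_const(1) z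
    by (intro frac_le mult_left_mono) (auto simp: strip_def s_def)
  also have "\<dots> = exp (- (2 * kap * s)) / (2 * cosh_const)"
    by (simp add: exp_minus field_simps flip: exp_add)
  also have "\<dots> \<le> exp (- (2 * gam * s)) / (2 * cosh_const)"
    using gam_le s cosh_const(1) by (intro divide_right_mono) (auto intro!: mult_right_mono)
  also have "\<dots> \<le> (1 + 3 / gam) ^ 3 * omega gam (Re z) / (2 * cosh_const)"
    unfolding s_def using exp_le_omega[OF gam_pos, of "Re z"] cosh_const(1)
    by (intro divide_right_mono) auto
  finally show ?thesis by (simp add: wb_const_def)
qed

lemma wb_left:
  assumes "z \<in> strip d" "Re z \<le> 0"
  shows "norm (wb z) \<le> wb_const * omega gam (Re z)"
  using half_exp_quotient_le[OF assms(1)] Re_sign(1)[OF assms]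
  unfolding wb_def norm_half_one_plus_tanh(1)[OF cosh_nonzero[OF assms(1)]] by simp

lemma wb_right:
  assumes "z \<in> strip d" "0 \<le> Re z"
  shows "norm (1 - wb z) \<le> wb_const * omega gam (Re z)"
proof -
  have eq: "1 - wb z = (1 - tanh (of_real (pi / 2) * sinh z)) / 2" by (simp add: wb_def field_simps)
  show ?thesis
    unfolding eq norm_half_one_plus_tanh(2)[OF cosh_nonzero[OF assms(1)]]
    using half_exp_quotient_le[OF assms(1)] Re_sign(2)[OF assms] by simp
qed

text \<open>From 1 - tanh^2 = 1/cosh^2. The square is the origin of the factor 2 in the decay rate
  of |Q|^alpha.\<close>

lemma Q_psi:
  assumes "cosh (of_real (pi / 2) * sinh z) \<noteq> 0"
  shows "Q_fun a b (psi_DE a b z) = of_real (((b - a) / 2)\<^sup>2) / (cosh (of_real (pi / 2) * sinh z))\<^sup>2"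
proof -
  define w where "w = of_real (pi / 2) * sinh z"
  have w: "cosh w \<noteq> 0" using assms by (simp add: w_def)
  have "1 - (tanh w)\<^sup>2 = ((cosh w)\<^sup>2 - (sinh w)\<^sup>2) / (cosh w)\<^sup>2"
    using w by (simp add: tanh_def diff_divide_distrib power_divide)
  also have "\<dots> = 1 / (cosh w)\<^sup>2" by (simp add: cosh_square_eq)
  finally have eq: "of_real (((b - a) / 2)\<^sup>2) / (cosh w)\<^sup>2 = of_real (((b - a) / 2)\<^sup>2) * (1 - (tanh w)\<^sup>2)" by simp
  show ?thesis
    unfolding w_def[symmetric] eq Q_fun_def psi_DE_def by (simp add: power2_eq_square field_simps)
qed

text \<open>If F is a coefficient times Q, the product estimated here is that coefficient times the
  derivative of the transformation: coefficients may be singular at the end points, but this product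
  decays double exponentially.\<close>

lemma L_space_times_cosh:
  assumes F: "F \<in> L_space a b d \<alpha>"
  shows "\<exists>K\<ge>0. \<forall>z\<in>strip d. norm (F z * (of_real (pi / (b - a)) * cosh z)) \<le> K * omega gam (Re z)"
proof -
  obtain L where L: "\<And>z. z \<in> strip d \<Longrightarrow> norm (F z) \<le> L * norm (Q_fun a b (psi_DE a b z)) powr \<alpha>"
    using F unfolding L_space_def by blast
  define q where "q = ((b - a) / 2)\<^sup>2"
  \<comment> \<open>The definition of the function space puts no sign on L, whereas K must be
    nonnegative.\<close>
  define L' where "L' = max 0 L"
  have q: "0 < q" using ab by (simp add: q_def)
  define K where "K = L' * q powr \<alpha> * cosh_const powr (- 2 * \<alpha>) * (pi / (b - a)) * (1 + 3 / gam) ^ 3"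
  have "norm (F z * (of_real (pi / (b - a)) * cosh z)) \<le> K * omega gam (Re z)" if z: "z \<in> strip d" for z
  proof -
    define C where "C = norm (cosh (of_real (pi / 2) * sinh z))"
    define s where "s = \<bar>sinh (Re z)\<bar>"
    have C: "cosh_const * exp (kap * s) \<le> C" using cosh_const(2)[of z] z by (simp add: C_def s_def strip_def)
    have C0: "0 < C" using cosh_nonzero[OF z] by (simp add: C_def)
    have "norm (Q_fun a b (psi_DE a b z)) = q * C powr (- 2)"
      unfolding Q_psi[OF cosh_nonzero[OF z]] q_def[symmetric] norm_divide norm_power norm_of_real C_def[symmetric]
      using q C0 by (simp add: powr_minus_divide)
    hence "norm (Q_fun a b (psi_DE a b z)) powr \<alpha> = q powr \<alpha> * C powr (- 2 * \<alpha>)"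
      using q C0 by (simp add: powr_mult powr_powr)
    also have "\<dots> \<le> q powr \<alpha> * (cosh_const * exp (kap * s)) powr (- 2 * \<alpha>)"
      using C cosh_const(1) \<alpha>_pos by (intro mult_left_mono powr_mono2') auto
    also have "(cosh_const * exp (kap * s)) powr (- 2 * \<alpha>) = cosh_const powr (- 2 * \<alpha>) * exp (- (2 * gam * s))"
      using cosh_const(1) by (simp add: powr_mult exp_powr_real gam_def mult_ac)
    finally have Q: "norm (Q_fun a b (psi_DE a b z)) powr \<alpha> \<le> q powr \<alpha> * (cosh_const powr (- 2 * \<alpha>) * exp (- (2 * gam * s)))" .
    have "norm (F z) \<le> L' * norm (Q_fun a b (psi_DE a b z)) powr \<alpha>"
      by (rule order_trans[OF L[OF z]]) (auto simp: L'_def intro: mult_right_mono)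
    also have "\<dots> \<le> L' * (q powr \<alpha> * (cosh_const powr (- 2 * \<alpha>) * exp (- (2 * gam * s))))"
      by (rule mult_left_mono[OF Q]) (simp add: L'_def)
    finally have "norm (F z * (of_real (pi / (b - a)) * cosh z))
        \<le> L' * (q powr \<alpha> * (cosh_const powr (- 2 * \<alpha>) * exp (- (2 * gam * s)))) * (pi / (b - a) * cosh (Re z))"
      unfolding norm_mult norm_of_real using ab norm_cosh_le[of z]
      by (intro mult_mono) (auto simp: L'_def intro!: mult_left_mono)
    also have "\<dots> = L' * q powr \<alpha> * cosh_const powr (- 2 * \<alpha>) * (pi / (b - a)) * (cosh (Re z) * exp (- (2 * gam * s)))"
      by (simp only: mult_ac)
    also have "\<dots> \<le> L' * q powr \<alpha> * cosh_const powr (- 2 * \<alpha>) * (pi / (b - a)) * ((1 + 3 / gam) ^ 3 * omega gam (Re z))"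
      unfolding s_def using ab cosh_times_exp_le_omega[OF gam_pos, of "Re z"]
      by (intro mult_left_mono mult_nonneg_nonneg) (auto simp: L'_def)
    finally show ?thesis by (simp add: K_def mult_ac)
  qed
  moreover have "0 \<le> K" using ab gam_pos by (simp add: K_def L'_def)
  ultimately show ?thesis by blast
qed

end

section \<open>End point behaviour and uniqueness\<close>

text \<open>Left of z the exponential factor of \<open>omega\<close> is largest at z itself, so it
  can be frozen there. Only 1/cosh^2 is integrated, and for Re z \<le> 0 its primitive 1 + tanh is
  again below 1/cosh^2: no constant is lost.\<close>

lemma left_endpoint_decay:
  assumes P: "\<And>z. z \<in> strip d \<Longrightarrow> (P has_field_derivative H z) (at z)"
    and lim: "((\<lambda>x. P (of_real x)) \<longlongrightarrow> l) at_bot"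
    and bound: "\<And>z. z \<in> strip d \<Longrightarrow> norm (H z) \<le> K * omega \<gamma> (Re z)" and K: "0 \<le> K" and \<gamma>: "0 \<le> \<gamma>"
    and z: "z \<in> strip d" "Re z \<le> 0"
  shows "norm (P z - l) \<le> K * omega \<gamma> (Re z)"
proof -
  define K' where "K' = K * exp (- \<gamma> * \<bar>sinh (Re z)\<bar>)"
  have K': "0 \<le> K'" using K by (simp add: K'_def)
  have K0: "((\<lambda>x. K' * (1 + tanh x)) \<longlongrightarrow> 0) at_bot" "((\<lambda>x. K' / (cosh x)\<^sup>2) \<longlongrightarrow> 0) at_bot"
    using tendsto_mult_left[OF tendsto_tanh_at_bot, of K'] tendsto_mult_left[OF tendsto_inverse_cosh_square_at_bot, of K']
    by simp_all
  have "norm (H w) \<le> K' / (cosh (Re w))\<^sup>2" if w: "w \<in> strip d" "Re w \<le> Re z" for w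
  proof -
    have "\<bar>sinh (Re z)\<bar> \<le> \<bar>sinh (Re w)\<bar>"
      using w z by (simp add: abs_of_nonpos)
    hence "exp (- \<gamma> * \<bar>sinh (Re w)\<bar>) \<le> exp (- \<gamma> * \<bar>sinh (Re z)\<bar>)"
      using \<gamma> by (simp add: mult_left_mono)
    hence "K * omega \<gamma> (Re w) \<le> K' / (cosh (Re w))\<^sup>2"
      unfolding omega_def K'_def using K by (simp add: mult_left_mono divide_right_mono)
    thus ?thesis using bound[OF w(1)] by linarith
  qed
  hence "norm (P z - l) \<le> K' * (1 + tanh (Re z))"
    by (intro strip_primitive_bound[OF P lim has_real_derivative_scaled_tanh K0 _ z(1) order_refl]) auto
  also have "\<dots> \<le> K' * (1 / (cosh (Re z))\<^sup>2)"
    using K' one_plus_tanh_le_inverse_cosh_square[OF z(2)] by (intro mult_left_mono) auto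
  also have "\<dots> = K * omega \<gamma> (Re z)" by (simp add: K'_def omega_def)
  finally show ?thesis .
qed

lemma uminus_in_strip_iff [simp]: "- z \<in> strip d \<longleftrightarrow> z \<in> strip d"
  by (simp add: strip_def)

text \<open>Reflection z to -z reduces this to the left end. There the limit has to be known
  beforehand; it is found as the constant by which the reflected primitive differs from the one
  normalised to 0 at minus infinity.\<close>

lemma right_endpoint_decay:
  assumes d: "0 < d" and H: "H holomorphic_on strip d"
    and P: "\<And>z. z \<in> strip d \<Longrightarrow> (P has_field_derivative H z) (at z)"
    and bound: "\<And>z. z \<in> strip d \<Longrightarrow> norm (H z) \<le> K * omega \<gamma> (Re z)" and K: "0 \<le> K" and \<gamma>: "0 \<le> \<gamma>"
  shows "\<exists>s. \<forall>z\<in>strip d. 0 \<le> Re z \<longrightarrow> norm (P z - s) \<le> K * omega \<gamma> (Re z)"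
proof -
  define H2 where "H2 = (\<lambda>z. - H (- z))"
  have bound2: "norm (H2 z) \<le> K * omega \<gamma> (Re z)" if "z \<in> strip d" for z
    using bound[of "- z"] that by (simp add: H2_def)
  have "norm (H2 z) \<le> K / (cosh (Re z))\<^sup>2" if "z \<in> strip d" for z
    using bound2[OF that] mult_left_mono[OF omega_le_inverse_cosh_square[OF \<gamma>] K, of "Re z"] by simp
  moreover have "H \<circ> (\<lambda>z. - z) holomorphic_on strip d"
    by (rule holomorphic_on_compose_gen[where t = "strip d"]) (auto intro!: holomorphic_intros H)
  hence "H2 holomorphic_on strip d"
    unfolding H2_def o_def by (rule holomorphic_on_minus)
  ultimately obtain P2 where P2: "\<And>z. z \<in> strip d \<Longrightarrow> (P2 has_field_derivative H2 z) (at z)"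
    and lim2: "((\<lambda>x. P2 (of_real x)) \<longlongrightarrow> 0) at_bot"
    using strip_primitive_exists[OF d] by blast
  have refl: "((\<lambda>z. P (- z)) has_field_derivative H2 z) (at z)" if "z \<in> strip d" for z
  proof -
    have "(P has_field_derivative H (- z)) (at (- z))" using P[of "- z"] that by simp
    hence "((\<lambda>z. P (- z)) has_field_derivative H (- z) * (- 1)) (at z)"
      by (rule DERIV_chain2) (auto intro!: derivative_eq_intros)
    thus ?thesis by (simp add: H2_def)
  qed
  have "\<exists>c. \<forall>z\<in>strip d. P (- z) - P2 z = c"
  proof (rule has_field_derivative_zero_constant[OF convex_strip])
    fix z assume "z \<in> strip d"
    from has_field_derivative_at_within[OF DERIV_diff[OF refl[OF this] P2[OF this]]]
    show "((\<lambda>z. P (- z) - P2 z) has_field_derivative 0) (at z within strip d)" by simp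
  qed
  then obtain s where s: "\<And>z. z \<in> strip d \<Longrightarrow> P (- z) = P2 z + s"
    by (metis diff_eq_eq add.commute)
  have "((\<lambda>x. P2 (of_real x) + s) \<longlongrightarrow> 0 + s) at_bot"
    by (intro tendsto_intros lim2)
  hence lim: "((\<lambda>x. P (- of_real x)) \<longlongrightarrow> s) at_bot"
    using d by (simp add: s strip_def)
  show ?thesis
  proof (intro exI ballI impI)
    fix z assume z: "z \<in> strip d" "0 \<le> Re z"
    show "norm (P z - s) \<le> K * omega \<gamma> (Re z)"
      using left_endpoint_decay[OF refl lim bound2 K \<gamma>, of d "- z"] z by simp
  qed
qed

text \<open>Gronwall from minus infinity: Z, the sum of |e_i|^2, satisfies Z' \<le> c Z/cosh^2, so Z
  exp(-c tanh x) is nonincreasing; it is nonnegative and tends to 0 at minus infinity.\<close>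

lemma linear_ode_zero:
  fixes e :: "nat \<Rightarrow> real \<Rightarrow> complex"
  assumes deriv: "\<And>i x. i < n \<Longrightarrow> (e i has_vector_derivative (\<Sum>j<n. A i j x * e j x)) (at x)"
    and bound: "\<And>i j x. i < n \<Longrightarrow> j < n \<Longrightarrow> norm (A i j x) \<le> M / (cosh x)\<^sup>2"
    and lim: "\<And>i. i < n \<Longrightarrow> (e i \<longlongrightarrow> 0) at_bot" and i: "i < n"
  shows "e i x = 0"
proof -
  define Z where "Z = (\<lambda>x. \<Sum>i<n. (norm (e i x))\<^sup>2)"
  define Z' where "Z' = (\<lambda>x. \<Sum>i<n. 2 * Re (cnj (e i x) * (\<Sum>j<n. A i j x * e j x)))"
  define c where "c = 2 * real n * M"
  have M: "0 \<le> M / (cosh x)\<^sup>2" for x using bound[OF i i, of x] norm_ge_zero order_trans by blast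
  have Z_deriv: "(Z has_real_derivative Z' x) (at x)" for x
    unfolding Z_def Z'_def
  proof (rule DERIV_sum)
    fix i assume "i \<in> {..<n}"
    hence "i < n" by simp
    note D = deriv[OF this, of x]
    have "((\<lambda>x. Re (e i x)) has_real_derivative Re (\<Sum>j<n. A i j x * e j x)) (at x)"
      "((\<lambda>x. Im (e i x)) has_real_derivative Im (\<Sum>j<n. A i j x * e j x)) (at x)"
      unfolding has_real_derivative_iff_has_vector_derivative
      by (rule bounded_linear.has_vector_derivative[OF bounded_linear_Re D]
          bounded_linear.has_vector_derivative[OF bounded_linear_Im D])+
    from DERIV_add[OF DERIV_power[OF this(1), of 2] DERIV_power[OF this(2), of 2]]
    show "((\<lambda>x. (norm (e i x))\<^sup>2) has_real_derivative 2 * Re (cnj (e i x) * (\<Sum>j<n. A i j x * e j x))) (at x)"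
      by (simp add: cmod_power2 algebra_simps)
  qed
  have Z'_le: "Z' x \<le> c / (cosh x)\<^sup>2 * Z x" for x
  proof -
    define m where "m = M / (cosh x)\<^sup>2"
    have m: "0 \<le> m" using M by (simp add: m_def)
    have "Z' x \<le> (\<Sum>i<n. \<Sum>j<n. m * ((norm (e i x))\<^sup>2 + (norm (e j x))\<^sup>2))"
      unfolding Z'_def
    proof (rule sum_mono)
      fix i assume "i \<in> {..<n}"
      have "2 * Re (cnj (e i x) * (\<Sum>j<n. A i j x * e j x)) \<le> 2 * norm (cnj (e i x) * (\<Sum>j<n. A i j x * e j x))"
        by (intro mult_left_mono complex_Re_le_cmod) simp
      also have "\<dots> = 2 * norm (e i x) * norm (\<Sum>j<n. A i j x * e j x)" by (simp add: norm_mult)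
      also have "\<dots> \<le> 2 * norm (e i x) * (\<Sum>j<n. m * norm (e j x))"
        by (intro mult_left_mono sum_norm_le, unfold norm_mult, intro mult_right_mono)
          (use \<open>i \<in> {..<n}\<close> bound in \<open>auto simp: m_def\<close>)
      also have "\<dots> = (\<Sum>j<n. m * (2 * norm (e i x) * norm (e j x)))"
        by (simp add: sum_distrib_left mult_ac)
      also have "\<dots> \<le> (\<Sum>j<n. m * ((norm (e i x))\<^sup>2 + (norm (e j x))\<^sup>2))"
        using m by (intro sum_mono mult_left_mono sum_squares_bound) auto
      finally show "2 * Re (cnj (e i x) * (\<Sum>j<n. A i j x * e j x)) \<le> (\<Sum>j<n. m * ((norm (e i x))\<^sup>2 + (norm (e j x))\<^sup>2))" .
    qed
    also have "\<dots> = m * (real n * Z x + real n * Z x)"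
      by (simp add: Z_def sum.distrib sum_distrib_left[symmetric] distrib_left)
    also have "\<dots> = c / (cosh x)\<^sup>2 * Z x" by (simp add: m_def c_def)
    finally show ?thesis .
  qed
  define g where "g = (\<lambda>x. Z x * exp (- c * tanh x))"
  have g_mono: "g x \<le> g t" if "t \<le> x" for t x
  proof (rule DERIV_nonpos_imp_nonincreasing[OF that])
    fix x
    have "(g has_real_derivative Z' x * exp (- c * tanh x) + (exp (- c * tanh x) * (- c * (1 / (cosh x)\<^sup>2))) * Z x) (at x)"
      unfolding g_def
      by (intro DERIV_mult Z_deriv DERIV_fun_exp DERIV_cmult has_real_derivative_tanh)
    moreover have "Z' x * exp (- c * tanh x) + (exp (- c * tanh x) * (- c * (1 / (cosh x)\<^sup>2))) * Z x
        = exp (- c * tanh x) * (Z' x - c / (cosh x)\<^sup>2 * Z x)"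
      by (simp add: algebra_simps)
    moreover have "exp (- c * tanh x) * (Z' x - c / (cosh x)\<^sup>2 * Z x) \<le> 0"
      using Z'_le[of x] by (intro mult_nonneg_nonpos) auto
    ultimately show "\<exists>y. (g has_real_derivative y) (at x) \<and> y \<le> 0" by auto
  qed
  have "(g \<longlongrightarrow> (\<Sum>i<n. (norm (0::complex))\<^sup>2) * exp (- c * (- 1))) at_bot"
    unfolding g_def Z_def by (intro tendsto_intros lim tanh_real_at_bot) auto
  hence "(g \<longlongrightarrow> 0) at_bot" by simp
  hence "g x \<le> 0"
    by (rule tendsto_lowerbound) (auto simp: eventually_at_bot_linorder intro!: exI[of _ x] g_mono)
  hence "Z x \<le> 0" by (simp add: g_def mult_le_0_iff)
  moreover have "(norm (e i x))\<^sup>2 \<le> Z x"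
    unfolding Z_def using i by (intro member_le_sum) auto
  ultimately show ?thesis using zero_le_power2[of "norm (e i x)"] by (smt (verit) norm_eq_zero power_eq_0_iff)
qed

section \<open>The transformation on the real line\<close>

lemma cosh_of_real: "cosh (of_real x :: complex) = of_real (cosh x)"
  and sinh_of_real: "sinh (of_real x :: complex) = of_real (sinh x)"
  by (simp_all add: cosh_field_def sinh_field_def flip: exp_of_real)

lemma psi_DE_real: "psi_DE a b x = (b - a) / 2 * tanh (pi / 2 * sinh x) + (b + a) / 2" for x :: real
  by (simp add: psi_DE_def)

lemma phi_psi: "a < b \<Longrightarrow> phi_DE a b (psi_DE a b x) = x"
proof -
  assume "a < b"
  hence "(2 * psi_DE a b x - b - a) / (b - a) = tanh (pi / 2 * sinh x)"
    by (simp add: psi_DE_real field_simps)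
  thus ?thesis by (simp add: phi_DE_def artanh_tanh_real arsinh_sinh_real)
qed

lemma psi_phi:
  assumes "a < t" "t < b" shows "psi_DE a b (phi_DE a b t) = t"
proof -
  define v where "v = (2 * t - b - a) / (b - a)"
  have "- 1 < v" "v < 1" using assms by (auto simp: v_def field_simps)
  hence q: "exp (- 2 * artanh v) = (1 - v) / (1 + v)"
    by (simp add: artanh_def exp_minus)
  have "tanh (artanh v) = v"
    unfolding tanh_real_altdef q using \<open>- 1 < v\<close> by (simp add: divide_simps)
  hence "psi_DE a b (phi_DE a b t) = (b - a) / 2 * v + (b + a) / 2"
    by (simp add: psi_DE_real phi_DE_def v_def)
  also have "\<dots> = t" using assms by (simp add: v_def field_simps)
  finally show ?thesis .
qed

lemma psi_DE_in_interval: "a < b \<Longrightarrow> a < psi_DE a b x \<and> psi_DE a b x < b" for x :: real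
proof -
  assume "a < b"
  hence "(b - a) / 2 * (- 1) < (b - a) / 2 * tanh (pi / 2 * sinh x)" "(b - a) / 2 * tanh (pi / 2 * sinh x) < (b - a) / 2 * 1"
    using tanh_real_gt_neg1 tanh_real_lt_1 by (intro mult_strict_left_mono; simp)+
  thus ?thesis by (simp add: psi_DE_real) (simp add: field_simps)
qed

lemma has_real_derivative_psi_DE:
  "(psi_DE a b has_real_derivative (b - a) / 2 * (pi / 2 * cosh x / (cosh (pi / 2 * sinh x))\<^sup>2)) (at x)"
proof -
  have "((\<lambda>x. (b - a) / 2 * tanh (pi / 2 * sinh x) + (b + a) / 2) has_real_derivative
      (b - a) / 2 * (1 / (cosh (pi / 2 * sinh x))\<^sup>2 * (pi / 2 * cosh x)) + 0) (at x)"
    by (intro DERIV_add DERIV_cmult DERIV_chain2[OF has_real_derivative_tanh] DERIV_const)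
      (auto intro!: derivative_eq_intros)
  thus ?thesis by (simp add: psi_DE_real [abs_def] mult_ac)
qed

lemma psi_DE_at_bot: "((psi_DE a b :: real \<Rightarrow> real) \<longlongrightarrow> a) at_bot"
proof -
  have "filterlim (\<lambda>x. pi / 2 * sinh x) at_bot at_bot"
    by (rule filterlim_tendsto_pos_mult_at_bot[OF tendsto_const _ sinh_real_at_bot]) simp
  from filterlim_compose[OF tanh_real_at_bot this]
  have "((\<lambda>x. (b - a) / 2 * tanh (pi / 2 * sinh x) + (b + a) / 2) \<longlongrightarrow> (b - a) / 2 * (- 1) + (b + a) / 2) at_bot"
    by (intro tendsto_intros)
  thus ?thesis by (simp add: psi_DE_real [abs_def] field_simps)
qed

lemma psi_DE_at_top: "((psi_DE a b :: real \<Rightarrow> real) \<longlongrightarrow> b) at_top"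
proof -
  have "filterlim (\<lambda>x. pi / 2 * sinh x) at_top at_top"
    by (rule filterlim_tendsto_pos_mult_at_top[OF tendsto_const _ sinh_real_at_top]) simp
  from filterlim_compose[OF tanh_real_at_top this]
  have "((\<lambda>x. (b - a) / 2 * tanh (pi / 2 * sinh x) + (b + a) / 2) \<longlongrightarrow> (b - a) / 2 * 1 + (b + a) / 2) at_top"
    by (intro tendsto_intros)
  thus ?thesis by (simp add: psi_DE_real [abs_def] field_simps)
qed

section \<open>The transformed initial value problem\<close>

locale de_ivp = de_strip +
  fixes n :: nat and r :: "complex vec" and k :: "nat \<Rightarrow> nat \<Rightarrow> complex \<Rightarrow> complex"
    and g :: "nat \<Rightarrow> complex \<Rightarrow> complex" and y :: "nat \<Rightarrow> real \<Rightarrow> complex"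
  assumes k_L: "\<And>i j. i < n \<Longrightarrow> j < n \<Longrightarrow> (\<lambda>\<zeta>. k i j \<zeta> * Q_fun a b (psi_DE a b \<zeta>)) \<in> L_space a b d \<alpha>"
    and g_L: "\<And>i. i < n \<Longrightarrow> (\<lambda>\<zeta>. g i \<zeta> * Q_fun a b (psi_DE a b \<zeta>)) \<in> L_space a b d \<alpha>"
    and ivp: "ivp_solution a b n k g r y"
begin

text \<open>The coefficient multiplied by the derivative of the transformation, with that derivative
  written as pi cosh z/(b - a) times Q, so that the hypothesis on f Q applies directly.\<close>

definition scaled :: "(complex \<Rightarrow> complex) \<Rightarrow> complex \<Rightarrow> complex" where
  "scaled f z = (f z * Q_fun a b (psi_DE a b z)) * (of_real (pi / (b - a)) * cosh z)"

definition dpsi :: "real \<Rightarrow> real" where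
  "dpsi x = (b - a) / 2 * (pi / 2 * cosh x / (cosh (pi / 2 * sinh x))\<^sup>2)"

lemma scaled_of_real: "scaled f (of_real x) = of_real (dpsi x) * f (of_real x)"
proof -
  have w: "of_real (pi / 2) * sinh (of_real x :: complex) = of_real (pi / 2 * sinh x)"
    by (simp add: sinh_of_real)
  have nz: "cosh (of_real (pi / 2) * sinh (of_real x :: complex)) \<noteq> 0"
    unfolding w cosh_of_real by simp
  have "Q_fun a b (psi_DE a b (of_real x)) = of_real (((b - a) / 2)\<^sup>2 / (cosh (pi / 2 * sinh x))\<^sup>2)"
    unfolding Q_psi[OF nz] w cosh_of_real by simp
  moreover have "((b - a) / 2)\<^sup>2 / (cosh (pi / 2 * sinh x))\<^sup>2 * (pi / (b - a) * cosh x) = dpsi x"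
    using ab by (simp add: dpsi_def power2_eq_square field_simps)
  hence "complex_of_real (((b - a) / 2)\<^sup>2 / (cosh (pi / 2 * sinh x))\<^sup>2) * (of_real (pi / (b - a)) * of_real (cosh x)) = of_real (dpsi x)"
    by (simp only: of_real_mult[symmetric])
  ultimately show ?thesis
    unfolding scaled_def cosh_of_real by (simp only: mult_ac)
qed

lemma scaled_holomorphic:
  assumes "(\<lambda>\<zeta>. f \<zeta> * Q_fun a b (psi_DE a b \<zeta>)) \<in> L_space a b d \<alpha>"
  shows "scaled f holomorphic_on strip d"
proof -
  have "(\<lambda>\<zeta>. f \<zeta> * Q_fun a b (psi_DE a b \<zeta>)) holomorphic_on strip d"
    using assms unfolding L_space_def by (auto intro: analytic_imp_holomorphic)
  thus ?thesis
    unfolding scaled_def [abs_def] cosh_field_def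
    by (rule holomorphic_on_mult) (intro holomorphic_intros, auto)
qed

lemma uniform_bound:
  "\<exists>M\<ge>0. (\<forall>i<n. \<forall>j<n. \<forall>z\<in>strip d. norm (scaled (k i j) z) \<le> M * omega gam (Re z))
     \<and> (\<forall>i<n. \<forall>z\<in>strip d. norm (scaled (g i) z) \<le> M * omega gam (Re z))"
proof -
  \<comment> \<open>The index condition stands under the existential quantifier so that the choice
    of K becomes a total function of the index.\<close>
  have "\<exists>K. i < n \<longrightarrow> 0 \<le> K \<and> (\<forall>z\<in>strip d. norm (scaled (g i) z) \<le> K * omega gam (Re z))" for i
    using L_space_times_cosh[OF g_L] unfolding scaled_def by blast
  then obtain Kg where Kg: "\<And>i. i < n \<Longrightarrow> 0 \<le> Kg i" "\<And>i z. i < n \<Longrightarrow> z \<in> strip d \<Longrightarrow> norm (scaled (g i) z) \<le> Kg i * omega gam (Re z)"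
    by metis
  have "\<exists>K. i < n \<longrightarrow> j < n \<longrightarrow> 0 \<le> K \<and> (\<forall>z\<in>strip d. norm (scaled (k i j) z) \<le> K * omega gam (Re z))" for i j
    using L_space_times_cosh[OF k_L] unfolding scaled_def by blast
  then obtain Kk where Kk: "\<And>i j. i < n \<Longrightarrow> j < n \<Longrightarrow> 0 \<le> Kk i j"
    "\<And>i j z. i < n \<Longrightarrow> j < n \<Longrightarrow> z \<in> strip d \<Longrightarrow> norm (scaled (k i j) z) \<le> Kk i j * omega gam (Re z)"
    by metis
  define M where "M = (\<Sum>i<n. Kg i) + (\<Sum>i<n. \<Sum>j<n. Kk i j)"
  have sums: "0 \<le> (\<Sum>i<n. Kg i)" "0 \<le> (\<Sum>i<n. \<Sum>j<n. Kk i j)"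
    using Kg(1) Kk(1) by (auto intro!: sum_nonneg)
  have g_le: "Kg i \<le> M" if "i < n" for i
    using member_le_sum[of i "{..<n}" Kg] Kg(1) that sums by (simp add: M_def)
  have k_le: "Kk i j \<le> M" if "i < n" "j < n" for i j
  proof -
    have "Kk i j \<le> (\<Sum>j<n. Kk i j)" using member_le_sum[of j "{..<n}" "Kk i"] Kk(1) that by simp
    also have "\<dots> \<le> (\<Sum>i<n. \<Sum>j<n. Kk i j)"
      by (rule member_le_sum) (use Kk(1) that in \<open>auto intro: sum_nonneg\<close>)
    finally show ?thesis using sums by (simp add: M_def)
  qed
  have "0 \<le> M" using sums by (simp add: M_def)
  thus ?thesis
    using order_trans[OF Kg(2) mult_right_mono[OF g_le omega_nonneg]] order_trans[OF Kk(2) mult_right_mono[OF k_le omega_nonneg]]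
    by (intro exI[of _ M] conjI allI impI ballI)
qed

lemma y_continuous: "i < n \<Longrightarrow> continuous_on {a..b} (y i)"
  using ivp by (simp add: ivp_solution_def)

text \<open>The initial value is contained in the integral equation at t = a, where the interval
  shrinks to a point.\<close>

lemma y_start: "i < n \<Longrightarrow> y i a = r $ i"
proof -
  assume "i < n"
  hence "\<forall>t\<in>{a..b}. ((\<lambda>s. on_interval a b (g i) s + (\<Sum>j<n. on_interval a b (k i j) s * y j s)) has_integral (y i t - r $ i)) {a..t}"
    using ivp unfolding ivp_solution_def by blast
  from bspec[OF this, of a] ab
  have "((\<lambda>s. on_interval a b (g i) s + (\<Sum>j<n. on_interval a b (k i j) s * y j s)) has_integral (y i a - r $ i)) {a}" by simp
  from has_integral_unique[OF this has_integral_refl(2)] show "y i a = r $ i" by simp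
qed

text \<open>The hypothesis concerns f Q only; on the real line f is recovered from
  \<open>scaled f\<close> by dividing by \<open>dpsi\<close>, which has no zeros.\<close>

lemma coefficient_continuous:
  assumes "(\<lambda>\<zeta>. f \<zeta> * Q_fun a b (psi_DE a b \<zeta>)) \<in> L_space a b d \<alpha>"
  shows "continuous_on {a<..<b} (on_interval a b f)"
proof -
  have "continuous_on UNIV (\<lambda>x. scaled f (of_real x))"
    by (intro continuous_on_compose2[OF holomorphic_on_imp_continuous_on[OF scaled_holomorphic[OF assms]]] continuous_intros)
      (use d_pos in \<open>auto simp: strip_def\<close>)
  moreover have dpsi0: "dpsi x \<noteq> 0" for x using ab by (simp add: dpsi_def)
  moreover have "f (of_real x) = scaled f (of_real x) / of_real (dpsi x)" for x
    using dpsi0[of x] by (simp add: scaled_of_real)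
  moreover have "continuous_on UNIV (\<lambda>x. of_real (dpsi x) :: complex)"
    unfolding dpsi_def by (intro continuous_intros) auto
  ultimately have f: "continuous_on UNIV (\<lambda>x::real. f (of_real x))"
    by (simp only:) (intro continuous_on_divide, auto)
  have "continuous_on {a<..<b} (phi_DE a b)"
  proof -
    have "continuous_on {a<..<b} (\<lambda>t. (2 * t - b - a) / (b - a))"
      using ab by (intro continuous_intros) auto
    moreover have "(2 * t - b - a) / (b - a) \<in> {- 1<..<1}" if "t \<in> {a<..<b}" for t
      using that ab by (auto simp: field_simps)
    ultimately show ?thesis
      unfolding phi_DE_def by (intro continuous_on_arsinh' continuous_on_mult_left continuous_on_artanh') auto
  qed
  thus ?thesis
    unfolding on_interval_def by (rule continuous_on_compose2[OF f]) auto
qed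

text \<open>The integrand may be singular at a and b. The fundamental theorem is therefore applied
  on a compact interval [c, e] around t inside (a, b), and the part from a to c enters as a
  constant.\<close>

lemma y_derivative:
  assumes i: "i < n" and t: "a < t" "t < b"
  shows "(y i has_vector_derivative on_interval a b (g i) t + (\<Sum>j<n. on_interval a b (k i j) t * y j t)) (at t)"
proof -
  define f where "f = (\<lambda>s. on_interval a b (g i) s + (\<Sum>j<n. on_interval a b (k i j) s * y j s))"
  have int: "(f has_integral (y i t - r $ i)) {a..t}" if "t \<in> {a..b}" for t
    using ivp i that by (simp add: ivp_solution_def f_def)
  define c where "c = (a + t) / 2"
  define e where "e = (t + b) / 2"
  have c: "a < c" "c < t" and e: "t < e" "e < b" using t by (auto simp: c_def e_def)
  have "continuous_on {a<..<b} f"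
    unfolding f_def using i
    by (intro continuous_intros coefficient_continuous k_L g_L continuous_on_subset[OF y_continuous]) auto
  hence "continuous_on {c..e} f" by (rule continuous_on_subset) (use c e in auto)
  hence "((\<lambda>t. integral {c..t} f) has_vector_derivative f t) (at t within {c..e})"
    by (rule integral_has_vector_derivative) (use c e in auto)
  hence "((\<lambda>t. integral {c..t} f) has_vector_derivative f t) (at t within {c<..<e})"
    by (rule has_vector_derivative_within_subset) auto
  moreover have "at t within {c<..<e} = at t"
    by (rule at_within_open) (use c e in auto)
  ultimately have D: "((\<lambda>t. integral {c..t} f) has_vector_derivative f t) (at t)"
    by (simp only:)
  have eq: "y i s = y i c + integral {c..s} f" if s: "s \<in> {c<..<e}" for s
  proof -
    have "f integrable_on {a..s}" using int[of s] s c e by (auto simp: has_integral_integrable)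
    hence "integral {a..c} f + integral {c..s} f = integral {a..s} f"
      using s c by (intro Henstock_Kurzweil_Integration.integral_combine) auto
    moreover have "integral {a..c} f = y i c - r $ i" "integral {a..s} f = y i s - r $ i"
      using int[of c] int[of s] s c e by (auto simp: integral_unique)
    ultimately show ?thesis by (simp add: algebra_simps)
  qed
  have "((\<lambda>t. y i c + integral {c..t} f) has_vector_derivative f t) (at t)"
    using has_vector_derivative_add[OF has_vector_derivative_const D] by simp
  hence "(y i has_vector_derivative f t) (at t)"
    by (rule has_vector_derivative_transform_within_open[where S = "{c<..<e}"]) (use eq c e in auto)
  thus ?thesis by (simp add: f_def)
qed

lemma y_psi_derivative:
  assumes i: "i < n"
  shows "((\<lambda>x. y i (psi_DE a b x)) has_vector_derivative
     scaled (g i) (of_real x) + (\<Sum>j<n. scaled (k i j) (of_real x) * y j (psi_DE a b x))) (at x)"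
proof -
  let ?t = "psi_DE a b x"
  have t: "a < ?t" "?t < b" using psi_DE_in_interval[OF ab] by auto
  have "(psi_DE a b has_vector_derivative dpsi x) (at x)"
    using has_real_derivative_psi_DE[of a b x] by (simp add: dpsi_def has_real_derivative_iff_has_vector_derivative)
  from vector_diff_chain_at[OF this y_derivative[OF i t]]
  have "((\<lambda>x. y i (psi_DE a b x)) has_vector_derivative
      dpsi x *\<^sub>R (on_interval a b (g i) ?t + (\<Sum>j<n. on_interval a b (k i j) ?t * y j ?t))) (at x)"
    by (simp add: o_def)
  also have "dpsi x *\<^sub>R (on_interval a b (g i) ?t + (\<Sum>j<n. on_interval a b (k i j) ?t * y j ?t))
      = scaled (g i) (of_real x) + (\<Sum>j<n. scaled (k i j) (of_real x) * y j ?t)"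
    by (simp add: scaled_of_real on_interval_def phi_psi[OF ab] scaleR_conv_of_real distrib_left sum_distrib_left mult_ac)
  finally show ?thesis .
qed

lemma y_psi_lim:
  assumes "i < n"
  shows "((\<lambda>x. y i (psi_DE a b x)) \<longlongrightarrow> r $ i) at_bot" "((\<lambda>x. y i (psi_DE a b x)) \<longlongrightarrow> y i b) at_top"
proof -
  have in_ab: "\<forall>\<^sub>F x in F. psi_DE a b x \<in> {a..b}" for F :: "real filter"
    using psi_DE_in_interval[OF ab] by (intro always_eventually) (auto intro: less_imp_le)
  show "((\<lambda>x. y i (psi_DE a b x)) \<longlongrightarrow> r $ i) at_bot"
    using continuous_on_tendsto_compose[OF y_continuous[OF assms] psi_DE_at_bot _ in_ab] ab y_start[OF assms] by simp
  show "((\<lambda>x. y i (psi_DE a b x)) \<longlongrightarrow> y i b) at_top"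
    using continuous_on_tendsto_compose[OF y_continuous[OF assms] psi_DE_at_top _ in_ab] ab by simp
qed

lemma analytic_solution:
  "\<exists>u F K. 0 \<le> K \<and> (\<forall>i<n. (\<forall>x. u i (of_real x) = y i (psi_DE a b x)) \<and>
     F i holomorphic_on strip d \<and>
     (\<forall>z\<in>strip d. (u i has_field_derivative F i z) (at z) \<and> norm (F i z) \<le> K * omega gam (Re z) \<and>
        norm (u i z) \<le> K \<and> (Re z \<le> 0 \<longrightarrow> norm (u i z - r $ i) \<le> K * omega gam (Re z)) \<and>
        (0 \<le> Re z \<longrightarrow> norm (u i z - y i b) \<le> K * omega gam (Re z))) \<and>
     (\<forall>x. F i (of_real x) = scaled (g i) (of_real x) + (\<Sum>j<n. scaled (k i j) (of_real x) * u j (of_real x))))"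
proof -
  obtain M where M: "0 \<le> M"
    "\<And>i j z. i < n \<Longrightarrow> j < n \<Longrightarrow> z \<in> strip d \<Longrightarrow> norm (scaled (k i j) z) \<le> M * omega gam (Re z)"
    "\<And>i z. i < n \<Longrightarrow> z \<in> strip d \<Longrightarrow> norm (scaled (g i) z) \<le> M * omega gam (Re z)"
    using uniform_bound by blast
  have M_omega: "M * omega gam x \<le> M / (cosh x)\<^sup>2" for x
    using mult_left_mono[OF omega_le_inverse_cosh_square M(1), of gam x] gam_pos by simp
  have holo_k: "\<And>i j. i < n \<Longrightarrow> j < n \<Longrightarrow> scaled (k i j) holomorphic_on strip d"
    and holo_g: "\<And>i. i < n \<Longrightarrow> scaled (g i) holomorphic_on strip d"
    by (intro scaled_holomorphic k_L g_L; assumption)+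
  note bound_k = order_trans[OF M(2) M_omega] and bound_g = order_trans[OF M(3) M_omega]
  interpret ode: strip_ode d M n "\<lambda>i j. scaled (k i j)" "\<lambda>i. scaled (g i)" "\<lambda>i. r $ i"
    by unfold_locales (use d_pos M(1) holo_k holo_g bound_k bound_g in simp_all)
  obtain u U where U: "0 \<le> U"
    and u_lim: "\<And>i. i < n \<Longrightarrow> ((\<lambda>x. u i (of_real x)) \<longlongrightarrow> r $ i) at_bot"
    and u_bound: "\<And>i z. i < n \<Longrightarrow> z \<in> strip d \<Longrightarrow> norm (u i z) \<le> U"
    and u_deriv: "\<And>i z. i < n \<Longrightarrow> z \<in> strip d \<Longrightarrow>
      (u i has_field_derivative scaled (g i) z + (\<Sum>j<n. scaled (k i j) z * u j z)) (at z)"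
    using ode.solution_exists by blast
  define F where "F = (\<lambda>i z. scaled (g i) z + (\<Sum>j<n. scaled (k i j) z * u j z))"
  define K where "K = M * (1 + real n * U) + U"
  have K: "0 \<le> K" "M * (1 + real n * U) \<le> K" "U \<le> K" using M U by (simp_all add: K_def)
  have u_deriv': "(u i has_field_derivative F i z) (at z)" if "i < n" "z \<in> strip d" for i z
    unfolding F_def using u_deriv[OF that] .
  have u_holo: "u i holomorphic_on strip d" if "i < n" for i
    using u_deriv[OF that] by (auto simp: holomorphic_on_open[OF open_strip])
  have F_holo: "F i holomorphic_on strip d" if "i < n" for i
    unfolding F_def using that by (intro holomorphic_intros scaled_holomorphic k_L g_L u_holo) auto
  have F_bound: "norm (F i z) \<le> K * omega gam (Re z)" if "i < n" "z \<in> strip d" for i z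
  proof -
    have "norm (\<Sum>j<n. scaled (k i j) z * u j z) \<le> (\<Sum>j<n. M * omega gam (Re z) * U)"
      by (intro sum_norm_le, unfold norm_mult, intro mult_mono) (use that M u_bound omega_nonneg in auto)
    hence "norm (F i z) \<le> M * omega gam (Re z) + (\<Sum>j<n. M * omega gam (Re z) * U)"
      unfolding F_def using that by (intro norm_triangle_mono M)
    also have "\<dots> = M * (1 + real n * U) * omega gam (Re z)" by (simp add: algebra_simps)
    also have "\<dots> \<le> K * omega gam (Re z)" using K omega_nonneg by (intro mult_right_mono)
    finally show ?thesis .
  qed
  \<comment> \<open>Both functions solve the same linear system on the real line with limit r at
    minus infinity; their difference solves the homogeneous one, where uniqueness applies.\<close>
  have u_y: "u i (of_real x) = y i (psi_DE a b x)" if i: "i < n" for i x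
  proof -
    have "u i (of_real x) - y i (psi_DE a b x) = 0"
    proof (rule linear_ode_zero[where n = n and e = "\<lambda>i x. u i (of_real x) - y i (psi_DE a b x)" and A = "\<lambda>i j x. scaled (k i j) (of_real x)" and M = M])
      fix i x assume i: "i < n"
      have "((\<lambda>x. u i (of_real x)) has_vector_derivative F i (of_real x)) (at x)"
        unfolding F_def using i d_pos by (intro has_vector_derivative_real_field u_deriv) (auto simp: strip_def)
      from has_vector_derivative_diff[OF this y_psi_derivative[OF i]]
      show "((\<lambda>x. u i (of_real x) - y i (psi_DE a b x)) has_vector_derivative
          (\<Sum>j<n. scaled (k i j) (of_real x) * (u j (of_real x) - y j (psi_DE a b x)))) (at x)"
        by (simp add: F_def right_diff_distrib sum_subtractf)
    next
      fix i j x assume "i < n" "j < n"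
      thus "norm (scaled (k i j) (of_real x)) \<le> M / (cosh x)\<^sup>2"
        using M(2)[of i j "of_real x"] M_omega[of x] d_pos by (simp add: strip_def)
    next
      fix i assume "i < n"
      from tendsto_diff[OF u_lim[OF this] y_psi_lim(1)[OF this]]
      show "((\<lambda>x. u i (of_real x) - y i (psi_DE a b x)) \<longlongrightarrow> 0) at_bot" by simp
    qed fact
    thus ?thesis by simp
  qed
  have left: "norm (u i z - r $ i) \<le> K * omega gam (Re z)" if "i < n" "z \<in> strip d" "Re z \<le> 0" for i z
    using left_endpoint_decay[OF u_deriv'[OF that(1)] u_lim[OF that(1)] F_bound[OF that(1)] K(1)] gam_pos that(2,3)
    by (simp add: less_imp_le)
  \<comment> \<open>Decay towards some limit s comes from reflection. On the real line
    \<open>u\<close> coincides with y after the transformation, and continuity of y at b identifies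
    s with y(b).\<close>
  have right: "norm (u i z - y i b) \<le> K * omega gam (Re z)" if i: "i < n" and z: "z \<in> strip d" "0 \<le> Re z" for i z
  proof -
    obtain s where s: "\<And>z. z \<in> strip d \<Longrightarrow> 0 \<le> Re z \<Longrightarrow> norm (u i z - s) \<le> K * omega gam (Re z)"
      using right_endpoint_decay[OF d_pos F_holo[OF i] u_deriv'[OF i] F_bound[OF i] K(1)] gam_pos
      by (meson less_imp_le)
    have "((\<lambda>x. 1 / (cosh x)\<^sup>2) \<longlongrightarrow> (0::real)) at_top"
      using tendsto_inverse_cosh_square_at_bot unfolding at_bot_mirror filterlim_filtermap by simp
    hence K_lim: "((\<lambda>x. K * (1 / (cosh x)\<^sup>2)) \<longlongrightarrow> 0) at_top" by (rule tendsto_mult_right_zero)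
    have "\<forall>\<^sub>F x in at_top. norm (u i (of_real x) - s) \<le> K * (1 / (cosh x)\<^sup>2)"
    proof (rule eventually_at_top_linorderI)
      fix x :: real assume "0 \<le> x"
      hence "norm (u i (of_real x) - s) \<le> K * omega gam x" using s[of "of_real x"] d_pos by (simp add: strip_def)
      thus "norm (u i (of_real x) - s) \<le> K * (1 / (cosh x)\<^sup>2)"
        using mult_left_mono[OF omega_le_inverse_cosh_square K(1), of gam x] gam_pos by simp
    qed
    hence "((\<lambda>x. u i (of_real x) - s) \<longlongrightarrow> 0) at_top"
      by (rule Lim_null_comparison) (rule K_lim)
    hence "((\<lambda>x. u i (of_real x)) \<longlongrightarrow> s) at_top" by (simp add: LIM_zero_iff)
    moreover have "((\<lambda>x. u i (of_real x)) \<longlongrightarrow> y i b) at_top"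
      using y_psi_lim(2)[OF i] by (simp add: u_y[OF i])
    ultimately have "s = y i b" by (rule tendsto_unique[OF trivial_limit_at_top_linorder])
    thus ?thesis using s z by simp
  qed
  have u_K: "norm (u i z) \<le> K" if "i < n" "z \<in> strip d" for i z
    using u_bound[OF that] K(3) by linarith
  show ?thesis
    by (intro exI[of _ u] exI[of _ F] exI[of _ K] conjI allI impI ballI)
      (use K(1) u_y F_holo u_deriv F_bound u_K left right in \<open>simp_all add: F_def\<close>)
qed

end

section \<open>Stability of the discrete system\<close>

text \<open>Split at distance m = sqrt(2N + 1): at most 2m + 1 near terms are bounded by 1, and all
  far terms together by (2N + 1)/m = m. A logarithmic bound would be sharper, but the square root
  suffices as h sqrt N tends to 0.\<close>

lemma sum_inverse_distance_le:
  fixes v :: real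
  shows "(\<Sum>j = - int N..int N. 1 / (1 + \<bar>v - of_int j\<bar>)) \<le> 4 * sqrt (2 * real N + 1)"
proof -
  define m where "m = sqrt (2 * real N + 1)"
  define S where "S = {- int N..int N}"
  define near where "near = {j \<in> S. \<bar>v - of_int j\<bar> < m}"
  have m: "1 \<le> m" "m * m = 2 * real N + 1" by (simp_all add: m_def)
  have fin: "finite S" "near \<subseteq> S" by (auto simp: S_def near_def)
  have card_near: "real (card near) \<le> 2 * m + 1"
  proof -
    have "near \<subseteq> {\<lceil>v - m\<rceil>..\<lfloor>v + m\<rfloor>}"
      by (auto simp: near_def abs_less_iff le_floor_iff ceiling_le_iff)
    hence "card near \<le> card {\<lceil>v - m\<rceil>..\<lfloor>v + m\<rfloor>}" by (intro card_mono) auto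
    also have "\<dots> = nat (\<lfloor>v + m\<rfloor> - \<lceil>v - m\<rceil> + 1)" by simp
    finally have "real (card near) \<le> max 0 (of_int (\<lfloor>v + m\<rfloor> - \<lceil>v - m\<rceil> + 1))" by simp
    also have "\<dots> \<le> 2 * m + 1" using m by simp linarith
    finally show ?thesis .
  qed
  have "(\<Sum>j\<in>S. 1 / (1 + \<bar>v - of_int j\<bar>)) = (\<Sum>j\<in>S - near. 1 / (1 + \<bar>v - of_int j\<bar>)) + (\<Sum>j\<in>near. 1 / (1 + \<bar>v - of_int j\<bar>))"
    using fin by (intro sum.subset_diff)
  also have "\<dots> \<le> (\<Sum>j\<in>S - near. 1 / m) + (\<Sum>j\<in>near. 1)"
    using m by (intro add_mono sum_mono) (auto simp: near_def intro!: frac_le)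
  also have "\<dots> \<le> (\<Sum>j\<in>S. 1 / m) + (\<Sum>j\<in>near. 1)"
    using fin m by (intro add_right_mono sum_mono2) auto
  also have "(\<Sum>j\<in>S. 1 / m) = m"
  proof -
    have "(\<Sum>j\<in>S. 1 / m) = (2 * real N + 1) / m" by (simp add: S_def)
    also have "\<dots> = m" unfolding m(2)[symmetric] using m(1) by simp
    finally show ?thesis .
  qed
  also have "m + (\<Sum>j\<in>near. 1) \<le> 4 * m" using card_near m by simp
  finally show ?thesis by (simp add: S_def m_def)
qed

lemma abs_sinc_basis_le: "\<bar>sinc_basis j h x\<bar> \<le> 2 / (1 + \<bar>x / h - of_int j\<bar>)"
proof -
  define t where "t = x / h - of_int j"
  have eq: "sinc_basis j h x = sinc (pi * t)" by (simp add: sinc_basis_def t_def)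
  show ?thesis
  proof (cases "\<bar>t\<bar> \<le> 1")
    case True
    have "\<bar>sinc_basis j h x\<bar> \<le> 1" by (rule abs_sinc_basis_le_1)
    also have "1 \<le> 2 / (1 + \<bar>t\<bar>)" using True by (simp add: field_simps)
    finally show ?thesis by (simp add: t_def)
  next
    case False
    hence t: "1 < \<bar>t\<bar>" by simp
    hence "\<bar>sinc_basis j h x\<bar> = \<bar>sin (pi * t)\<bar> / (pi * \<bar>t\<bar>)"
      unfolding eq by (auto simp: abs_mult)
    also have "\<dots> \<le> 1 / (1 * \<bar>t\<bar>)"
      using t pi_gt3 by (intro frac_le mult_right_mono) auto
    also have "\<dots> \<le> 2 / (1 + \<bar>t\<bar>)" using t by (simp add: field_simps)
    finally show ?thesis by (simp add: t_def)
  qed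
qed

lemma lebesgue_constant_le: "(\<Sum>j = - int N..int N. \<bar>sinc_basis j h x\<bar>) \<le> 8 * sqrt (2 * real N + 1)"
proof -
  have "(\<Sum>j = - int N..int N. \<bar>sinc_basis j h x\<bar>) \<le> (\<Sum>j = - int N..int N. 2 * (1 / (1 + \<bar>x / h - of_int j\<bar>)))"
    using abs_sinc_basis_le by (intro sum_mono) (simp only: mult_1_right times_divide_eq_right)
  also have "\<dots> = 2 * (\<Sum>j = - int N..int N. 1 / (1 + \<bar>x / h - of_int j\<bar>))"
    by (simp only: sum_distrib_left)
  also have "\<dots> \<le> 2 * (4 * sqrt (2 * real N + 1))"
    by (intro mult_left_mono sum_inverse_distance_le) simp
  finally show ?thesis by simp
qed

text \<open>The product solves the discrete Gronwall recursion with equality.\<close>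

lemma telescoping_prod: "1 + (\<Sum>q<p. c q * (\<Prod>s<q. 1 + c s)) = (\<Prod>q<p. 1 + c q)"
  for c :: "nat \<Rightarrow> real"
  by (induction p) (simp_all add: algebra_simps)

lemma sum_nodes: "(\<Sum>p<2 * N + 1. f (node N p)) = (\<Sum>q = - int N..int N. f q)"
  by (rule sum.reindex_bij_witness[of _ "\<lambda>q. nat (q + int N)" "node N"]) (auto simp: node_def)

text \<open>Used twice: with R = 0 it gives injectivity of the system matrix, and with the
  integration residual it gives the error at the sampling points. The final constant is independent
  of N and h.\<close>

lemma stability:
  fixes e \<rho> :: "nat \<Rightarrow> nat \<Rightarrow> complex"
  assumes eqn: "\<And>i p. i < n \<Longrightarrow> p < 2 * N + 1 \<Longrightarrow> e i p = \<rho> i p +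
        of_real h * (\<Sum>q<2 * N + 1. of_real (sigma (node N p - node N q)) * (\<Sum>j<n. A i j q * e j q))"
    and A: "\<And>i j q. i < n \<Longrightarrow> j < n \<Longrightarrow> norm (A i j q) \<le> K / (cosh (of_int (node N q) * h))\<^sup>2"
    and \<rho>: "\<And>i p. i < n \<Longrightarrow> p < 2 * N + 1 \<Longrightarrow> norm (\<rho> i p) \<le> R"
    and K: "0 \<le> K" and h: "0 < h" "h \<le> 1"
    and small: "exp (3 * real n * K) * (4 * real n * K) * (h * sqrt (2 * real N + 1)) \<le> 1 / 2"
    and ip: "i < n" "p < 2 * N + 1"
  shows "norm (e i p) \<le> 2 * exp (3 * real n * K) * R"
proof -
  \<comment> \<open>\<open>\<Gamma>\<close> is the Gronwall factor; replacing \<open>\<sigma>\<close> by the Heaviside function costs a multiple of \<open>h \<surd>N E\<close>, absorbed by \<open>small\<close>.\<close>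
  define E where "E = Max ((\<lambda>(i, p). norm (e i p)) ` ({..<n} \<times> {..<2 * N + 1}))"
  define c where "c = (\<lambda>q. h * real n * K / (cosh (of_int (node N q) * h))\<^sup>2)"
  define \<eta> where "\<eta> = R + h * (real n * K * E) * (4 * sqrt (2 * real N + 1))"
  define \<Gamma> where "\<Gamma> = exp (3 * real n * K)"
  have E_ge: "norm (e i p) \<le> E" if "i < n" "p < 2 * N + 1" for i p
    unfolding E_def using that by (intro Max_ge) auto
  have E0: "0 \<le> E" using E_ge[OF ip] norm_ge_zero order_trans by blast
  have R0: "0 \<le> R" using \<rho>[OF ip] norm_ge_zero order_trans by blast
  have c0: "0 \<le> c q" for q using h K by (simp add: c_def)
  have \<eta>0: "0 \<le> \<eta>" using E0 R0 h K by (simp add: \<eta>_def)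
  \<comment> \<open>Strong induction over the row p: the strict step lets only rows q < p
    contribute, and everything else has been put into \<eta>.\<close>
  have claim: "p < 2 * N + 1 \<Longrightarrow> i < n \<Longrightarrow> norm (e i p) \<le> \<eta> * (\<Prod>q<p. 1 + c q)" for i p
  proof (induction p arbitrary: i rule: less_induct)
    case (less p i)
    define s where "s = (\<lambda>q. \<Sum>j<n. A i j q * e j q)"
    define \<mu> where "\<mu> = (\<lambda>q. 1 / (cosh (of_int (node N q) * h))\<^sup>2)"
    have \<mu>: "0 \<le> \<mu> q" "\<mu> q \<le> 1" for q
      using cosh_real_ge_1 by (auto simp: \<mu>_def one_le_power)
    have s_le: "norm (s q) \<le> real n * (K * \<mu> q * B)" if "\<And>j. j < n \<Longrightarrow> norm (e j q) \<le> B" "0 \<le> B" for q B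
    proof -
      have "norm (s q) \<le> (\<Sum>j<n. K * \<mu> q * B)"
        unfolding s_def by (intro sum_norm_le, unfold norm_mult, intro mult_mono)
          (use that A[OF less.prems(2), of _ q] K \<mu> in \<open>auto simp: \<mu>_def\<close>)
      thus ?thesis by simp
    qed
    have summand: "norm (of_real (sigma (node N p - node N q)) * s q)
        \<le> of_bool (q < p) * norm (s q) + real n * K * E * (1 / (1 + \<bar>of_int (node N p) - of_int (node N q)\<bar>))"
      if q: "q < 2 * N + 1" for q
    proof -
      let ?k = "node N p - node N q"
      have "norm (s q) \<le> real n * (K * \<mu> q * E)"
        by (rule s_le) (use E_ge q E0 in auto)
      also have "\<dots> \<le> real n * (K * 1 * E)"
        using \<mu> K E0 by (intro mult_left_mono mult_right_mono) auto
      finally have sE: "norm (s q) \<le> real n * K * E" by simp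
      \<comment> \<open>The step part keeps the actual size of s(q) for the recursion; the remainder
        part replaces it by the global maximum E.\<close>
      have "\<bar>sigma ?k\<bar> \<le> of_bool (?k > 0) + 1 / (1 + \<bar>of_int ?k\<bar>)"
        using sigma_close_to_step[of ?k] abs_triangle_ineq[of "sigma ?k - of_bool (?k > 0)" "of_bool (?k > 0)"]
        by simp
      hence "\<bar>sigma ?k\<bar> * norm (s q) \<le> (of_bool (?k > 0) + 1 / (1 + \<bar>of_int ?k\<bar>)) * norm (s q)"
        by (rule mult_right_mono) simp
      also have "\<dots> = of_bool (?k > 0) * norm (s q) + 1 / (1 + \<bar>of_int ?k\<bar>) * norm (s q)"
        by (rule distrib_right)
      also have "\<dots> \<le> of_bool (?k > 0) * norm (s q) + 1 / (1 + \<bar>of_int ?k\<bar>) * (real n * K * E)"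
        using sE by (intro add_left_mono mult_left_mono) auto
      finally show ?thesis
        unfolding norm_mult norm_of_real by (simp add: node_def mult_ac)
    qed
    have "norm (e i p) \<le> norm (\<rho> i p) + h * norm (\<Sum>q<2 * N + 1. of_real (sigma (node N p - node N q)) * s q)"
      unfolding eqn[OF less.prems(2,1)] s_def using h
      by (intro order_trans[OF norm_triangle_ineq]) (simp add: norm_mult)
    also have "norm (\<Sum>q<2 * N + 1. of_real (sigma (node N p - node N q)) * s q)
        \<le> (\<Sum>q<2 * N + 1. of_bool (q < p) * norm (s q) + real n * K * E * (1 / (1 + \<bar>of_int (node N p) - of_int (node N q)\<bar>)))"
      using summand by (intro sum_norm_le) auto
    also have "\<dots> = (\<Sum>q<2 * N + 1. of_bool (q < p) * norm (s q))
        + real n * K * E * (\<Sum>q<2 * N + 1. 1 / (1 + \<bar>of_int (node N p) - of_int (node N q)\<bar>))"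
      by (simp only: sum.distrib sum_distrib_left)
    also have "(\<Sum>q<2 * N + 1. of_bool (q < p) * norm (s q)) = (\<Sum>q<p. norm (s q))"
      by (rule sum.mono_neutral_cong_right) (use less.prems in auto)
    also have "(\<Sum>q<2 * N + 1. 1 / (1 + \<bar>of_int (node N p) - of_int (node N q)\<bar>))
        = (\<Sum>q = - int N..int N. 1 / (1 + \<bar>of_int (node N p) - of_int q\<bar>))"
      by (rule sum_nodes)
    also have "\<dots> \<le> 4 * sqrt (2 * real N + 1)" by (rule sum_inverse_distance_le)
    finally have "norm (e i p) \<le> norm (\<rho> i p) + h * ((\<Sum>q<p. norm (s q)) + real n * K * E * (4 * sqrt (2 * real N + 1)))"
      using h K E0 by (simp add: mult_left_mono)
    also have "\<dots> \<le> \<eta> + (\<Sum>q<p. h * norm (s q))"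
      using \<rho>[OF less.prems(2,1)] by (simp add: \<eta>_def sum_distrib_left algebra_simps)
    also have "(\<Sum>q<p. h * norm (s q)) \<le> (\<Sum>q<p. c q * (\<eta> * (\<Prod>s<q. 1 + c s)))"
    proof (rule sum_mono)
      fix q assume q: "q \<in> {..<p}"
      have "0 \<le> (\<Prod>s<q. 1 + c s)" using c0 by (intro prod_nonneg) (auto intro: add_nonneg_nonneg)
      hence "norm (s q) \<le> real n * (K * \<mu> q * (\<eta> * (\<Prod>s<q. 1 + c s)))"
        using \<eta>0 q less.prems by (intro s_le less.IH mult_nonneg_nonneg) auto
      from mult_left_mono[OF this, of h] show "h * norm (s q) \<le> c q * (\<eta> * (\<Prod>s<q. 1 + c s))"
        using h by (simp add: c_def \<mu>_def mult_ac)
    qed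
    also have "\<eta> + (\<Sum>q<p. c q * (\<eta> * (\<Prod>s<q. 1 + c s))) = \<eta> * (1 + (\<Sum>q<p. c q * (\<Prod>s<q. 1 + c s)))"
      by (simp add: distrib_left sum_distrib_left mult_ac)
    also have "\<dots> = \<eta> * (\<Prod>q<p. 1 + c q)" by (simp only: telescoping_prod)
    finally show ?case by simp
  qed
  \<comment> \<open>A Riemann sum of 1/cosh^2, whose integral is 2; the central term adds h \<le> 1,
    hence the 3.\<close>
  have sum_c: "(\<Sum>q<2 * N + 1. c q) \<le> 3 * real n * K"
  proof -
    have "(\<Sum>q<2 * N + 1. c q) = (\<Sum>q = - int N..int N. h * real n * K / (cosh (of_int q * h))\<^sup>2)"
      unfolding c_def by (rule sum_nodes)
    also have "\<dots> = real n * K * (h * (\<Sum>q = - int N..int N. 1 / (cosh (of_int q * h))\<^sup>2))"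
      by (simp add: sum_distrib_left mult_ac)
    also have "\<dots> \<le> real n * K * (h + 2)"
      using K by (intro mult_left_mono sum_inverse_cosh_square_le h) auto
    also have "\<dots> \<le> real n * K * 3" using K h by (intro mult_left_mono) auto
    finally show ?thesis by simp
  qed
  have bound: "norm (e i p) \<le> \<Gamma> * \<eta>" if "i < n" "p < 2 * N + 1" for i p
  proof -
    have "(\<Prod>q<p. 1 + c q) \<le> (\<Prod>q<p. exp (c q))"
      using c0 by (intro prod_mono) (auto intro: add_nonneg_nonneg)
    also have "\<dots> = exp (\<Sum>q<p. c q)" by (simp add: exp_sum)
    also have "(\<Sum>q<p. c q) \<le> (\<Sum>q<2 * N + 1. c q)"
      using that c0 by (intro sum_mono2) auto
    also have "\<dots> \<le> 3 * real n * K" by (rule sum_c)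
    finally have "(\<Prod>q<p. 1 + c q) \<le> \<Gamma>" unfolding \<Gamma>_def by simp
    from mult_left_mono[OF this \<eta>0] claim[OF that(2,1)] show ?thesis by (simp add: mult.commute)
  qed
  have "E \<le> \<Gamma> * \<eta>"
    unfolding E_def using ip bound by (subst Max_le_iff) auto
  also have "\<dots> = \<Gamma> * R + \<Gamma> * (4 * real n * K) * (h * sqrt (2 * real N + 1)) * E"
    by (simp add: \<eta>_def algebra_simps)
  also have "\<dots> \<le> \<Gamma> * R + 1 / 2 * E"
    using small E0 by (intro add_left_mono mult_right_mono) (auto simp: \<Gamma>_def)
  finally have "E \<le> 2 * \<Gamma> * R" by simp
  thus ?thesis using E_ge[OF ip] by (simp add: \<Gamma>_def)
qed

section \<open>Asymptotics of the step size\<close>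

lemma step_size_pos_asymp:
  assumes "0 < d" "0 < \<alpha>" "0 < c"
  shows "\<forall>\<^sub>F N in sequentially. 0 < step_size d \<alpha> N \<and> step_size d \<alpha> N < c \<and> 1 / step_size d \<alpha> N \<le> real N"
proof -
  define e where "e = 2 * d / \<alpha>"
  have e: "0 < e" using assms by (simp add: e_def)
  have h: "step_size d \<alpha> N = ln (e * real N) / real N" for N by (simp add: step_size_def e_def)
  have "\<forall>\<^sub>F N in sequentially. 0 < ln (e * real N) / real N" using e by real_asymp
  moreover have "\<forall>\<^sub>F N in sequentially. ln (e * real N) / real N < c" using e assms by real_asymp
  moreover have "\<forall>\<^sub>F N in sequentially. 1 / (ln (e * real N) / real N) \<le> real N" using e by real_asymp
  ultimately show ?thesis unfolding h by eventually_elim auto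
qed

lemma step_size_sqrt_asymp:
  assumes "0 < d" "0 < \<alpha>" "0 < c"
  shows "\<forall>\<^sub>F N in sequentially. step_size d \<alpha> N * sqrt (2 * real N + 1) < c"
proof -
  define e where "e = 2 * d / \<alpha>"
  have e: "0 < e" using assms by (simp add: e_def)
  have h: "step_size d \<alpha> N = ln (e * real N) / real N" for N by (simp add: step_size_def e_def)
  show ?thesis unfolding h using e assms by real_asymp
qed

text \<open>As N h = log(2 d N/alpha), sinh(N h) grows linearly in N, whereas N/log N is sublinear;
  so powers of N can be afforded. The square is room for the factors 1/h and sqrt N that occur
  later.\<close>

lemma tail_asymp:
  assumes "0 < d" "0 < \<alpha>" "0 < \<gamma>"
  shows "\<forall>\<^sub>F N in sequentially. exp (- \<gamma> * sinh (real N * step_size d \<alpha> N)) * (real N + 1)\<^sup>2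
      \<le> exp (- pi * d * real N / ln (2 * d * real N / \<alpha>))"
proof -
  define e where "e = 2 * d / \<alpha>"
  define m where "m = pi * d"
  have e: "0 < e" "0 < m" using assms by (simp_all add: e_def m_def)
  have "\<forall>\<^sub>F N in sequentially. exp (- \<gamma> * ((e * real N - inverse (e * real N)) / 2)) * (real N + 1)\<^sup>2
      \<le> exp (- (m * real N / ln (e * real N)))"
    using e assms by real_asymp
  moreover have "\<forall>\<^sub>F N in sequentially. (0::nat) < N" by (rule eventually_gt_at_top)
  ultimately show ?thesis
  proof eventually_elim
    case (elim N)
    have "real N * step_size d \<alpha> N = ln (e * real N)"
      using elim by (simp add: step_size_def e_def)
    moreover have "sinh (ln (e * real N)) = (e * real N - inverse (e * real N)) / 2"
      using e elim by (intro sinh_ln_real) auto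
    moreover have "- pi * d * real N / ln (2 * d * real N / \<alpha>) = - (m * real N / ln (e * real N))"
      by (simp add: m_def e_def)
    ultimately show ?case using elim(1) by (simp only:)
  qed
qed

section \<open>The linear system and the error estimate\<close>

lemma block_index_less: "i < n \<Longrightarrow> p < m \<Longrightarrow> i * m + p < n * (m::nat)"
proof -
  assume "i < n" "p < m"
  hence "i * m + p < Suc i * m" by simp
  also have "\<dots> \<le> n * m" using \<open>i < n\<close> by (intro mult_right_mono) auto
  finally show ?thesis .
qed

lemma block_index_div_mod: "p < m \<Longrightarrow> (i * m + p) div m = i" "p < m \<Longrightarrow> (i * m + p) mod m = (p::nat)"
  by simp_all

lemma block_index_cases:
  assumes "P < n * (m::nat)"
  obtains i p where "i < n" "p < m" "P = i * m + p"
proof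
  have "0 < m" using assms by (cases m) auto
  thus "P div m < n" "P mod m < m" using assms by (auto simp: less_mult_imp_div_less)
  show "P = P div m * m + P mod m" by simp
qed

lemma sum_blocks: "(\<Sum>P<n * m. f P) = (\<Sum>i<n. \<Sum>p<m. f (i * m + p))" for m :: nat
proof -
  have "(\<Sum>P<n * m. f P) = (\<Sum>i<n. sum f {i * m..<i * m + m})"
    by (rule sum.nat_group[symmetric])
  also have "\<dots> = (\<Sum>i<n. \<Sum>p<m. f (i * m + p))"
  proof (rule sum.cong[OF refl])
    fix i
    show "sum f {i * m..<i * m + m} = (\<Sum>p<m. f (i * m + p))"
      by (rule sum.reindex_bij_witness[of _ "\<lambda>p. i * m + p" "\<lambda>P. P - i * m"]) auto
  qed
  finally show ?thesis .
qed

lemma mat_mult_vec_blocks: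
  assumes "A \<in> carrier_mat (n * m) (n * m)" "v \<in> carrier_vec (n * m)" "P < n * m"
  shows "(A *\<^sub>v v) $ P = (\<Sum>j<n. \<Sum>q<m. A $$ (P, j * m + q) * v $ (j * m + q))"
proof -
  have "(A *\<^sub>v v) $ P = (\<Sum>Q<n * m. A $$ (P, Q) * v $ Q)"
    using assms by (simp add: scalar_prod_def atLeast0LessThan)
  thus ?thesis by (simp only: sum_blocks)
qed

lemma unique_solution_if_injective:
  fixes A :: "'a::field mat"
  assumes A: "A \<in> carrier_mat m m" and b: "b \<in> carrier_vec m"
    and inj: "\<And>v. v \<in> carrier_vec m \<Longrightarrow> A *\<^sub>v v = 0\<^sub>v m \<Longrightarrow> v = 0\<^sub>v m"
  shows "\<exists>!v. v \<in> carrier_vec m \<and> A *\<^sub>v v = b"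
proof -
  have "det A \<noteq> 0" using det_0_iff_vec_prod_zero_field[OF A] inj by blast
  from det_non_zero_imp_unit[OF A this, of "()"]
  obtain B where B: "B \<in> carrier_mat m m" "A * B = 1\<^sub>m m" "B * A = 1\<^sub>m m"
    unfolding Units_def ring_mat_simps by blast
  show ?thesis
  proof (rule ex1I[of _ "B *\<^sub>v b"])
    have "A *\<^sub>v (B *\<^sub>v b) = (A * B) *\<^sub>v b" by (rule assoc_mult_mat_vec[OF A B(1) b, symmetric])
    hence "A *\<^sub>v (B *\<^sub>v b) = b" using B b by simp
    thus "B *\<^sub>v b \<in> carrier_vec m \<and> A *\<^sub>v (B *\<^sub>v b) = b" using B b by simp
    fix v assume v: "v \<in> carrier_vec m \<and> A *\<^sub>v v = b"
    hence "B *\<^sub>v b = B *\<^sub>v (A *\<^sub>v v)" by simp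
    also have "\<dots> = (B * A) *\<^sub>v v" using assoc_mult_mat_vec[OF B(1) A, of v] v by (simp only:)
    also have "\<dots> = v" using B v by simp
    finally show "v = B *\<^sub>v b" by simp
  qed
qed

context de_ivp
begin

lemma deriv_psi: "deriv (psi_DE a b :: real \<Rightarrow> real) x = dpsi x"
  unfolding dpsi_def by (rule DERIV_imp_deriv[OF has_real_derivative_psi_DE])

lemma on_interval_sample: "on_interval a b F (sample_pt a b h j) = F (of_real (of_int j * h))"
  by (simp add: on_interval_def sample_pt_def phi_psi[OF ab])

lemma integration_mat_carrier: "integration_mat a b n h N \<in> carrier_mat (n * (2 * N + 1)) (n * (2 * N + 1))"
  by (simp add: integration_mat_def kronecker_def sinc_int_mat_def D_mat_def mat_diag_def)

lemma integration_mat_entry: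
  assumes "i < n" "j < n" "p < 2 * N + 1" "q < 2 * N + 1"
  shows "integration_mat a b n h N $$ (i * (2 * N + 1) + p, j * (2 * N + 1) + q)
     = of_bool (i = j) * (of_real h * (of_real (sigma (node N p - node N q)) * of_real (dpsi (of_int (node N q) * h))))"
proof -
  let ?m = "2 * N + 1"
  define B where "B = of_real h \<cdot>\<^sub>m (sinc_int_mat N * D_mat a b h N)"
  have dims: "dim_row (sinc_int_mat N * D_mat a b h N) = ?m" "dim_col (sinc_int_mat N * D_mat a b h N) = ?m"
    "dim_row B = ?m" "dim_col B = ?m"
    by (simp_all add: B_def sinc_int_mat_def D_mat_def mat_diag_def)
  have "(sinc_int_mat N * D_mat a b h N) $$ (p, q) =
      (\<Sum>s<?m. of_real (sigma (node N p - node N s)) * (if s = q then of_real (deriv (psi_DE a b :: real \<Rightarrow> real) (of_int (node N s) * h)) else 0))"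
    using assms by (auto simp: sinc_int_mat_def D_mat_def mat_diag_def scalar_prod_def atLeast0LessThan intro!: sum.cong)
  also have "\<dots> = of_real (sigma (node N p - node N q)) * of_real (dpsi (of_int (node N q) * h))"
    using assms by (simp add: deriv_psi if_distrib[of "\<lambda>x. _ * x"] cong: if_cong)
  finally have "B $$ (p, q) = of_real h * (of_real (sigma (node N p - node N q)) * of_real (dpsi (of_int (node N q) * h)))"
    unfolding B_def using assms dims(1,2) by (subst index_smult_mat(1)) (simp_all only:)
  moreover have "integration_mat a b n h N $$ (i * ?m + p, j * ?m + q) = 1\<^sub>m n $$ (i, j) * B $$ (p, q)"
    unfolding integration_mat_def B_def[symmetric] kronecker_def
    using assms block_index_less[of i n p ?m] block_index_less[of j n q ?m]
    by (simp add: dims del: mult_Suc_right)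
  ultimately show ?thesis using assms by simp
qed

lemma integration_mat_apply:
  assumes V: "V \<in> carrier_vec (n * (2 * N + 1))" and ip: "i < n" "p < 2 * N + 1"
  shows "(integration_mat a b n h N *\<^sub>v V) $ (i * (2 * N + 1) + p)
     = of_real h * (\<Sum>q<2 * N + 1. of_real (sigma (node N p - node N q)) *
          (of_real (dpsi (of_int (node N q) * h)) * V $ (i * (2 * N + 1) + q)))"
proof -
  let ?m = "2 * N + 1"
  have "(integration_mat a b n h N *\<^sub>v V) $ (i * ?m + p) =
      (\<Sum>j<n. \<Sum>q<?m. of_bool (i = j) * (of_real h * (of_real (sigma (node N p - node N q)) * of_real (dpsi (of_int (node N q) * h)))) * V $ (j * ?m + q))"
    unfolding mat_mult_vec_blocks[OF integration_mat_carrier V block_index_less[OF ip]]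
    using ip by (intro sum.cong refl arg_cong2[of _ _ _ _ "(*)"] integration_mat_entry) auto
  also have "\<dots> = (\<Sum>j<n. if i = j then \<Sum>q<?m. of_real h * (of_real (sigma (node N p - node N q)) * of_real (dpsi (of_int (node N q) * h))) * V $ (j * ?m + q) else 0)"
    by (intro sum.cong refl) simp
  also have "\<dots> = (\<Sum>q<?m. of_real h * (of_real (sigma (node N p - node N q)) * of_real (dpsi (of_int (node N q) * h))) * V $ (i * ?m + q))"
    using ip by simp
  finally show ?thesis by (simp only: sum_distrib_left mult.assoc)
qed

lemma coefficient_blocks_apply:
  assumes Y: "Y \<in> carrier_vec (n * (2 * N + 1))" and ip: "i < n" "p < 2 * N + 1"
  shows "(block_mat n (2 * N + 1) (\<lambda>i j. sample_mat a b h N (k i j)) *\<^sub>v Y) $ (i * (2 * N + 1) + p)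
     = (\<Sum>j<n. k i j (of_real (of_int (node N p) * h)) * Y $ (j * (2 * N + 1) + p))"
proof -
  let ?m = "2 * N + 1"
  let ?K = "block_mat n ?m (\<lambda>i j. sample_mat a b h N (k i j))"
  have K: "?K \<in> carrier_mat (n * ?m) (n * ?m)" by (simp add: block_mat_def)
  have entry: "?K $$ (i * ?m + p, j * ?m + q) = (if p = q then k i j (of_real (of_int (node N p) * h)) else 0)"
    if "j < n" "q < ?m" for j q
    using that ip block_index_less[of i n p ?m] block_index_less[of j n q ?m]
    by (simp add: block_mat_def sample_mat_def mat_diag_def on_interval_sample del: mult_Suc_right)
  have "(?K *\<^sub>v Y) $ (i * ?m + p) = (\<Sum>j<n. \<Sum>q<?m. (if p = q then k i j (of_real (of_int (node N p) * h)) else 0) * Y $ (j * ?m + q))"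
    unfolding mat_mult_vec_blocks[OF K Y block_index_less[OF ip]]
    by (intro sum.cong refl arg_cong2[of _ _ _ _ "(*)"] entry) auto
  also have "\<dots> = (\<Sum>j<n. \<Sum>q<?m. if p = q then k i j (of_real (of_int (node N p) * h)) * Y $ (j * ?m + q) else 0)"
    by (intro sum.cong refl) simp
  also have "\<dots> = (\<Sum>j<n. k i j (of_real (of_int (node N p) * h)) * Y $ (j * ?m + p))"
    using ip by (intro sum.cong refl) simp
  finally show ?thesis .
qed

lemma system_mat_carrier: "system_mat a b n k h N \<in> carrier_mat (n * (2 * N + 1)) (n * (2 * N + 1))"
  using integration_mat_carrier[of h N]
  by (auto simp: system_mat_def kronecker_def block_mat_def)

text \<open>The diagonal of derivatives in the integration matrix merges with the sampled
  coefficients into \<open>scaled\<close>. The discrete system thus has the same coefficients as the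
  equation on the strip and can be compared with it term by term.\<close>

lemma system_mat_apply:
  assumes Y: "Y \<in> carrier_vec (n * (2 * N + 1))" and ip: "i < n" "p < 2 * N + 1"
  shows "(system_mat a b n k h N *\<^sub>v Y) $ (i * (2 * N + 1) + p) = Y $ (i * (2 * N + 1) + p) -
     of_real h * (\<Sum>q<2 * N + 1. of_real (sigma (node N p - node N q)) *
       (\<Sum>j<n. scaled (k i j) (of_real (of_int (node N q) * h)) * Y $ (j * (2 * N + 1) + q)))"
proof -
  let ?m = "2 * N + 1"
  let ?K = "block_mat n ?m (\<lambda>i j. sample_mat a b h N (k i j))"
  let ?I = "integration_mat a b n h N"
  have K: "?K \<in> carrier_mat (n * ?m) (n * ?m)" by (simp add: block_mat_def)
  have id: "kronecker (1\<^sub>m n) (1\<^sub>m ?m) = (1\<^sub>m (n * ?m) :: complex mat)"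
  proof (rule eq_matI)
    fix P Q assume "P < dim_row (1\<^sub>m (n * ?m) :: complex mat)" "Q < dim_col (1\<^sub>m (n * ?m) :: complex mat)"
    hence PQ: "P < n * ?m" "Q < n * ?m" by simp_all
    obtain i p where 1: "i < n" "p < ?m" "P = i * ?m + p" using PQ(1) by (rule block_index_cases)
    obtain j q where 2: "j < n" "q < ?m" "Q = j * ?m + q" using PQ(2) by (rule block_index_cases)
    have "P = Q \<longleftrightarrow> i = j \<and> p = q" using 1 2 block_index_div_mod by metis
    thus "kronecker (1\<^sub>m n) (1\<^sub>m ?m) $$ (P, Q) = (1\<^sub>m (n * ?m) :: complex mat) $$ (P, Q)"
      using 1 2 PQ by (simp add: kronecker_def del: mult_Suc_right)
  qed (simp_all add: kronecker_def)
  have "(system_mat a b n k h N *\<^sub>v Y) = Y - ?I *\<^sub>v (?K *\<^sub>v Y)"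
    unfolding system_mat_def id using integration_mat_carrier[of h N] K Y
    by (subst minus_mult_distrib_mat_vec[where nr = "n * ?m" and nc = "n * ?m"]) auto
  moreover have "(?I *\<^sub>v (?K *\<^sub>v Y)) $ (i * ?m + p) = of_real h * (\<Sum>q<?m. of_real (sigma (node N p - node N q)) *
       (\<Sum>j<n. scaled (k i j) (of_real (of_int (node N q) * h)) * Y $ (j * ?m + q)))"
  proof -
    have KY: "?K *\<^sub>v Y \<in> carrier_vec (n * ?m)" using K Y by simp
    have "of_real (dpsi (of_int (node N q) * h)) * (?K *\<^sub>v Y) $ (i * ?m + q)
        = (\<Sum>j<n. scaled (k i j) (of_real (of_int (node N q) * h)) * Y $ (j * ?m + q))" if "q < ?m" for q
      unfolding coefficient_blocks_apply[OF Y ip(1) that] sum_distrib_left scaled_of_real mult.assoc ..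
    thus ?thesis unfolding integration_mat_apply[OF KY ip] by simp
  qed
  ultimately show ?thesis
    using integration_mat_carrier[of h N] K Y block_index_less[OF ip] by simp
qed

lemma system_rhs_carrier: "system_rhs a b n g r h N \<in> carrier_vec (n * (2 * N + 1))"
  using mult_mat_vec_carrier[OF integration_mat_carrier, of "G_vec a b n g h N"]
  unfolding system_rhs_def by (intro add_carrier_vec) (simp_all add: R_vec_def G_vec_def)

lemma system_rhs_entry:
  assumes ip: "i < n" "p < 2 * N + 1"
  shows "system_rhs a b n g r h N $ (i * (2 * N + 1) + p) = r $ i +
     of_real h * (\<Sum>q<2 * N + 1. of_real (sigma (node N p - node N q)) * scaled (g i) (of_real (of_int (node N q) * h)))"
proof -
  let ?m = "2 * N + 1"
  have G: "G_vec a b n g h N \<in> carrier_vec (n * ?m)" by (simp add: G_vec_def)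
  have entry: "G_vec a b n g h N $ (i * ?m + q) = g i (of_real (of_int (node N q) * h))" if "q < ?m" for q
    using that block_index_less[OF ip(1) that] unfolding G_vec_def
    by (simp add: on_interval_sample del: mult_Suc_right)
  have "of_real (dpsi (of_int (node N q) * h)) * G_vec a b n g h N $ (i * ?m + q)
      = scaled (g i) (of_real (of_int (node N q) * h))" if "q < ?m" for q
    unfolding entry[OF that] scaled_of_real ..
  hence "(integration_mat a b n h N *\<^sub>v G_vec a b n g h N) $ (i * ?m + p) =
      of_real h * (\<Sum>q<?m. of_real (sigma (node N p - node N q)) * scaled (g i) (of_real (of_int (node N q) * h)))"
    unfolding integration_mat_apply[OF G ip] by simp
  moreover have "R_vec n r N $ (i * ?m + p) = r $ i"
    using ip block_index_less[OF ip] by (simp add: R_vec_def del: mult_Suc_right)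
  ultimately show ?thesis
    using integration_mat_carrier[of h N] block_index_less[OF ip]
    by (simp add: system_rhs_def R_vec_def del: mult_Suc_right)
qed

end

section \<open>Error propagation and the final estimate\<close>

text \<open>Three sources of error: I for interpolating exact data; \<delta> + E for replacing the
  end values r and s by computed ones, which enters as a convex combination; and the error of the
  interpolated data. The latter consists of E for the sample and again \<delta> + E for the end
  values, and is amplified by the Lebesgue constant.\<close>

lemma interpolation_perturbation:
  fixes f u c :: "int \<Rightarrow> complex" and S \<beta> :: "int \<Rightarrow> real" and fx r s :: complex
  assumes f: "\<And>j. j \<in> {- int N..int N} \<Longrightarrow> f j = u j - r * of_real (1 - \<beta> j) - s * of_real (\<beta> j)"
    and \<beta>: "\<And>j. 0 \<le> \<beta> j \<and> \<beta> j \<le> 1" and \<beta>x: "0 \<le> \<beta>x" "\<beta>x \<le> 1"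
    and interp: "norm (fx - (\<Sum>j = - int N..int N. f j * of_real (S j))) \<le> I"
    and err: "\<And>j. j \<in> {- int N..int N} \<Longrightarrow> norm (u j - c j) \<le> E"
    and ends: "norm (r - u (- int N)) \<le> \<delta>" "norm (s - u (int N)) \<le> \<delta>"
    and Lam: "(\<Sum>j = - int N..int N. \<bar>S j\<bar>) \<le> \<Lambda>"
  shows "norm (fx + r * of_real (1 - \<beta>x) + s * of_real \<beta>x -
      (c (- int N) * of_real (1 - \<beta>x) + c (int N) * of_real \<beta>x +
       (\<Sum>j = - int N..int N. (c j - c (- int N) * of_real (1 - \<beta> j) - c (int N) * of_real (\<beta> j)) * of_real (S j))))
     \<le> I + (\<delta> + E) + (2 * E + \<delta>) * \<Lambda>"
proof -
  let ?cm = "c (- int N)" and ?cp = "c (int N)"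
  define g where "g = (\<lambda>j. c j - ?cm * of_real (1 - \<beta> j) - ?cp * of_real (\<beta> j))"
  have E0: "0 \<le> E" using order_trans[OF norm_ge_zero err[of 0]] by simp
  have \<delta>0: "0 \<le> \<delta>" using ends(1) norm_ge_zero order_trans by blast
  have dm: "norm (r - ?cm) \<le> \<delta> + E"
    using norm_triangle_mono[OF ends(1) err[of "- int N"]] by simp
  have dp: "norm (s - ?cp) \<le> \<delta> + E"
    using norm_triangle_mono[OF ends(2) err[of "int N"]] by simp
  have convex: "norm ((r - ?cm) * of_real (1 - t) + (s - ?cp) * of_real t) \<le> \<delta> + E" if "0 \<le> t" "t \<le> 1" for t
  proof -
    have "norm ((r - ?cm) * of_real (1 - t)) \<le> (\<delta> + E) * (1 - t)"
      unfolding norm_mult norm_of_real using that dm by (simp add: mult_right_mono)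
    moreover have "norm ((s - ?cp) * of_real t) \<le> (\<delta> + E) * t"
      unfolding norm_mult norm_of_real using that dp by (simp add: mult_right_mono)
    ultimately have "norm ((r - ?cm) * of_real (1 - t) + (s - ?cp) * of_real t) \<le> (\<delta> + E) * (1 - t) + (\<delta> + E) * t"
      by (rule norm_triangle_mono)
    thus ?thesis by (simp add: algebra_simps)
  qed
  have fg: "norm (f j - g j) \<le> 2 * E + \<delta>" if j: "j \<in> {- int N..int N}" for j
  proof -
    have "f j - g j = (u j - c j) - ((r - ?cm) * of_real (1 - \<beta> j) + (s - ?cp) * of_real (\<beta> j))"
      by (simp add: f[OF j] g_def algebra_simps)
    also have "norm \<dots> \<le> E + (\<delta> + E)"
      by (intro order_trans[OF norm_triangle_ineq4] add_mono err j convex) (use \<beta> in auto)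
    finally show ?thesis by simp
  qed
  have "norm (\<Sum>j = - int N..int N. (f j - g j) * of_real (S j)) \<le> (\<Sum>j = - int N..int N. (2 * E + \<delta>) * \<bar>S j\<bar>)"
    by (intro sum_norm_le, unfold norm_mult norm_of_real, intro mult_right_mono fg) auto
  also have "\<dots> = (2 * E + \<delta>) * (\<Sum>j = - int N..int N. \<bar>S j\<bar>)" by (simp only: sum_distrib_left)
  also have "\<dots> \<le> (2 * E + \<delta>) * \<Lambda>" using E0 \<delta>0 by (intro mult_left_mono Lam) auto
  finally have 3: "norm (\<Sum>j = - int N..int N. (f j - g j) * of_real (S j)) \<le> (2 * E + \<delta>) * \<Lambda>" .
  have "fx + r * of_real (1 - \<beta>x) + s * of_real \<beta>x -
      (?cm * of_real (1 - \<beta>x) + ?cp * of_real \<beta>x + (\<Sum>j = - int N..int N. g j * of_real (S j)))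
    = (fx - (\<Sum>j = - int N..int N. f j * of_real (S j)))
      + ((r - ?cm) * of_real (1 - \<beta>x) + (s - ?cp) * of_real \<beta>x)
      + (\<Sum>j = - int N..int N. (f j - g j) * of_real (S j))"
    by (simp add: left_diff_distrib sum_subtractf algebra_simps)
  also have "norm \<dots> \<le> I + (\<delta> + E) + (2 * E + \<delta>) * \<Lambda>"
    by (intro norm_triangle_mono interp convex \<beta>x 3)
  finally show ?thesis by (simp only: g_def)
qed

context de_ivp
begin

lemma system_solution_equation:
  fixes Y :: "complex vec"
  assumes Y: "system_solution a b n k g r h N Y" and ip: "i < n" "p < 2 * N + 1"
  shows "Y $ (i * (2 * N + 1) + p) = r $ i + of_real h * (\<Sum>q<2 * N + 1. of_real (sigma (node N p - node N q)) *
       (scaled (g i) (of_real (of_int (node N q) * h)) +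
        (\<Sum>j<n. scaled (k i j) (of_real (of_int (node N q) * h)) * Y $ (j * (2 * N + 1) + q))))"
proof -
  have carrier: "Y \<in> carrier_vec (n * (2 * N + 1))"
    and eq: "system_mat a b n k h N *\<^sub>v Y = system_rhs a b n g r h N"
    using Y by (auto simp: system_solution_def)
  have "(system_mat a b n k h N *\<^sub>v Y) $ (i * (2 * N + 1) + p) = system_rhs a b n g r h N $ (i * (2 * N + 1) + p)"
    by (simp only: eq)
  thus ?thesis
    unfolding system_mat_apply[OF carrier ip] system_rhs_entry[OF ip]
    by (simp only: distrib_left sum.distrib diff_eq_eq add.assoc)
qed

text \<open>A vector in the kernel satisfies the stability hypothesis with zero residual and
  therefore vanishes; for a square matrix this yields existence as well.\<close>

lemma system_uniquely_solvable:
  assumes coeff: "\<And>i j x. i < n \<Longrightarrow> j < n \<Longrightarrow> norm (scaled (k i j) (of_real x)) \<le> M / (cosh x)\<^sup>2"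
    and M: "0 \<le> M" and h: "0 < h" "h \<le> 1"
    and small: "exp (3 * real n * M) * (4 * real n * M) * (h * sqrt (2 * real N + 1)) \<le> 1 / 2"
  shows "\<exists>!Y. system_solution a b n k g r h N Y"
  unfolding system_solution_def
proof (rule unique_solution_if_injective[OF system_mat_carrier system_rhs_carrier])
  let ?m = "2 * N + 1"
  fix v assume v: "v \<in> carrier_vec (n * ?m)" "system_mat a b n k h N *\<^sub>v v = 0\<^sub>v (n * ?m)"
  have "v $ (i * ?m + p) = 0" if ip: "i < n" "p < ?m" for i p
  proof -
    have "norm (v $ (i * ?m + p)) \<le> 2 * exp (3 * real n * M) * 0"
    proof (rule stability[where e = "\<lambda>i p. v $ (i * ?m + p)" and \<rho> = "\<lambda>_ _. 0" and h = h and N = N and n = n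
          and A = "\<lambda>i j q. scaled (k i j) (of_real (of_int (node N q) * h))"])
      fix i p assume ip: "i < n" "p < ?m"
      have "(system_mat a b n k h N *\<^sub>v v) $ (i * ?m + p) = 0"
        unfolding v(2) using block_index_less[OF ip] by (simp del: mult_Suc_right)
      thus "v $ (i * ?m + p) = 0 + of_real h * (\<Sum>q<?m. of_real (sigma (node N p - node N q)) *
          (\<Sum>j<n. scaled (k i j) (of_real (of_int (node N q) * h)) * v $ (j * ?m + q)))"
        unfolding system_mat_apply[OF v(1) ip] by simp
    qed (use coeff M h small ip in \<open>simp_all only: norm_zero order_refl\<close>)
    thus ?thesis by simp
  qed
  thus "v = 0\<^sub>v (n * ?m)"
    using v(1) by (intro eq_vecI; clarsimp simp del: mult_Suc_right) (metis block_index_cases)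
qed

lemma wb_of_real: "wb (of_real x) = of_real (w_b a b (psi_DE a b x))"
proof -
  have "of_real (pi / 2) * sinh (of_real x :: complex) = of_real (pi / 2 * sinh x)"
    by (simp add: sinh_of_real)
  hence "tanh (of_real (pi / 2) * sinh (of_real x :: complex)) = of_real (tanh (pi / 2 * sinh x))"
    by (simp only: tanh_def cosh_of_real sinh_of_real of_real_divide)
  hence "wb (of_real x) = of_real ((1 + tanh (pi / 2 * sinh x)) / 2)" by (simp add: wb_def)
  also have "(1 + tanh (pi / 2 * sinh x)) / 2 = w_b a b (psi_DE a b x)"
    using ab by (simp add: w_b_def psi_DE_real field_simps)
  finally show ?thesis .
qed

lemma w_a_conv: "w_a a b t = 1 - w_b a b t"
  using ab by (simp add: w_a_def w_b_def field_simps)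

lemma w_b_psi_bounds: "0 \<le> w_b a b (psi_DE a b x) \<and> w_b a b (psi_DE a b x) \<le> 1"
  using psi_DE_in_interval[OF ab, of x] ab by (simp add: w_b_def field_simps)

text \<open>Only the exponential is frozen at X; keeping 1/cosh^2 in its variable form leaves the
  tail summable.\<close>

lemma omega_tail:
  assumes "0 \<le> X" "X \<le> \<bar>x\<bar>"
  shows "omega gam x \<le> exp (- gam * sinh X) / (cosh x)\<^sup>2"
proof -
  have "sinh X \<le> sinh \<bar>x\<bar>" using assms by (simp only: sinh_real_le_iff)
  hence "sinh X \<le> \<bar>sinh x\<bar>" by (simp only: sinh_real_abs)
  thus ?thesis unfolding omega_def using gam_pos by (intro divide_right_mono) auto
qed

lemma collocation_at_psi:
  "collocation_solution a b h N Y i (psi_DE a b x) =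
     coeff_at N Y i (- int N) * of_real (1 - w_b a b (psi_DE a b x)) + coeff_at N Y i (int N) * of_real (w_b a b (psi_DE a b x)) +
     (\<Sum>j = - int N..int N. (coeff_at N Y i j
        - coeff_at N Y i (- int N) * of_real (1 - w_b a b (psi_DE a b (of_int j * h)))
        - coeff_at N Y i (int N) * of_real (w_b a b (psi_DE a b (of_int j * h)))) * of_real (sinc_basis j h x))"
proof -
  have "sinc_basis_DE a b j h (psi_DE a b x) = sinc_basis j h x" for j
    using psi_DE_in_interval[OF ab, of x] by (simp add: sinc_basis_DE_def phi_psi[OF ab])
  thus ?thesis unfolding collocation_solution_def w_a_conv sample_pt_def by (simp only:)
qed

lemma collocation_at_ends:
  "collocation_solution a b h N Y i a = coeff_at N Y i (- int N)"
  "collocation_solution a b h N Y i b = coeff_at N Y i (int N)"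
  using ab by (simp_all add: collocation_solution_def sinc_basis_DE_def w_a_def w_b_def)

lemma convergence:
  "\<exists>N\<^sub>0\<ge>1. \<exists>C::real. \<forall>N\<ge>N\<^sub>0.
     (\<exists>!Y. system_solution a b n k g r (step_size d \<alpha> N) N Y) \<and>
     (\<forall>Y. system_solution a b n k g r (step_size d \<alpha> N) N Y \<longrightarrow>
        (\<forall>i<n. \<forall>t\<in>{a..b}.
           norm (y i t - collocation_solution a b (step_size d \<alpha> N) N Y i t)
             \<le> C * exp (- pi * d * real N / ln (2 * d * real N / \<alpha>))))"
proof -
  obtain M where M: "0 \<le> M"
    "\<And>i j z. i < n \<Longrightarrow> j < n \<Longrightarrow> z \<in> strip d \<Longrightarrow> norm (scaled (k i j) z) \<le> M * omega gam (Re z)"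
    using uniform_bound by blast
  obtain u F K where K: "0 \<le> K"
    and u_y: "\<And>i x. i < n \<Longrightarrow> u i (of_real x) = y i (psi_DE a b x)"
    and F_holo: "\<And>i. i < n \<Longrightarrow> F i holomorphic_on strip d"
    and u_deriv: "\<And>i z. i < n \<Longrightarrow> z \<in> strip d \<Longrightarrow> (u i has_field_derivative F i z) (at z)"
    and F_bound: "\<And>i z. i < n \<Longrightarrow> z \<in> strip d \<Longrightarrow> norm (F i z) \<le> K * omega gam (Re z)"
    and u_bound: "\<And>i z. i < n \<Longrightarrow> z \<in> strip d \<Longrightarrow> norm (u i z) \<le> K"
    and u_left: "\<And>i z. i < n \<Longrightarrow> z \<in> strip d \<Longrightarrow> Re z \<le> 0 \<Longrightarrow> norm (u i z - r $ i) \<le> K * omega gam (Re z)"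
    and u_right: "\<And>i z. i < n \<Longrightarrow> z \<in> strip d \<Longrightarrow> 0 \<le> Re z \<Longrightarrow> norm (u i z - y i b) \<le> K * omega gam (Re z)"
    and F_eq: "\<And>i x. i < n \<Longrightarrow> F i (of_real x) = scaled (g i) (of_real x) + (\<Sum>j<n. scaled (k i j) (of_real x) * u j (of_real x))"
    using analytic_solution by blast
  have real_in_strip: "of_real x \<in> strip d" for x using d_pos by (simp add: strip_def)
  have coeff: "norm (scaled (k i j) (of_real x)) \<le> M / (cosh x)\<^sup>2" if "i < n" "j < n" for i j x
  proof -
    have "M * omega gam x \<le> M * (1 / (cosh x)\<^sup>2)"
      using M(1) gam_pos by (intro mult_left_mono omega_le_inverse_cosh_square) auto
    thus ?thesis using M(2)[OF that real_in_strip, of x] by simp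
  qed
  define K' where "K' = K + 4 * K * wb_const"
  \<comment> \<open>Subtracting the combination of the two limits makes the function decay at both
    ends. The approximation does the same with its own values at -N and N.\<close>
  define f where "f = (\<lambda>i z. u i z - r $ i * (1 - wb z) - y i b * wb z)"
  have K': "0 \<le> K'" using K wb_const_nonneg by (simp add: K'_def)
  have omega0: "omega gam 0 = 1" by (simp add: omega_def)
  \<comment> \<open>Both limits are compared with u(0): |u(0)| \<le> K, and both deviations are at
    most K \<open>omega\<close>(0) = K.\<close>
  have ends: "norm (r $ i) \<le> 2 * K" "norm (y i b) \<le> 2 * K" if "i < n" for i
    using u_left[OF that real_in_strip[of 0]] u_right[OF that real_in_strip[of 0]] u_bound[OF that real_in_strip[of 0]]
      norm_triangle_sub[of "r $ i" "u i 0"] norm_triangle_sub[of "y i b" "u i 0"]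
    by (simp_all add: omega0 norm_minus_commute)
  have jump: "norm (y i b - r $ i) \<le> 4 * K" if "i < n" for i
    using norm_triangle_ineq4[of "y i b" "r $ i"] ends[OF that] by linarith
  have f_holo: "f i holomorphic_on strip d" if "i < n" for i
  proof -
    have "u i holomorphic_on strip d"
      using u_deriv[OF that] by (auto simp: holomorphic_on_open[OF open_strip])
    thus ?thesis unfolding f_def by (intro holomorphic_intros wb_holomorphic)
  qed
  have f_bound: "norm (f i z) \<le> K' * omega gam (Re z)" if i: "i < n" and z: "z \<in> strip d" for i z
  proof (cases "Re z \<le> 0")
    case True
    have "f i z = (u i z - r $ i) - (y i b - r $ i) * wb z" by (simp add: f_def algebra_simps)
    also have "norm \<dots> \<le> K * omega gam (Re z) + 4 * K * (wb_const * omega gam (Re z))"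
      by (intro order_trans[OF norm_triangle_ineq4] add_mono u_left[OF i z True], unfold norm_mult, intro mult_mono jump[OF i] wb_left[OF z True])
        (use K in auto)
    finally show ?thesis by (simp add: K'_def algebra_simps)
  next
    case False
    hence *: "0 \<le> Re z" by simp
    have "f i z = (u i z - y i b) + (y i b - r $ i) * (1 - wb z)" by (simp add: f_def algebra_simps)
    also have "norm \<dots> \<le> K * omega gam (Re z) + 4 * K * (wb_const * omega gam (Re z))"
      by (intro norm_triangle_mono u_right[OF i z *], unfold norm_mult, intro mult_mono jump[OF i] wb_right[OF z *])
        (use K in auto)
    finally show ?thesis by (simp add: K'_def algebra_simps)
  qed
  define \<Gamma> where "\<Gamma> = exp (3 * real n * M)"
  define cd where "cd = 64 * (1 / d + 1 + 1 / d\<^sup>2)"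
  \<comment> \<open>The first bracket is for interpolation with its tail. The second bounds (2E + K
    \<tau>) m relative to e, and 9 is 8 from the Lebesgue constant plus 1 for the end
    values.\<close>
  define C where "C = (32 * K' / d + 2 * K') + 9 * (4 * \<Gamma> * (cd * K + 6 * K) + K)"
  have \<Gamma>: "1 \<le> \<Gamma>" using M(1) by (simp add: \<Gamma>_def)
  have cd: "0 \<le> cd" using d_pos by (simp add: cd_def)
  \<comment> \<open>The largest size of h m that the smallness condition of the stability estimate
    tolerates; the added 1 prevents division by zero when M = 0.\<close>
  define c1 where "c1 = 1 / (2 * (\<Gamma> * (4 * real n * M) + 1))"
  have c1: "0 < c1" using \<Gamma> M(1) by (simp add: c1_def add_nonneg_pos)
  let ?h = "step_size d \<alpha>"
  have "\<forall>\<^sub>F N in sequentially. (0 < ?h N \<and> ?h N < min d 1 \<and> 1 / ?h N \<le> real N) \<and>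
      ?h N * sqrt (2 * real N + 1) < min c1 1 \<and>
      exp (- gam * sinh (real N * ?h N)) * (real N + 1)\<^sup>2 \<le> exp (- pi * d * real N / ln (2 * d * real N / \<alpha>)) \<and> 1 \<le> N"
    using d_pos \<alpha>_pos gam_pos c1
    by (intro eventually_conj step_size_pos_asymp step_size_sqrt_asymp tail_asymp eventually_ge_at_top) auto
  then obtain N0 where N0: "\<And>N. N0 \<le> N \<Longrightarrow> (0 < ?h N \<and> ?h N < min d 1 \<and> 1 / ?h N \<le> real N) \<and>
      ?h N * sqrt (2 * real N + 1) < min c1 1 \<and>
      exp (- gam * sinh (real N * ?h N)) * (real N + 1)\<^sup>2 \<le> exp (- pi * d * real N / ln (2 * d * real N / \<alpha>)) \<and> 1 \<le> N"
    unfolding eventually_sequentially by blast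
  have main: "(\<exists>!Y. system_solution a b n k g r (?h N) N Y) \<and>
     (\<forall>Y. system_solution a b n k g r (?h N) N Y \<longrightarrow>
        (\<forall>i<n. \<forall>t\<in>{a..b}. norm (y i t - collocation_solution a b (?h N) N Y i t)
             \<le> C * exp (- pi * d * real N / ln (2 * d * real N / \<alpha>))))" if N: "N0 \<le> N" for N
  proof -
    define h where "h = ?h N"
    define e where "e = exp (- pi * d / h)"
    define \<tau> where "\<tau> = exp (- gam * sinh (real N * h))"
    define m where "m = sqrt (2 * real N + 1)"
    define R where "R = cd * K * h * e + 2 * (K * \<tau>) * (h + 2)"
    define E where "E = 2 * \<Gamma> * R"
    have h: "0 < h" "h \<le> d" "h \<le> 1" "1 / h \<le> real N" and hm: "h * m < c1" "h * m \<le> 1" and N1: "1 \<le> N"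
      using N0[OF N] by (auto simp: h_def m_def)
    \<comment> \<open>By the choice of h, exp(-pi d/h) is exactly the claimed rate.\<close>
    have e_eq: "exp (- pi * d * real N / ln (2 * d * real N / \<alpha>)) = e"
      using N1 by (simp add: e_def h_def step_size_def)
    \<comment> \<open>One power (N + 1)^2 is affordable, and it dominates both sqrt(2N + 1) and, up
      to a factor 2, the term 1 + 2/h.\<close>
    have tail: "\<tau> * (real N + 1)\<^sup>2 \<le> e"
      using N0[OF N] unfolding e_eq by (simp add: \<tau>_def h_def)
    have e0: "0 < e" and \<tau>0: "0 < \<tau>" by (simp_all add: e_def \<tau>_def)
    have m1: "1 \<le> m" by (simp add: m_def)
    have m_le: "m \<le> (real N + 1)\<^sup>2"
    proof -
      have "2 * real N + 1 \<le> (real N + 1)\<^sup>2" by (simp add: power2_eq_square algebra_simps)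
      hence "m \<le> real N + 1" unfolding m_def by (intro real_le_lsqrt) auto
      also have "\<dots> \<le> (real N + 1)\<^sup>2" by (simp add: power2_eq_square algebra_simps)
      finally show ?thesis .
    qed
    have \<tau>m: "\<tau> * m \<le> e"
      using mult_left_mono[OF m_le, of \<tau>] \<tau>0 tail by linarith
    have small: "exp (3 * real n * M) * (4 * real n * M) * (h * sqrt (2 * real N + 1)) \<le> 1 / 2"
    proof -
      have pos: "0 \<le> \<Gamma> * (4 * real n * M)" using \<Gamma> M(1) by simp
      hence "\<Gamma> * (4 * real n * M) * (h * m) \<le> \<Gamma> * (4 * real n * M) * c1"
        using hm(1) by (intro mult_left_mono) auto
      also have "\<dots> \<le> 1 / 2"
      proof -
        have "v * (1 / (2 * (v + 1))) \<le> 1 / 2" if "0 \<le> v" for v :: real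
          using that by (simp add: field_simps)
        from this[OF pos] show ?thesis by (simp only: c1_def)
      qed
      finally show ?thesis by (simp add: \<Gamma>_def m_def)
    qed
    have unique: "\<exists>!Y. system_solution a b n k g r h N Y"
      by (rule system_uniquely_solvable[OF coeff M(1) h(1,3) small])
    have Nh: "0 \<le> real N * h" using h(1) by simp
    have far: "real N * h \<le> \<bar>of_int q * h\<bar>" if "int N \<le> \<bar>q\<bar>" for q :: int
    proof -
      have "real N \<le> \<bar>of_int q\<bar>" using that by linarith
      thus ?thesis using h(1) by (simp add: abs_mult)
    qed
    have omega_far: "omega gam (of_int q * h) \<le> \<tau> / (cosh (of_int q * h))\<^sup>2" if "int N \<le> \<bar>q\<bar>" for q :: int
      unfolding \<tau>_def by (rule omega_tail[OF Nh far[OF that]])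
    have omega_edge: "omega gam (of_int q * h) \<le> \<tau>" if "int N \<le> \<bar>q\<bar>" for q :: int
    proof -
      have "\<tau> / (cosh (of_int q * h))\<^sup>2 \<le> \<tau> / 1"
        using \<tau>0 cosh_real_ge_1[of "of_int q * h"] by (intro divide_left_mono) (auto simp: one_le_power)
      thus ?thesis using omega_far[OF that] by simp
    qed
    have sinc_F: "sinc_strip d h K (F i)" if "i < n" for i
    proof
      fix z assume "z \<in> strip d"
      thus "norm (F i z) \<le> K / (cosh (Re z))\<^sup>2"
        using F_bound[OF that] mult_left_mono[OF omega_le_inverse_cosh_square K, of gam "Re z"] gam_pos by fastforce
    qed (use d_pos h F_holo that in auto)
    have sinc_f: "sinc_strip d h K' (f i)" if "i < n" for i
    proof
      fix z assume "z \<in> strip d"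
      thus "norm (f i z) \<le> K' / (cosh (Re z))\<^sup>2"
        using f_bound[OF that] mult_left_mono[OF omega_le_inverse_cosh_square K', of gam "Re z"] gam_pos by fastforce
    qed (use d_pos h f_holo that in auto)
    have residual: "norm (u i (of_real (of_int p * h)) - r $ i -
        of_real h * (\<Sum>q = - int N..int N. F i (of_real (of_int q * h)) * of_real (sigma (p - q))))
        \<le> cd * K * h * e + 2 * (K * \<tau>) * (h + 2)" if i: "i < n" for i p
      unfolding cd_def e_def
    proof (rule sinc_strip.indefinite_integration_error[OF sinc_F[OF i], where u = "\<lambda>x. u i (of_real x)"])
      show "((\<lambda>x. u i (of_real x)) has_vector_derivative F i (of_real x)) (at x)" for x
        by (rule has_vector_derivative_real_field) (rule u_deriv[OF i real_in_strip])
      show "((\<lambda>x. u i (of_real x)) \<longlongrightarrow> r $ i) at_bot"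
        using y_psi_lim(1)[OF i] by (simp only: u_y[OF i])
      fix q :: int assume "int N < \<bar>q\<bar>"
      hence "K * omega gam (of_int q * h) \<le> K * (\<tau> / (cosh (of_int q * h))\<^sup>2)"
        using K by (intro mult_left_mono omega_far) auto
      thus "norm (F i (of_real (of_int q * h))) \<le> K * \<tau> / (cosh (of_int q * h))\<^sup>2"
        using F_bound[OF i real_in_strip, of "of_int q * h"] by simp
    qed
    have interp: "norm (f i (of_real x) - (\<Sum>q = - int N..int N. f i (of_real (of_int q * h)) * of_real (sinc_basis q h x)))
        \<le> 32 * K' / d * e + (K' * \<tau>) * (1 + 2 / h)" if i: "i < n" for i x
      unfolding e_def
    proof (rule sinc_strip.sinc_interpolation_error[OF sinc_f[OF i]])
      fix q :: int assume "int N < \<bar>q\<bar>"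
      hence "K' * omega gam (of_int q * h) \<le> K' * (\<tau> / (cosh (of_int q * h))\<^sup>2)"
        using K' by (intro mult_left_mono omega_far) auto
      thus "norm (f i (of_real (of_int q * h))) \<le> K' * \<tau> / (cosh (of_int q * h))\<^sup>2"
        using f_bound[OF i real_in_strip, of "of_int q * h"] by simp
    qed
    have interp_e: "32 * K' / d * e + (K' * \<tau>) * (1 + 2 / h) \<le> (32 * K' / d + 2 * K') * e"
    proof -
      have "1 + 2 / h \<le> 1 + 2 * real N" using h(4) by simp
      also have "\<dots> \<le> 2 * (real N + 1)\<^sup>2" by (simp add: power2_eq_square algebra_simps)
      finally have "\<tau> * (1 + 2 / h) \<le> \<tau> * (2 * (real N + 1)\<^sup>2)" using \<tau>0 by (intro mult_left_mono) auto
      also have "\<dots> \<le> 2 * e" using tail by simp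
      finally have "K' * (\<tau> * (1 + 2 / h)) \<le> K' * (2 * e)" using K' by (rule mult_left_mono)
      thus ?thesis by (simp add: algebra_simps)
    qed
    have Em: "(2 * E + K * \<tau>) * m \<le> (4 * \<Gamma> * (cd * K + 6 * K) + K) * e"
    proof -
      \<comment> \<open>The decisive cancellation: the factor h of the residual meets m = sqrt(2N +
        1), and h m \<le> 1. Without it the contour term would be larger than the claimed rate by a
        factor m.\<close>
      have "cd * K * h * e * m = cd * K * e * (h * m)" by (simp only: mult_ac)
      also have "\<dots> \<le> cd * K * e * 1" using cd K e0 hm(2) by (intro mult_left_mono) auto
      finally have 1: "cd * K * h * e * m \<le> cd * K * e" by simp
      have "2 * (K * \<tau>) * (h + 2) * m = 2 * K * (h + 2) * (\<tau> * m)" by (simp only: mult_ac)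
      also have "\<dots> \<le> 2 * K * 3 * e" using K h \<tau>m \<tau>0 m1 by (intro mult_mono) auto
      finally have 2: "2 * (K * \<tau>) * (h + 2) * m \<le> 6 * K * e" by simp
      have "R * m \<le> (cd * K + 6 * K) * e"
        unfolding R_def distrib_right[of _ _ m] distrib_right[of _ _ e] using 1 2 by linarith
      hence "4 * \<Gamma> * (R * m) \<le> 4 * \<Gamma> * ((cd * K + 6 * K) * e)"
        using \<Gamma> by (intro mult_left_mono) auto
      moreover have "K * (\<tau> * m) \<le> K * e" using K \<tau>m by (rule mult_left_mono[rotated])
      moreover have "(2 * E + K * \<tau>) * m = 4 * \<Gamma> * (R * m) + K * (\<tau> * m)"
        unfolding E_def by (simp add: algebra_simps)
      moreover have "(4 * \<Gamma> * (cd * K + 6 * K) + K) * e = 4 * \<Gamma> * ((cd * K + 6 * K) * e) + K * e"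
        by (simp only: distrib_right mult.assoc)
      ultimately show ?thesis by linarith
    qed
    have E0: "0 \<le> E" unfolding E_def R_def using \<Gamma> cd K h e0 \<tau>0 by (intro mult_nonneg_nonneg add_nonneg_nonneg) auto
    have "norm (y i t - collocation_solution a b h N Y i t) \<le> C * e"
      if Y: "system_solution a b n k g r h N Y" and i: "i < n" and t: "t \<in> {a..b}" for Y i t
    proof -
      let ?m = "2 * N + 1"
      define U where "U = (\<lambda>i p. u i (of_real (of_int (node N p) * h)))"
      have grid_error: "norm (U i p - Y $ (i * ?m + p)) \<le> 2 * exp (3 * real n * M) * (cd * K * h * e + 2 * (K * \<tau>) * (h + 2))"
        if "i < n" "p < ?m" for i p
      \<comment> \<open>\<rho> is the indefinite integration error of the exact solution at the
        sampling points. The discrete equation holds exactly for Y, so subtracting it leaves a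
        homogeneous system for the error with \<rho> as inhomogeneity.\<close>
      proof (rule stability[where e = "\<lambda>i p. U i p - Y $ (i * ?m + p)" and h = h and N = N and n = n
            and A = "\<lambda>i j q. scaled (k i j) (of_real (of_int (node N q) * h))"
            and \<rho> = "\<lambda>i p. U i p - r $ i - of_real h * (\<Sum>q<?m. of_real (sigma (node N p - node N q)) * F i (of_real (of_int (node N q) * h)))"])
        fix i p assume ip: "i < n" "p < ?m"
        have "of_real (sigma (node N p - node N q)) * F i (of_real (of_int (node N q) * h))
            - of_real (sigma (node N p - node N q)) * (scaled (g i) (of_real (of_int (node N q) * h)) +
               (\<Sum>j<n. scaled (k i j) (of_real (of_int (node N q) * h)) * Y $ (j * ?m + q)))
            = of_real (sigma (node N p - node N q)) * (\<Sum>j<n. scaled (k i j) (of_real (of_int (node N q) * h)) * (U j q - Y $ (j * ?m + q)))" for q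
          unfolding F_eq[OF ip(1)] U_def by (simp add: right_diff_distrib sum_subtractf algebra_simps del: mult_Suc_right)
        note termwise = this
        define SX where "SX = (\<Sum>q<?m. of_real (sigma (node N p - node N q)) * (\<Sum>j<n. scaled (k i j) (of_real (of_int (node N q) * h)) * (U j q - Y $ (j * ?m + q))))"
        define SF where "SF = (\<Sum>q<?m. of_real (sigma (node N p - node N q)) * F i (of_real (of_int (node N q) * h)))"
        define SY where "SY = (\<Sum>q<?m. of_real (sigma (node N p - node N q)) * (scaled (g i) (of_real (of_int (node N q) * h)) +
               (\<Sum>j<n. scaled (k i j) (of_real (of_int (node N q) * h)) * Y $ (j * ?m + q))))"
        have SX_eq: "SX = SF - SY"
          unfolding SX_def SF_def SY_def sum_subtractf[symmetric] by (intro sum.cong refl termwise[symmetric])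
        define yv where "yv = Y $ (i * ?m + p)"
        have yv_eq: "yv = r $ i + of_real h * SY"
          unfolding yv_def SY_def by (rule system_solution_equation[OF Y ip])
        have "U i p - yv = U i p - r $ i - of_real h * SF + of_real h * SX"
          unfolding SX_eq yv_eq by (simp add: right_diff_distrib)
        thus "U i p - Y $ (i * ?m + p) = U i p - r $ i - of_real h * (\<Sum>q<?m. of_real (sigma (node N p - node N q)) * F i (of_real (of_int (node N q) * h))) +
            of_real h * (\<Sum>q<?m. of_real (sigma (node N p - node N q)) * (\<Sum>j<n. scaled (k i j) (of_real (of_int (node N q) * h)) * (U j q - Y $ (j * ?m + q))))"
          unfolding yv_def SX_def SF_def .
      next
        fix i p assume ip: "i < n" "p < ?m"
        have "(\<Sum>q<?m. of_real (sigma (node N p - node N q)) * F i (of_real (of_int (node N q) * h)))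
            = (\<Sum>q = - int N..int N. F i (of_real (of_int q * h)) * of_real (sigma (node N p - q)))"
          using sum_nodes[of "\<lambda>q. F i (of_real (of_int q * h)) * of_real (sigma (node N p - q))" N]
          by (simp only: mult.commute)
        thus "norm (U i p - r $ i - of_real h * (\<Sum>q<?m. of_real (sigma (node N p - node N q)) * F i (of_real (of_int (node N q) * h))))
            \<le> cd * K * h * e + 2 * (K * \<tau>) * (h + 2)"
          unfolding U_def using residual[OF ip(1)] by (simp only:)
      qed (use coeff M(1) h small that in \<open>simp_all only:\<close>)
      have err: "norm (u i (of_real (of_int j * h)) - coeff_at N Y i j) \<le> E" if j: "j \<in> {- int N..int N}" for j
      proof -
        define p where "p = nat (j + int N)"
        have p: "p < ?m" "node N p = j" using j by (auto simp: p_def node_def)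
        show ?thesis using grid_error[OF i p(1)] unfolding U_def p(2) coeff_at_def p_def[symmetric] E_def R_def \<Gamma>_def .
      qed
      have end_a: "norm (r $ i - u i (of_real (of_int (- int N) * h))) \<le> K * \<tau>"
      proof -
        have "norm (u i (of_real (of_int (- int N) * h)) - r $ i) \<le> K * omega gam (of_int (- int N) * h)"
          using u_left[OF i real_in_strip[of "of_int (- int N) * h"]] Nh by simp
        also have "\<dots> \<le> K * \<tau>" using K by (intro mult_left_mono omega_edge) auto
        finally show ?thesis by (simp add: norm_minus_commute)
      qed
      have end_b: "norm (y i b - u i (of_real (of_int (int N) * h))) \<le> K * \<tau>"
      proof -
        have "norm (u i (of_real (of_int (int N) * h)) - y i b) \<le> K * omega gam (of_int (int N) * h)"
          using u_right[OF i real_in_strip[of "of_int (int N) * h"]] Nh by simp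
        also have "\<dots> \<le> K * \<tau>" using K by (intro mult_left_mono omega_edge) auto
        finally show ?thesis by (simp add: norm_minus_commute)
      qed
      have final: "I + 9 * ((2 * E + K * \<tau>) * m) \<le> C * e" if "I \<le> (32 * K' / d + 2 * K') * e" for I
        using that Em by (simp add: C_def distrib_right)
      \<comment> \<open>As m \<ge> 1, the error in the end values is charged to the Lebesgue
        term.\<close>
      have edge: "K * \<tau> + E \<le> (2 * E + K * \<tau>) * m"
      proof -
        have "(2 * E + K * \<tau>) * 1 \<le> (2 * E + K * \<tau>) * m"
          using E0 K \<tau>0 m1 by (intro mult_left_mono) auto
        thus ?thesis using E0 unfolding mult_1_right by linarith
      qed
      have edge_C: "K * \<tau> + E \<le> C * e"
      proof -
        have "0 \<le> (2 * E + K * \<tau>) * m" using E0 K \<tau>0 m1 by (intro mult_nonneg_nonneg add_nonneg_nonneg) auto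
        moreover have "0 \<le> (32 * K' / d + 2 * K') * e" using K' d_pos e0 by simp
        ultimately show ?thesis using edge final[of 0] by linarith
      qed
      \<comment> \<open>At a and b the inverse transformation has no meaning. There the basis
        functions are 0 by convention, and the approximation reduces to its first or last
        coefficient.\<close>
      consider "t = a" | "t = b" | "a < t" "t < b" using t by fastforce
      thus ?thesis
      proof cases
        case 1
        have "norm (y i a - coeff_at N Y i (- int N)) \<le> K * \<tau> + E"
          using norm_triangle_mono[OF end_a err[of "- int N"]] y_start[OF i] by simp
        thus ?thesis using edge_C unfolding 1 collocation_at_ends by linarith
      next
        case 2
        have "norm (y i b - coeff_at N Y i (int N)) \<le> K * \<tau> + E"
          using norm_triangle_mono[OF end_b err[of "int N"]] by simp
        thus ?thesis using edge_C unfolding 2 collocation_at_ends by linarith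
      next
        case 3
        define x where "x = phi_DE a b t"
        define \<beta> where "\<beta> = (\<lambda>x. w_b a b (psi_DE a b x))"
        have t_x: "t = psi_DE a b x" using psi_phi[OF 3] by (simp add: x_def)
        have f_real: "f i (of_real x) = u i (of_real x) - r $ i * of_real (1 - \<beta> x) - y i b * of_real (\<beta> x)" for x
          by (simp add: f_def wb_of_real \<beta>_def)
        have bound: "norm (f i (of_real x) + r $ i * of_real (1 - \<beta> x) + y i b * of_real (\<beta> x) -
            (coeff_at N Y i (- int N) * of_real (1 - \<beta> x) + coeff_at N Y i (int N) * of_real (\<beta> x) +
             (\<Sum>j = - int N..int N. (coeff_at N Y i j - coeff_at N Y i (- int N) * of_real (1 - \<beta> (of_int j * h))
                - coeff_at N Y i (int N) * of_real (\<beta> (of_int j * h))) * of_real (sinc_basis j h x))))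
            \<le> (32 * K' / d * e + (K' * \<tau>) * (1 + 2 / h)) + (K * \<tau> + E) + (2 * E + K * \<tau>) * (8 * m)"
        proof (rule interpolation_perturbation[where u = "\<lambda>j. u i (of_real (of_int j * h))"
              and f = "\<lambda>j. f i (of_real (of_int j * h))" and c = "\<lambda>j. coeff_at N Y i j"])
          show "norm (f i (of_real x) - (\<Sum>j = - int N..int N. f i (of_real (of_int j * h)) * of_real (sinc_basis j h x)))
              \<le> 32 * K' / d * e + (K' * \<tau>) * (1 + 2 / h)" by (rule interp[OF i])
          show "(\<Sum>j = - int N..int N. \<bar>sinc_basis j h x\<bar>) \<le> 8 * m"
            unfolding m_def by (rule lebesgue_constant_le)
          show "0 \<le> \<beta> (of_int j * h) \<and> \<beta> (of_int j * h) \<le> 1" for j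
            unfolding \<beta>_def by (rule w_b_psi_bounds)
          show "0 \<le> \<beta> x" "\<beta> x \<le> 1"
            unfolding \<beta>_def using w_b_psi_bounds by auto
        qed (rule f_real err end_a end_b; assumption?)+
        have y_eq: "f i (of_real x) + r $ i * of_real (1 - \<beta> x) + y i b * of_real (\<beta> x) = y i t"
          unfolding f_real t_x u_y[OF i] by simp
        have "norm (y i t - collocation_solution a b h N Y i t)
            \<le> (32 * K' / d * e + (K' * \<tau>) * (1 + 2 / h)) + (K * \<tau> + E) + (2 * E + K * \<tau>) * (8 * m)"
          using bound unfolding y_eq unfolding t_x collocation_at_psi \<beta>_def .
        also have "(32 * K' / d * e + (K' * \<tau>) * (1 + 2 / h)) + (K * \<tau> + E) + (2 * E + K * \<tau>) * (8 * m)
            \<le> (32 * K' / d * e + (K' * \<tau>) * (1 + 2 / h)) + 9 * ((2 * E + K * \<tau>) * m)"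
        proof -
          have "(2 * E + K * \<tau>) * (8 * m) = 8 * ((2 * E + K * \<tau>) * m)" by (simp only: mult_ac)
          thus ?thesis using edge by linarith
        qed
        also have "\<dots> \<le> C * e" by (rule final[OF interp_e])
        finally show ?thesis .
      qed
    qed
    thus ?thesis using unique unfolding e_eq h_def by blast
  qed
  show ?thesis
    by (intro exI[of _ "max 1 N0"] conjI exI[of _ C] allI impI main) auto
qed

end

theorem theorem10:
  fixes a b d \<alpha> :: real
    and n :: nat
    and r :: "complex vec"
    and k :: "nat \<Rightarrow> nat \<Rightarrow> complex \<Rightarrow> complex"
    and g :: "nat \<Rightarrow> complex \<Rightarrow> complex"
    and y :: "nat \<Rightarrow> real \<Rightarrow> complex"
  assumes "a < b" and "n \<ge> 1"
    and "0 < d" and "d < pi / 2"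
    and "0 < \<alpha>" and "\<alpha> \<le> 1"
    and "r \<in> carrier_vec n"
    and "\<And>i j. i < n \<Longrightarrow> j < n \<Longrightarrow>
           (\<lambda>\<zeta>. k i j \<zeta> * Q_fun a b (psi_DE a b \<zeta>)) \<in> L_space a b d \<alpha>"
    and "\<And>i. i < n \<Longrightarrow> (\<lambda>\<zeta>. g i \<zeta> * Q_fun a b (psi_DE a b \<zeta>)) \<in> L_space a b d \<alpha>"
    and "ivp_solution a b n k g r y"
  shows "\<exists>N\<^sub>0\<ge>1. \<exists>C::real. \<forall>N\<ge>N\<^sub>0.
           (\<exists>!Y. system_solution a b n k g r (step_size d \<alpha> N) N Y) \<and>
           (\<forall>Y. system_solution a b n k g r (step_size d \<alpha> N) N Y \<longrightarrow>
              (\<forall>i<n. \<forall>t\<in>{a..b}.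
                 norm (y i t - collocation_solution a b (step_size d \<alpha> N) N Y i t)
                   \<le> C * exp (- pi * d * real N / ln (2 * d * real N / \<alpha>))))"
proof -
  interpret de_ivp a b d \<alpha> n r k g y
    by unfold_locales (use assms in auto)
  show ?thesis by (rule convergence)
qed

end
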